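(* Let $E$ be a finite graph and $K$ a field. Let $$E=E_0\rightarrow E_1\rightarrow\cdots\rightarrow E_i\rightarrow\cdots\rightarrow E_t=E_{sf}$$ be a sequence of graphs which arises in some step-by-step process of source eliminations. Then the following statements are true: (1) If some $E_i$ ($0\le i\le t$) contains an isolated vertex, then $L_K(E)$ has Invariant Basis Number. (2) If no $E_i$ ($0\le i\le t$) contains an isolated vertex, then there exists a finite source-free graph $F$ satisfying the following conditions: (i) $L_K(E)\cong L_K(F)$; (ii) the cycles of $F$ without exits are in one-to-one correspondence to the cycles of $E$ without exits; (iii) the source cycles of $F$ are in one-to-one correspondence to the source cycles of $E_{sf}$.
   Context: A (directed) graph $E=(E^0,E^1,s,r)$ consists of two disjoint sets $E^0$ (vertices) and $E^1$ (edges) and maps $s,r:E^1\to E^0$ (source and range). It is finite if $E^0$ and $E^1$ are finite; $E^0$ is assumed nonempty. A vertex $v$ is a sink if $s^{-1}(v)=\emptyset$, a source if $r^{-1}(v)=\emptyset$, isolated if it is both a source and a sink, and regular if $0<|s^{-1}(v)|<\infty$. A graph is source-free if it has no sources. A path is a sequence of edges $p=e_1\cdots e_n$ with $r(e_i)=s(e_{i+1})$ for $i=1,\dots,n-1$; $s(p)=s(e_1)$, $r(p)=r(e_n)$, and $p^0=\{s(e_i),r(e_i)\mid i=1,\dots,n\}$ is its set of vertices. A cycle is a path $p$ with $s(p)=r(p)$ that does not revisit any other vertex. An edge $f$ is an exit for $p=e_1\cdots e_n$ if $s(f)=s(e_i)$ but $f\ne e_i$ for some $1\le i\le n$. A cycle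 $c$ is a source cycle if $|r^{-1}(v)|=1$ for all $v\in c^0$. Source elimination: if $v$ is a source of $E$, $E_{\setminus v}$ is the graph with vertices $E^0\setminus\{v\}$, edges $E^1\setminus s^{-1}(v)$, and source and range maps restricted from $E$. A step-by-step process of source eliminations starting at the finite graph $E$ is a sequence $E=E_0\to E_1\to\cdots\to E_t$ in which each $E_{i+1}$ is $(E_i)_{\setminus v}$ for some source $v$ of $E_i$, continued until a source-free graph $E_t=:E_{sf}$ is reached; with the convention, to avoid the empty graph, that if $E_{t-1}$ is the graph $E_{triv}$ consisting of one vertex and no edges, then $E_t=E_{sf}:=E_{triv}$. (The resulting $E_{sf}$ does not depend on the order of eliminations.) For a field $K$, the Leavitt path algebra $L_K(E)$ is the $K$-algebra generated by $\{v,e,e^*\mid v\in E^0,e\in E^1\}$ subject to, for all $v,w\in E^0$, $e,f\in E^1$: (1) $vw=\delta_{v,w}w$; (2) $s(e)e=e=e\,r(e)$ and $r(e)e^*=e^*=e^*s(e)$; (3) $e^*f=\delta_{e,f}r(e)$; (4) $v=\sum_{e\in s^{-1}(v)}ee^*$ for every regular vertex $v$. For finite $E$ it is unital with identity $\sum_{v\in E^0}v$. A unital ring $R$ has Invariant Basis Number if for all positive integers $m,n$, $R^m\cong R^n$ as right $R$-modules implies $m=n$.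
   Formalization: In (ii) and (iii) cycles are counted up to the choice of base point (cyclic rotation); with based cycles the claim fails, e.g. for a loop at w plus an edge v→w, where F must be the 2-cycle. *)

theory Defs
  imports
    "HOL-Library.Poly_Mapping"
    "HOL-Library.FuncSet"
    "HOL-Algebra.QuotRing"
    "HOL-Algebra.Module"
    "Graph_Theory.Arc_Walk"
begin

section \<open>Directed graphs and source elimination\<close>

text \<open>
  A graph is a \<^typ>\<open>('v, 'e) pre_digraph\<close> satisfying \<^const>\<open>wf_digraph\<close>, with \<^const>\<open>tail\<close> as
  source map and \<^const>\<open>head\<close> as range map, so that the fibres of the two maps over \<open>v\<close> are
  \<^term>\<open>out_arcs G v\<close> and \<^term>\<open>in_arcs G v\<close>. Vertices and edges have different types and are
  hence disjoint.
\<close>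

definition is_sink :: "('v, 'e) pre_digraph \<Rightarrow> 'v \<Rightarrow> bool" where
  "is_sink G v \<longleftrightarrow> v \<in> verts G \<and> out_arcs G v = {}"

definition is_source :: "('v, 'e) pre_digraph \<Rightarrow> 'v \<Rightarrow> bool" where
  "is_source G v \<longleftrightarrow> v \<in> verts G \<and> in_arcs G v = {}"

definition is_isolated :: "('v, 'e) pre_digraph \<Rightarrow> 'v \<Rightarrow> bool" where
  "is_isolated G v \<longleftrightarrow> is_source G v \<and> is_sink G v"

definition is_regular :: "('v, 'e) pre_digraph \<Rightarrow> 'v \<Rightarrow> bool" where
  "is_regular G v \<longleftrightarrow> v \<in> verts G \<and> out_arcs G v \<noteq> {} \<and> finite (out_arcs G v)"

definition source_free :: "('v, 'e) pre_digraph \<Rightarrow> bool" where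
  "source_free G \<longleftrightarrow> (\<nexists>v. is_source G v)"

definition eliminate_source :: "('v, 'e) pre_digraph \<Rightarrow> 'v \<Rightarrow> ('v, 'e) pre_digraph" where
  "eliminate_source G v =
     \<lparr>verts = verts G - {v}, arcs = arcs G - out_arcs G v, tail = tail G, head = head G\<rparr>"

definition trivial_graph :: "('v, 'e) pre_digraph \<Rightarrow> bool" where
  "trivial_graph G \<longleftrightarrow> (\<exists>v. verts G = {v}) \<and> arcs G = {}"

text \<open>
  The one-vertex graph without edges is not source-free, and eliminating its vertex would give the
  empty graph. A process that arrives at it instead repeats it once and stops there.
\<close>

definition source_elimination_process ::
    "('v, 'e) pre_digraph \<Rightarrow> (nat \<Rightarrow> ('v, 'e) pre_digraph) \<Rightarrow> nat \<Rightarrow> bool" where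
  "source_elimination_process E Es t \<longleftrightarrow>
     Es 0 = E \<and>
     (\<forall>i<t. if trivial_graph (Es i) then Suc i = t \<and> Es (Suc i) = Es i
            else \<exists>v. is_source (Es i) v \<and> Es (Suc i) = eliminate_source (Es i) v) \<and>
     (source_free (Es t) \<or> 0 < t \<and> trivial_graph (Es (t - 1)))"

section \<open>Cycles\<close>

definition has_exit :: "('v, 'e) pre_digraph \<Rightarrow> 'e list \<Rightarrow> bool" where
  "has_exit G p \<longleftrightarrow> (\<exists>f\<in>arcs G. \<exists>e\<in>set p. tail G f = tail G e \<and> f \<noteq> e)"

definition path_verts :: "('v, 'e) pre_digraph \<Rightarrow> 'e list \<Rightarrow> 'v set" where
  "path_verts G p = tail G ` set p \<union> head G ` set p"

definition source_cycle :: "('v, 'e) pre_digraph \<Rightarrow> 'e list \<Rightarrow> bool" where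
  "source_cycle G c \<longleftrightarrow> pre_digraph.cycle G c \<and> (\<forall>v\<in>path_verts G c. card (in_arcs G v) = 1)"

text \<open>
  Cycles are counted up to the choice of the base point: \<^term>\<open>cycle_class c\<close> consists of all
  cyclic rotations of the edge sequence \<open>c\<close>. Subdividing an edge of a cycle increases the number of its
  base points but yields a single cycle in this sense.
\<close>

definition cycle_class :: "'e list \<Rightarrow> 'e list set" where
  "cycle_class c = range (\<lambda>n. rotate n c)"

definition cycles_without_exits :: "('v, 'e) pre_digraph \<Rightarrow> 'e list set set" where
  "cycles_without_exits G = cycle_class ` {c. pre_digraph.cycle G c \<and> \<not> has_exit G c}"

definition source_cycles :: "('v, 'e) pre_digraph \<Rightarrow> 'e list set set" where
  "source_cycles G = cycle_class ` {c. source_cycle G c}"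

section \<open>Algebras given by generators and relations\<close>

datatype 'a free_monoid = Word (letters: "'a list")

instantiation free_monoid :: (type) monoid_add
begin

definition zero_free_monoid :: "'a free_monoid" where
  "0 = Word []"

definition plus_free_monoid :: "'a free_monoid \<Rightarrow> 'a free_monoid \<Rightarrow> 'a free_monoid" where
  "u + v = Word (letters u @ letters v)"

instance
  by standard (simp_all add: zero_free_monoid_def plus_free_monoid_def)

end

text \<open>
  The monoid ring of the free monoid over \<open>'a\<close>, that is, the unital free algebra over \<open>'a\<close>, is
  \<^typ>\<open>'a free_monoid \<Rightarrow>\<^sub>0 'k\<close>; the monoid is written additively because \<open>Poly_Mapping\<close> requires it.
\<close>

definition gen :: "'a \<Rightarrow> ('a free_monoid \<Rightarrow>\<^sub>0 'k::field)" where
  "gen x = Poly_Mapping.single (Word [x]) 1"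

definition scale :: "'k::field \<Rightarrow> ('a free_monoid \<Rightarrow>\<^sub>0 'k) \<Rightarrow> ('a free_monoid \<Rightarrow>\<^sub>0 'k)" where
  "scale k f = Poly_Mapping.map ((*) k) f"

text \<open>The free algebra, not necessarily unital, on the set \<open>X\<close>: no constant terms.\<close>

definition free_algebra :: "'a set \<Rightarrow> ('a free_monoid \<Rightarrow>\<^sub>0 'k::field) set" where
  "free_algebra X =
     {f. \<forall>w\<in>Poly_Mapping.keys f. letters w \<noteq> [] \<and> set (letters w) \<subseteq> X}"

inductive_set generated_ideal ::
    "'a set \<Rightarrow> ('a free_monoid \<Rightarrow>\<^sub>0 'k::field) set \<Rightarrow> ('a free_monoid \<Rightarrow>\<^sub>0 'k) set"
  for X R where
  zero: "0 \<in> generated_ideal X R"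
| relation: "r \<in> R \<Longrightarrow> r \<in> generated_ideal X R"
| add: "f \<in> generated_ideal X R \<Longrightarrow> g \<in> generated_ideal X R \<Longrightarrow> f + g \<in> generated_ideal X R"
| scale: "f \<in> generated_ideal X R \<Longrightarrow> scale k f \<in> generated_ideal X R"
| left: "a \<in> free_algebra X \<Longrightarrow> f \<in> generated_ideal X R \<Longrightarrow> a * f \<in> generated_ideal X R"
| right: "f \<in> generated_ideal X R \<Longrightarrow> a \<in> free_algebra X \<Longrightarrow> f * a \<in> generated_ideal X R"

section \<open>Leavitt path algebras\<close>

datatype ('v, 'e) leavitt_gen = Vertex 'v | Edge 'e | Ghost 'e

type_synonym ('v, 'e, 'k) leavitt_poly = "('v, 'e) leavitt_gen free_monoid \<Rightarrow>\<^sub>0 'k"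

definition leavitt_gens :: "('v, 'e) pre_digraph \<Rightarrow> ('v, 'e) leavitt_gen set" where
  "leavitt_gens E = Vertex ` verts E \<union> Edge ` arcs E \<union> Ghost ` arcs E"

definition leavitt_relations :: "('v, 'e) pre_digraph \<Rightarrow> ('v, 'e, 'k::field) leavitt_poly set" where
  "leavitt_relations E =
     {gen (Vertex v) * gen (Vertex w) - (if v = w then gen (Vertex w) else 0) | v w.
        v \<in> verts E \<and> w \<in> verts E} \<union>
     {gen (Vertex (tail E e)) * gen (Edge e) - gen (Edge e) | e. e \<in> arcs E} \<union>
     {gen (Edge e) * gen (Vertex (head E e)) - gen (Edge e) | e. e \<in> arcs E} \<union>
     {gen (Vertex (head E e)) * gen (Ghost e) - gen (Ghost e) | e. e \<in> arcs E} \<union>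
     {gen (Ghost e) * gen (Vertex (tail E e)) - gen (Ghost e) | e. e \<in> arcs E} \<union>
     {gen (Ghost e) * gen (Edge f) - (if e = f then gen (Vertex (head E e)) else 0) | e f.
        e \<in> arcs E \<and> f \<in> arcs E} \<union>
     {gen (Vertex v) - (\<Sum>e\<in>out_arcs E v. gen (Edge e) * gen (Ghost e)) | v. is_regular E v}"

definition leavitt_ideal :: "('v, 'e) pre_digraph \<Rightarrow> ('v, 'e, 'k::field) leavitt_poly set" where
  "leavitt_ideal E = generated_ideal (leavitt_gens E) (leavitt_relations E)"

definition leavitt_class ::
    "('v, 'e) pre_digraph \<Rightarrow> ('v, 'e, 'k::field) leavitt_poly \<Rightarrow> ('v, 'e, 'k) leavitt_poly set" where
  "leavitt_class E f = {g. g - f \<in> leavitt_ideal E}"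

text \<open>
  The record \<open>module\<close> of \<open>HOL-Algebra\<close> extends the ring operations by a scalar multiplication. The
  field \<open>one\<close> is the identity element if the graph has finitely many vertices, and is meaningless
  otherwise.
\<close>

definition leavitt_path_algebra ::
    "'k::field itself \<Rightarrow> ('v, 'e) pre_digraph \<Rightarrow> ('k, ('v, 'e, 'k) leavitt_poly set) module" where
  "leavitt_path_algebra K E =
     \<lparr>carrier = leavitt_class E ` free_algebra (leavitt_gens E),
      mult = (\<lambda>A B. \<Union>f\<in>A. \<Union>g\<in>B. leavitt_class E (f * g)),
      one = leavitt_class E (\<Sum>v\<in>verts E. gen (Vertex v)),
      zero = leavitt_class E 0,
      add = (\<lambda>A B. \<Union>f\<in>A. \<Union>g\<in>B. leavitt_class E (f + g)),
      smult = (\<lambda>k A. \<Union>f\<in>A. leavitt_class E (scale k f))\<rparr>"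

text \<open>Isomorphism of unital algebras over the field \<open>'k\<close>.\<close>

definition algebra_isomorphic :: "('k, 'a) module \<Rightarrow> ('k, 'b) module \<Rightarrow> bool" where
  "algebra_isomorphic A B \<longleftrightarrow>
     (\<exists>h\<in>ring_iso A B. \<forall>k. \<forall>x\<in>carrier A. h (k \<odot>\<^bsub>A\<^esub> x) = k \<odot>\<^bsub>B\<^esub> h x)"

section \<open>Invariant Basis Number\<close>

definition free_right_module :: "('a, 'b) ring_scheme \<Rightarrow> nat \<Rightarrow> (nat \<Rightarrow> 'a) set" where
  "free_right_module R n = Pi\<^sub>E {..<n} (\<lambda>_. carrier R)"

definition free_right_modules_isomorphic :: "('a, 'b) ring_scheme \<Rightarrow> nat \<Rightarrow> nat \<Rightarrow> bool" where
  "free_right_modules_isomorphic R m n \<longleftrightarrow>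
     (\<exists>h. bij_betw h (free_right_module R m) (free_right_module R n) \<and>
        (\<forall>x\<in>free_right_module R m. \<forall>y\<in>free_right_module R m.
           h (\<lambda>i\<in>{..<m}. x i \<oplus>\<^bsub>R\<^esub> y i) = (\<lambda>i\<in>{..<n}. h x i \<oplus>\<^bsub>R\<^esub> h y i)) \<and>
        (\<forall>x\<in>free_right_module R m. \<forall>r\<in>carrier R.
           h (\<lambda>i\<in>{..<m}. x i \<otimes>\<^bsub>R\<^esub> r) = (\<lambda>i\<in>{..<n}. h x i \<otimes>\<^bsub>R\<^esub> r)))"

definition invariant_basis_number :: "('a, 'b) ring_scheme \<Rightarrow> bool" where
  "invariant_basis_number R \<longleftrightarrow>
     (\<forall>m n. 0 < m \<longrightarrow> 0 < n \<longrightarrow> free_right_modules_isomorphic R m n \<longrightarrow> m = n)"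

end

theory Submission
  imports Defs
begin

text \<open>
  If a graph of the process has an isolated vertex \<open>z\<close>, then \<open>z\<close> is a sink of \<open>E\<close> all of whose
  ancestors are eliminated, so only finitely many paths end in \<open>z\<close>. The Leavitt path algebra acts on
  the vector space with these paths as basis; this gives a unital homomorphism into a matrix ring
  over the field, and the invariant basis number is inherited.

  Otherwise every eliminated vertex is regular. An edge \<open>e\<close> into a regular vertex may be replaced by
  the edges \<open>e f\<close>, where \<open>f\<close> runs through the edges leaving that vertex: inside the algebra \<open>e\<close>
  is the sum of the \<open>(e f) f\<^sup>*\<close>. Doing this for all edges between eliminated vertices makes them sources
  whose edges all lead into the source-free core, and such a source can be split into sources
  emitting a single edge. If \<open>f\<close> is the only edge leaving \<open>u\<close>, then an edge \<open>e\<close> of the core with the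
  same range as \<open>f\<close> may be redirected to \<open>u\<close>, since this is undone by collapsing \<open>e\<close>. The effect on the
  core is that \<open>e\<close> is subdivided, which changes neither the cycles without exits nor the source
  cycles. All cycles of \<open>E\<close> lie in the core.
\<close>

text \<open>Condition (i) asks for an isomorphism, while deleting a regular source changes the
  algebra and in general preserves it only up to Morita equivalence. The eliminated vertices
  therefore have to stay, and \<open>F\<close> arises by giving each of them an incoming edge. Apart
  from relabelling, only two isomorphisms are used, and both keep track of the identity, the sum of
  the vertices: \<open>collapse\<close> leaves the vertices alone, and \<open>split_source\<close>
  divides one vertex into two orthogonal idempotents.

  The incoming edge has to be taken from the core. It exists because the range of an edge leading
  into a source-free core already receives a core edge. The enlarged core is again source-free, so
  the construction can be repeated.

  Collapsing creates edges and splitting creates vertices, so \<open>E\<close> is first relabelled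
  by natural numbers, where fresh names never run out. Each isomorphism is given by a pair of
  substitutions on generators, which reduces everything to congruences between polynomials modulo
  the relations.\<close>

lemma poly_mapping_single_induct [case_names single add]:
  fixes f :: "'a \<Rightarrow>\<^sub>0 'b::comm_monoid_add"
  assumes single: "\<And>w c. P (Poly_Mapping.single w c)"
    and add: "\<And>f g. P f \<Longrightarrow> P g \<Longrightarrow> P (f + g)"
  shows "P f"
proof (induction f rule: update_induct)
  case const
  show ?case using single[of undefined 0] by simp
next
  case (update f a b)
  have "Poly_Mapping.update a b f = f + Poly_Mapping.single a b"
    using update.hyps
    by (intro poly_mapping_eqI)
      (auto simp: lookup_update lookup_add lookup_single when_def not_in_keys_iff_lookup_eq_zero)
  then show ?case using add[OF update.IH single] by simp
qed

text \<open>Turns scalars into constant polynomials, which are central, so that linearity over the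
  field becomes a case of multiplicativity.\<close>

lemma scale_eq_mult: "scale k f = Poly_Mapping.single 0 k * f"
  unfolding scale_def by (rule mult_map_scale_conv_mult)

lemma single_zero_commute:
  "Poly_Mapping.single 0 (k::'k::field) * f = f * Poly_Mapping.single (0::'a::monoid_add) k"
  by (induction f rule: poly_mapping_single_induct)
    (simp_all add: mult_single distrib_left distrib_right mult.commute)

lemma letters_zero [simp]: "letters 0 = []"
  by (simp add: zero_free_monoid_def)

lemma letters_plus [simp]: "letters (u + w) = letters u @ letters w"
  by (simp add: plus_free_monoid_def)

subsection \<open>Substitution\<close>

text \<open>The unital algebra homomorphism that the universal property of the free algebra attaches
  to \<phi>.\<close>

definition subst ::
    "('a \<Rightarrow> ('b free_monoid \<Rightarrow>\<^sub>0 'k)) \<Rightarrow> ('a free_monoid \<Rightarrow>\<^sub>0 'k::field) \<Rightarrow> ('b free_monoid \<Rightarrow>\<^sub>0 'k)" where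
  "subst \<phi> f = (\<Sum>w\<in>Poly_Mapping.keys f.
     Poly_Mapping.single 0 (Poly_Mapping.lookup f w) * prod_list (map \<phi> (letters w)))"

lemma subst_superset:
  assumes "finite S" "Poly_Mapping.keys f \<subseteq> S"
  shows "subst \<phi> f = (\<Sum>w\<in>S. Poly_Mapping.single 0 (Poly_Mapping.lookup f w) * prod_list (map \<phi> (letters w)))"
  unfolding subst_def
  by (rule sum.mono_neutral_left[OF assms]) (simp add: not_in_keys_iff_lookup_eq_zero)

lemma subst_add: "subst \<phi> (f + g) = subst \<phi> f + subst \<phi> g"
proof -
  let ?S = "Poly_Mapping.keys f \<union> Poly_Mapping.keys g"
  have "subst \<phi> (f + g) = (\<Sum>w\<in>?S. Poly_Mapping.single 0 (Poly_Mapping.lookup (f + g) w) * prod_list (map \<phi> (letters w)))"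
    using keys_add[of f g] by (intro subst_superset) auto
  also have "\<dots> = subst \<phi> f + subst \<phi> g"
    by (simp add: subst_superset[of ?S f] subst_superset[of ?S g] lookup_add single_add distrib_right sum.distrib)
  finally show ?thesis .
qed

lemma subst_single:
  "subst \<phi> (Poly_Mapping.single w c) = Poly_Mapping.single 0 c * prod_list (map \<phi> (letters w))"
  by (subst subst_superset[of "{w}"]) auto

lemma subst_0 [simp]: "subst \<phi> 0 = 0"
  by (simp add: subst_def)

lemma subst_mult: "subst \<phi> (f * g) = subst \<phi> f * subst \<phi> g"
proof (induction f rule: poly_mapping_single_induct)
  case (single u a)
  show ?case
  proof (induction g rule: poly_mapping_single_induct)
    case (single w b)
    let ?P = "\<lambda>w. prod_list (map \<phi> (letters w))"
    have "subst \<phi> (Poly_Mapping.single u a * Poly_Mapping.single w b) =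
        Poly_Mapping.single 0 a * (Poly_Mapping.single 0 b * ?P u) * ?P w"
      by (simp add: mult_single subst_single flip: mult.assoc)
    also have "Poly_Mapping.single 0 b * ?P u = ?P u * Poly_Mapping.single 0 b"
      by (rule single_zero_commute)
    finally show ?case by (simp add: subst_single mult.assoc)
  qed (simp_all add: subst_add distrib_left)
qed (simp_all add: subst_add distrib_right)

lemma subst_gen [simp]: "subst \<phi> (gen x) = \<phi> x"
  by (simp add: gen_def subst_single)

lemma subst_diff: "subst \<phi> (f - g) = subst \<phi> f - subst \<phi> g"
  by (metis add_diff_cancel subst_add diff_add_cancel)

lemma subst_sum: "subst \<phi> (\<Sum>i\<in>S. f i) = (\<Sum>i\<in>S. subst \<phi> (f i))"
  by (induction S rule: infinite_finite_induct) (simp_all add: subst_add)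

lemma subst_scale: "subst \<phi> (scale k f) = scale k (subst \<phi> f)"
  by (simp add: scale_eq_mult subst_mult subst_single)

subsection \<open>The free algebra without constant terms\<close>

lemma free_algebra_0 [simp]: "0 \<in> free_algebra X"
  by (simp add: free_algebra_def)

lemma free_algebra_gen: "x \<in> X \<Longrightarrow> gen x \<in> free_algebra X"
  by (simp add: free_algebra_def gen_def)

lemma free_algebra_add: "f \<in> free_algebra X \<Longrightarrow> g \<in> free_algebra X \<Longrightarrow> f + g \<in> free_algebra X"
  using keys_add[of f g] by (auto simp: free_algebra_def)

lemma free_algebra_mult:
  assumes "f \<in> free_algebra X" "g \<in> free_algebra X"
  shows "f * g \<in> free_algebra X"
  using keys_mult[of f g] assms by (fastforce simp: free_algebra_def)

lemma free_algebra_scale: "f \<in> free_algebra X \<Longrightarrow> scale k f \<in> free_algebra X"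
  using keys_mult[of "Poly_Mapping.single 0 k" f]
  by (fastforce simp: free_algebra_def scale_eq_mult split: if_splits)

lemma scale_minus_one: "scale (-1) f = - f"
  by (simp add: scale_eq_mult single_uminus)

lemma free_algebra_diff: "f \<in> free_algebra X \<Longrightarrow> g \<in> free_algebra X \<Longrightarrow> f - g \<in> free_algebra X"
  using free_algebra_add[OF _ free_algebra_scale[of g X "-1"], of f] by (simp add: scale_minus_one)

lemma free_algebra_sum: "(\<And>i. i \<in> S \<Longrightarrow> f i \<in> free_algebra X) \<Longrightarrow> (\<Sum>i\<in>S. f i) \<in> free_algebra X"
  by (induction S rule: infinite_finite_induct) (auto intro: free_algebra_add)

lemma free_algebra_prod_list:
  "xs \<noteq> [] \<Longrightarrow> (\<And>x. x \<in> set xs \<Longrightarrow> x \<in> free_algebra X) \<Longrightarrow> prod_list xs \<in> free_algebra X"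
proof (induction xs)
  case (Cons x xs)
  then show ?case by (cases "xs = []") (auto intro: free_algebra_mult)
qed simp

lemma prod_list_gen: "prod_list (map gen xs) = (Poly_Mapping.single (Word xs) 1 :: _ \<Rightarrow>\<^sub>0 'k::field)"
proof (induction xs)
  case Nil
  then show ?case by (simp flip: zero_free_monoid_def)
qed (simp add: gen_def mult_single plus_free_monoid_def)

text \<open>A nonempty word is a product of generators, so no case for the constant 1 arises. This
  matters for \<open>unit_left\<close> and \<open>unit_right\<close>: the sum of the vertices is an
  identity for polynomials without constant term, but is not congruent to 1.\<close>

lemma free_algebra_induct [consumes 1, case_names gen add scale mult]:
  assumes "f \<in> free_algebra X"
    and gen: "\<And>x. x \<in> X \<Longrightarrow> P (gen x)"
    and add: "\<And>f g. f \<in> free_algebra X \<Longrightarrow> g \<in> free_algebra X \<Longrightarrow> P f \<Longrightarrow> P g \<Longrightarrow> P (f + g)"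
    and scale: "\<And>k f. f \<in> free_algebra X \<Longrightarrow> P f \<Longrightarrow> P (scale k f)"
    and mult: "\<And>f g. f \<in> free_algebra X \<Longrightarrow> g \<in> free_algebra X \<Longrightarrow> P f \<Longrightarrow> P g \<Longrightarrow> P (f * g)"
    and zero: "P 0"
  shows "P (f :: 'a free_monoid \<Rightarrow>\<^sub>0 'k::field)"
  using assms(1)
proof (induction f rule: update_induct)
  case const
  show ?case by (rule zero)
next
  case (update f a b)
  have word: "P (prod_list (map gen xs))" if "xs \<noteq> []" "set xs \<subseteq> X" for xs
    using that
  proof (induction xs)
    case (Cons x xs)
    then show ?case
      by (cases "xs = []") (auto intro!: gen mult free_algebra_gen free_algebra_prod_list)
  qed simp
  have keys: "Poly_Mapping.keys (Poly_Mapping.update a b f) = insert a (Poly_Mapping.keys f)"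
    using update.hyps by (auto simp: keys_update)
  have a: "letters a \<noteq> []" "set (letters a) \<subseteq> X" and f: "f \<in> free_algebra X"
    using update.prems by (auto simp: free_algebra_def keys)
  have eq: "Poly_Mapping.update a b f = f + scale b (prod_list (map gen (letters a)))"
    using update.hyps
    by (intro poly_mapping_eqI)
      (auto simp: prod_list_gen scale_eq_mult mult_single
         lookup_update lookup_add lookup_single when_def not_in_keys_iff_lookup_eq_zero)
  have fa: "prod_list (map gen (letters a)) \<in> free_algebra X"
    using a by (auto intro!: free_algebra_prod_list free_algebra_gen)
  show ?case
    unfolding eq by (intro add f update.IH scale free_algebra_scale fa word a)
qed

lemma subst_free_algebra:
  assumes "f \<in> free_algebra X" "\<And>x. x \<in> X \<Longrightarrow> \<phi> x \<in> free_algebra Y"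
  shows "subst \<phi> f \<in> free_algebra Y"
  using assms(1)
  by (induction rule: free_algebra_induct)
    (auto simp: subst_add subst_scale subst_mult assms(2)
      intro: free_algebra_add free_algebra_scale free_algebra_mult)

lemma subst_id: 
  assumes "f \<in> free_algebra X" "\<And>x. x \<in> X \<Longrightarrow> \<phi> x = gen x"
  shows "subst \<phi> f = f"
  using assms(1)
  by (induction rule: free_algebra_induct) (auto simp: subst_add subst_scale subst_mult assms(2))

subsection \<open>Congruence modulo the Leavitt relations\<close>

text \<open>
  In contrast to \<^const>\<open>leavitt_ideal\<close>, this is an ideal of the whole unital free algebra, so that
  congruences can be multiplied without membership conditions.
\<close>

inductive_set full_ideal :: "('v, 'e) pre_digraph \<Rightarrow> ('v, 'e, 'k::field) leavitt_poly set"
  for E where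
  zero: "0 \<in> full_ideal E"
| relation: "r \<in> leavitt_relations E \<Longrightarrow> r \<in> full_ideal E"
| outside: "x \<notin> leavitt_gens E \<Longrightarrow> gen x \<in> full_ideal E"
| add: "f \<in> full_ideal E \<Longrightarrow> g \<in> full_ideal E \<Longrightarrow> f + g \<in> full_ideal E"
| left: "f \<in> full_ideal E \<Longrightarrow> a * f \<in> full_ideal E"
| right: "f \<in> full_ideal E \<Longrightarrow> f * a \<in> full_ideal E"

lemma full_ideal_uminus: "f \<in> full_ideal E \<Longrightarrow> - f \<in> full_ideal E"
  using full_ideal.left[of f E "- 1"] by simp

lemma full_ideal_diff: "f \<in> full_ideal E \<Longrightarrow> g \<in> full_ideal E \<Longrightarrow> f - g \<in> full_ideal E"
  using full_ideal.add[OF _ full_ideal_uminus, of f E g] by simp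

lemma leavitt_relations_free_algebra:
  assumes "wf_digraph E"
  shows "leavitt_relations E \<subseteq> free_algebra (leavitt_gens E)"
proof -
  interpret wf_digraph E by fact
  show ?thesis
    unfolding leavitt_relations_def
    by (auto simp: leavitt_gens_def is_regular_def
        intro!: free_algebra_diff free_algebra_mult free_algebra_gen free_algebra_sum)
qed

lemma leavitt_ideal_free_algebra:
  assumes "wf_digraph E" "f \<in> leavitt_ideal E"
  shows "f \<in> free_algebra (leavitt_gens E)"
  using assms(2) unfolding leavitt_ideal_def
  by (induction rule: generated_ideal.induct)
    (use leavitt_relations_free_algebra[OF assms(1)] in
      \<open>auto intro: free_algebra_add free_algebra_scale free_algebra_mult\<close>)

lemma leavitt_ideal_full: "f \<in> leavitt_ideal E \<Longrightarrow> f \<in> full_ideal E"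
  unfolding leavitt_ideal_def
  by (induction rule: generated_ideal.induct) (auto intro: full_ideal.intros simp: scale_eq_mult)

text \<open>The retraction that kills the generators outside the graph maps the full ideal back.\<close>

lemma full_ideal_iff:
  assumes wf: "wf_digraph E" and f: "f \<in> free_algebra (leavitt_gens E)"
  shows "f \<in> full_ideal E \<longleftrightarrow> f \<in> leavitt_ideal E"
proof
  let ?X = "leavitt_gens E"
  define \<pi> :: "('a, 'b, 'c) leavitt_poly \<Rightarrow> ('a, 'b, 'c) leavitt_poly"
    where "\<pi> = subst (\<lambda>x. if x \<in> ?X then gen x else 0)"
  have \<pi>_id: "\<pi> g = g" if "g \<in> free_algebra ?X" for g
    unfolding \<pi>_def using that by (rule subst_id) simp
  \<comment> \<open>Factors allowed in \<open>full_ideal\<close> may have constant terms, those in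
    \<open>leavitt_ideal\<close> may not. After the retraction a factor is a constant, which acts by
    \<open>scale\<close>, plus an element of the free algebra.\<close>
  have decomp: "\<exists>c a'. a' \<in> free_algebra ?X \<and> \<pi> a = Poly_Mapping.single 0 c + a'" for a
  proof (induction a rule: poly_mapping_single_induct)
    case (single w c)
    have *: "prod_list (map (\<lambda>x. if x \<in> ?X then gen x else 0) xs) \<in> free_algebra ?X" if "xs \<noteq> []"
      for xs :: "('a, 'b) leavitt_gen list"
      using that by (intro free_algebra_prod_list) (auto intro: free_algebra_gen)
    show ?case
    proof (cases "letters w = []")
      case True
      then show ?thesis
        by (intro exI[of _ c] exI[of _ 0]) (simp add: \<pi>_def subst_single)
    next
      case False
      then show ?thesis using *[OF False]
        by (intro exI[of _ 0] exI[of _ "\<pi> (Poly_Mapping.single w c)"])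
          (auto simp: \<pi>_def subst_single intro!: free_algebra_scale simp flip: scale_eq_mult)
    qed
  next
    case (add f g)
    then obtain c a d b where "a \<in> free_algebra ?X" "\<pi> f = Poly_Mapping.single 0 c + a"
      "b \<in> free_algebra ?X" "\<pi> g = Poly_Mapping.single 0 d + b" by blast
    then show ?case
      by (intro exI[of _ "c + d"] exI[of _ "a + b"])
        (auto simp: \<pi>_def subst_add single_add intro: free_algebra_add)
  qed
  have "\<pi> g \<in> leavitt_ideal E" if "g \<in> full_ideal E" for g
    using that
  proof (induction rule: full_ideal.induct)
    case (relation r)
    then have "\<pi> r = r" using leavitt_relations_free_algebra[OF wf] by (intro \<pi>_id) auto
    then show ?case using relation by (simp add: leavitt_ideal_def generated_ideal.relation)
  next
    case (left g a)
    obtain c a' where "a' \<in> free_algebra ?X" "\<pi> a = Poly_Mapping.single 0 c + a'" using decomp by blast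
    then have "\<pi> (a * g) = scale c (\<pi> g) + a' * \<pi> g" "a' \<in> free_algebra ?X"
      by (simp_all add: \<pi>_def subst_mult scale_eq_mult distrib_right)
    then show ?case using left
      by (auto simp: leavitt_ideal_def intro: generated_ideal.intros)
  next
    case (right g a)
    obtain c a' where "a' \<in> free_algebra ?X" "\<pi> a = Poly_Mapping.single 0 c + a'" using decomp by blast
    then have "\<pi> (g * a) = scale c (\<pi> g) + \<pi> g * a'" "a' \<in> free_algebra ?X"
      by (simp_all add: \<pi>_def subst_mult scale_eq_mult distrib_left single_zero_commute)
    then show ?case using right
      by (auto simp: leavitt_ideal_def intro: generated_ideal.intros)
  qed (auto simp: \<pi>_def subst_add leavitt_ideal_def intro: generated_ideal.intros)
  then show "f \<in> full_ideal E \<Longrightarrow> f \<in> leavitt_ideal E" using \<pi>_id[OF f] by metis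
qed (rule leavitt_ideal_full)

definition lcong :: "('v, 'e, 'k) leavitt_poly \<Rightarrow> ('v, 'e) pre_digraph \<Rightarrow> ('v, 'e, 'k::field) leavitt_poly \<Rightarrow> bool"
    (\<open>(_ \<approx>\<^bsub>_\<^esub> _)\<close> [51, 0, 51] 50) where
  "f \<approx>\<^bsub>E\<^esub> g \<longleftrightarrow> f - g \<in> full_ideal E"

lemma lcong_refl [simp]: "f \<approx>\<^bsub>E\<^esub> f"
  by (simp add: lcong_def full_ideal.zero)

lemma lcong_sym: "f \<approx>\<^bsub>E\<^esub> g \<Longrightarrow> g \<approx>\<^bsub>E\<^esub> f"
  using full_ideal_uminus[of "f - g" E] by (simp add: lcong_def)

lemma lcong_trans [trans]: "f \<approx>\<^bsub>E\<^esub> g \<Longrightarrow> g \<approx>\<^bsub>E\<^esub> h \<Longrightarrow> f \<approx>\<^bsub>E\<^esub> h"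
  using full_ideal.add[of "f - g" E "g - h"] by (simp add: lcong_def)

lemma lcong_add: "f \<approx>\<^bsub>E\<^esub> g \<Longrightarrow> f' \<approx>\<^bsub>E\<^esub> g' \<Longrightarrow> f + f' \<approx>\<^bsub>E\<^esub> g + g'"
  using full_ideal.add[of "f - g" E "f' - g'"] by (simp add: lcong_def algebra_simps)

lemma lcong_diff: "f \<approx>\<^bsub>E\<^esub> g \<Longrightarrow> f' \<approx>\<^bsub>E\<^esub> g' \<Longrightarrow> f - f' \<approx>\<^bsub>E\<^esub> g - g'"
  using full_ideal_diff[of "f - g" E "f' - g'"] by (simp add: lcong_def algebra_simps)

lemma lcong_mult:
  assumes "f \<approx>\<^bsub>E\<^esub> g" "f' \<approx>\<^bsub>E\<^esub> g'"
  shows "f * f' \<approx>\<^bsub>E\<^esub> g * g'"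
proof -
  have "f * f' - g * g' = (f - g) * f' + g * (f' - g')" by (simp add: algebra_simps)
  then show ?thesis using assms by (auto simp: lcong_def intro: full_ideal.intros)
qed

lemma lcong_multL: "f \<approx>\<^bsub>E\<^esub> g \<Longrightarrow> h * f \<approx>\<^bsub>E\<^esub> h * g"
  by (rule lcong_mult) simp_all

lemma lcong_multR: "f \<approx>\<^bsub>E\<^esub> g \<Longrightarrow> f * h \<approx>\<^bsub>E\<^esub> g * h"
  by (rule lcong_mult) simp_all

lemma lcong_scale: "f \<approx>\<^bsub>E\<^esub> g \<Longrightarrow> scale k f \<approx>\<^bsub>E\<^esub> scale k g"
  unfolding scale_eq_mult by (rule lcong_multL)

lemma lcong_sum: "(\<And>i. i \<in> S \<Longrightarrow> f i \<approx>\<^bsub>E\<^esub> g i) \<Longrightarrow> (\<Sum>i\<in>S. f i) \<approx>\<^bsub>E\<^esub> (\<Sum>i\<in>S. g i)"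
  by (induction S rule: infinite_finite_induct) (auto intro: lcong_add)

text \<open>The ideal lies inside the free algebra, so the class of an element of the free algebra
  contains no other polynomials. Within the free algebra the two ideals agree, and the congruence
  decides equality of classes.\<close>

lemma leavitt_class_eq_iff:
  assumes wf: "wf_digraph E" and f: "f \<in> free_algebra (leavitt_gens E)" and g: "g \<in> free_algebra (leavitt_gens E)"
  shows "leavitt_class E f = leavitt_class E g \<longleftrightarrow> f \<approx>\<^bsub>E\<^esub> g"
proof -
  have I: "h - f \<in> leavitt_ideal E \<longleftrightarrow> h \<in> free_algebra (leavitt_gens E) \<and> h \<approx>\<^bsub>E\<^esub> f"
    if "f \<in> free_algebra (leavitt_gens E)" for h f
    using free_algebra_diff[OF _ that] free_algebra_add[OF _ that, of "h - f"]
      full_ideal_iff[OF wf, of "h - f"] leavitt_ideal_free_algebra[OF wf, of "h - f"]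
    by (auto simp: lcong_def)
  show ?thesis
    unfolding leavitt_class_def I[OF f] I[OF g]
    using f g by (auto dest: lcong_trans lcong_sym)
qed

lemma leavitt_class_memE:
  assumes wf: "wf_digraph E" and f: "f \<in> free_algebra (leavitt_gens E)" and "g \<in> leavitt_class E f"
  shows "g \<in> free_algebra (leavitt_gens E)" "leavitt_class E g = leavitt_class E f"
proof -
  have *: "g - f \<in> leavitt_ideal E" using assms(3) by (simp add: leavitt_class_def)
  from free_algebra_add[OF leavitt_ideal_free_algebra[OF wf this] f]
  show g: "g \<in> free_algebra (leavitt_gens E)" by simp
  show "leavitt_class E g = leavitt_class E f"
    unfolding leavitt_class_eq_iff[OF wf g f] lcong_def by (rule leavitt_ideal_full[OF *])
qed

lemma leavitt_class_self: "f \<in> leavitt_class E f"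
  by (simp add: leavitt_class_def leavitt_ideal_def generated_ideal.zero)

lemma leavitt_carrier:
  "carrier (leavitt_path_algebra TYPE('k::field) E) = leavitt_class E ` free_algebra (leavitt_gens E)"
  by (simp add: leavitt_path_algebra_def)

lemma leavitt_zero: "\<zero>\<^bsub>leavitt_path_algebra TYPE('k::field) E\<^esub> = leavitt_class E 0"
  by (simp add: leavitt_path_algebra_def)

lemma leavitt_one:
  "\<one>\<^bsub>leavitt_path_algebra TYPE('k::field) E\<^esub> = leavitt_class E (\<Sum>v\<in>verts E. gen (Vertex v))"
  by (simp add: leavitt_path_algebra_def)

text \<open>The union over representatives in the definition is a union of equal sets, because the
  congruence respects products.\<close>

lemma leavitt_mult:
  assumes wf: "wf_digraph E" and "f \<in> free_algebra (leavitt_gens E)" "g \<in> free_algebra (leavitt_gens E)"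
  shows "leavitt_class E f \<otimes>\<^bsub>leavitt_path_algebra TYPE('k::field) E\<^esub> leavitt_class E g = leavitt_class E (f * g)"
proof -
  have "leavitt_class E (f' * g') = leavitt_class E (f * g)"
    if "f' \<in> leavitt_class E f" "g' \<in> leavitt_class E g" for f' g'
    using leavitt_class_memE[OF wf assms(2) that(1)] leavitt_class_memE[OF wf assms(3) that(2)] assms
    by (simp add: leavitt_class_eq_iff[OF wf] free_algebra_mult lcong_mult)
  then have "(\<Union>f'\<in>leavitt_class E f. \<Union>g'\<in>leavitt_class E g. leavitt_class E (f' * g')) = (\<Union>f'\<in>leavitt_class E f. \<Union>g'\<in>leavitt_class E g. leavitt_class E (f * g))"
    by (intro SUP_cong refl)
  also have "\<dots> = leavitt_class E (f * g)" using leavitt_class_self[of f E] leavitt_class_self[of g E] by auto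
  finally show ?thesis by (simp add: leavitt_path_algebra_def)
qed

lemma leavitt_add:
  assumes wf: "wf_digraph E" and "f \<in> free_algebra (leavitt_gens E)" "g \<in> free_algebra (leavitt_gens E)"
  shows "leavitt_class E f \<oplus>\<^bsub>leavitt_path_algebra TYPE('k::field) E\<^esub> leavitt_class E g = leavitt_class E (f + g)"
proof -
  have "leavitt_class E (f' + g') = leavitt_class E (f + g)"
    if "f' \<in> leavitt_class E f" "g' \<in> leavitt_class E g" for f' g'
    using leavitt_class_memE[OF wf assms(2) that(1)] leavitt_class_memE[OF wf assms(3) that(2)] assms
    by (simp add: leavitt_class_eq_iff[OF wf] free_algebra_add lcong_add)
  then have "(\<Union>f'\<in>leavitt_class E f. \<Union>g'\<in>leavitt_class E g. leavitt_class E (f' + g')) = (\<Union>f'\<in>leavitt_class E f. \<Union>g'\<in>leavitt_class E g. leavitt_class E (f + g))"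
    by (intro SUP_cong refl)
  also have "\<dots> = leavitt_class E (f + g)" using leavitt_class_self[of f E] leavitt_class_self[of g E] by auto
  finally show ?thesis by (simp add: leavitt_path_algebra_def)
qed

lemma leavitt_smult:
  assumes wf: "wf_digraph E" and "f \<in> free_algebra (leavitt_gens E)"
  shows "k \<odot>\<^bsub>leavitt_path_algebra TYPE('k::field) E\<^esub> leavitt_class E f = leavitt_class E (scale k f)"
proof -
  have "leavitt_class E (scale k f') = leavitt_class E (scale k f)"
    if "f' \<in> leavitt_class E f" for f'
    using leavitt_class_memE[OF wf assms(2) that(1)] assms
    by (simp add: leavitt_class_eq_iff[OF wf] free_algebra_scale lcong_scale)
  then have "(\<Union>f'\<in>leavitt_class E f. leavitt_class E (scale k f')) = (\<Union>f'\<in>leavitt_class E f. leavitt_class E (scale k f))"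
    by (intro SUP_cong refl)
  also have "\<dots> = leavitt_class E (scale k f)" using leavitt_class_self[of f E] by auto
  finally show ?thesis by (simp add: leavitt_path_algebra_def)
qed

subsection \<open>Leavitt families and isomorphisms\<close>

text \<open>The relations of \<open>E\<close> imposed on elements of the algebra of
  \<open>F\<close>: the data that induce a homomorphism from the algebra of \<open>E\<close> to that
  of \<open>F\<close>.\<close>

definition leavitt_family ::
    "('w, 'f) pre_digraph \<Rightarrow> ('v, 'e) pre_digraph \<Rightarrow> ('v \<Rightarrow> ('w, 'f, 'k::field) leavitt_poly) \<Rightarrow>
     ('e \<Rightarrow> ('w, 'f, 'k) leavitt_poly) \<Rightarrow> ('e \<Rightarrow> ('w, 'f, 'k) leavitt_poly) \<Rightarrow> bool" where
  "leavitt_family F E V A G \<longleftrightarrow>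
     (\<forall>x\<in>verts E. \<forall>y\<in>verts E. V x * V y \<approx>\<^bsub>F\<^esub> (if x = y then V y else 0)) \<and>
     (\<forall>e\<in>arcs E. V (tail E e) * A e \<approx>\<^bsub>F\<^esub> A e \<and> A e * V (head E e) \<approx>\<^bsub>F\<^esub> A e \<and>
        V (head E e) * G e \<approx>\<^bsub>F\<^esub> G e \<and> G e * V (tail E e) \<approx>\<^bsub>F\<^esub> G e) \<and>
     (\<forall>e\<in>arcs E. \<forall>f\<in>arcs E. G e * A f \<approx>\<^bsub>F\<^esub> (if e = f then V (head E e) else 0)) \<and>
     (\<forall>x. is_regular E x \<longrightarrow> V x \<approx>\<^bsub>F\<^esub> (\<Sum>e\<in>out_arcs E x. A e * G e))"

lemma lcong_relation: "f - g \<in> leavitt_relations E \<Longrightarrow> f \<approx>\<^bsub>E\<^esub> g"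
  by (simp add: lcong_def full_ideal.relation)

lemma vertex_vertex:
  fixes E :: "('v, 'e) pre_digraph"
  shows "x \<in> verts E \<Longrightarrow> y \<in> verts E \<Longrightarrow> (gen (Vertex x) :: ('v, 'e, 'k::field) leavitt_poly) * gen (Vertex y) \<approx>\<^bsub>E\<^esub> (if x = y then gen (Vertex y) else 0)"
  by (rule lcong_relation) (unfold leavitt_relations_def, blast)

lemma tail_edge:
  fixes E :: "('v, 'e) pre_digraph"
  shows "e \<in> arcs E \<Longrightarrow> (gen (Vertex (tail E e)) :: ('v, 'e, 'k::field) leavitt_poly) * gen (Edge e) \<approx>\<^bsub>E\<^esub> gen (Edge e)"
  by (rule lcong_relation) (unfold leavitt_relations_def, blast)

lemma edge_head:
  fixes E :: "('v, 'e) pre_digraph"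
  shows "e \<in> arcs E \<Longrightarrow> (gen (Edge e) :: ('v, 'e, 'k::field) leavitt_poly) * gen (Vertex (head E e)) \<approx>\<^bsub>E\<^esub> gen (Edge e)"
  by (rule lcong_relation) (unfold leavitt_relations_def, blast)

lemma head_ghost:
  fixes E :: "('v, 'e) pre_digraph"
  shows "e \<in> arcs E \<Longrightarrow> (gen (Vertex (head E e)) :: ('v, 'e, 'k::field) leavitt_poly) * gen (Ghost e) \<approx>\<^bsub>E\<^esub> gen (Ghost e)"
  by (rule lcong_relation) (unfold leavitt_relations_def, blast)

lemma ghost_tail:
  fixes E :: "('v, 'e) pre_digraph"
  shows "e \<in> arcs E \<Longrightarrow> (gen (Ghost e) :: ('v, 'e, 'k::field) leavitt_poly) * gen (Vertex (tail E e)) \<approx>\<^bsub>E\<^esub> gen (Ghost e)"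
  by (rule lcong_relation) (unfold leavitt_relations_def, blast)

lemma ghost_edge:
  fixes E :: "('v, 'e) pre_digraph"
  shows "e \<in> arcs E \<Longrightarrow> f \<in> arcs E \<Longrightarrow>
    (gen (Ghost e) :: ('v, 'e, 'k::field) leavitt_poly) * gen (Edge f) \<approx>\<^bsub>E\<^esub> (if e = f then gen (Vertex (head E e)) else 0)"
  by (rule lcong_relation) (unfold leavitt_relations_def, blast)

lemma vertex_sum:
  fixes E :: "('v, 'e) pre_digraph"
  shows "is_regular E v \<Longrightarrow> (gen (Vertex v) :: ('v, 'e, 'k::field) leavitt_poly) \<approx>\<^bsub>E\<^esub> (\<Sum>e\<in>out_arcs E v. gen (Edge e) * gen (Ghost e))"
  by (rule lcong_relation) (unfold leavitt_relations_def, blast)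

text \<open>The value 0 off the graph matches the rule \<open>outside\<close> of
  \<open>full_ideal\<close>, so that the substitution respects the full ideals.\<close>

definition gen_map ::
    "('v, 'e) pre_digraph \<Rightarrow> ('v \<Rightarrow> 'a) \<Rightarrow> ('e \<Rightarrow> 'a) \<Rightarrow> ('e \<Rightarrow> 'a) \<Rightarrow> ('v, 'e) leavitt_gen \<Rightarrow> 'a::zero" where
  "gen_map E V A G x = (if x \<in> leavitt_gens E
     then case x of Vertex v \<Rightarrow> V v | Edge e \<Rightarrow> A e | Ghost e \<Rightarrow> G e else 0)"

lemma gen_map_simps [simp]:
  "v \<in> verts E \<Longrightarrow> gen_map E V A G (Vertex v) = V v"
  "e \<in> arcs E \<Longrightarrow> gen_map E V A G (Edge e) = A e"
  "e \<in> arcs E \<Longrightarrow> gen_map E V A G (Ghost e) = G e"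
  by (auto simp: gen_map_def leavitt_gens_def)

lemma leavitt_gensE:
  assumes "x \<in> leavitt_gens E"
  obtains v where "v \<in> verts E" "x = Vertex v" | e where "e \<in> arcs E" "x = Edge e"
    | e where "e \<in> arcs E" "x = Ghost e"
  using assms by (auto simp: leavitt_gens_def)

lemma subst_gen_map_full_ideal:
  assumes wf: "wf_digraph E" and fam: "leavitt_family F E V A G" and f: "f \<in> full_ideal E"
  shows "subst (gen_map E V A G) f \<in> full_ideal F"
  using f
proof (induction rule: full_ideal.induct)
  case (relation r)
  interpret wf_digraph E by fact
  show ?case
    using relation fam[unfolded leavitt_family_def lcong_def]
    by (auto simp: leavitt_relations_def subst_diff subst_mult subst_sum is_regular_def if_distrib[of "subst _"]
        cong: if_cong)
next
  case (outside x)
  then show ?case by (simp add: gen_map_def full_ideal.zero)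
qed (auto simp: subst_add subst_mult intro: full_ideal.intros)

text \<open>Being mutually inverse on generators suffices, because congruences pass through sums,
  scalars and products. The identity of the algebra is the sum of the vertices and not the constant
  1 that a substitution fixes; it enters through \<open>unit\<close>.\<close>

lemma algebra_isomorphicI:
  fixes E :: "('v, 'e) pre_digraph" and F :: "('w, 'f) pre_digraph"
    and V :: "'v \<Rightarrow> ('w, 'f, 'k::field) leavitt_poly" and A G :: "'e \<Rightarrow> ('w, 'f, 'k) leavitt_poly"
    and V' :: "'w \<Rightarrow> ('v, 'e, 'k) leavitt_poly" and A' G' :: "'f \<Rightarrow> ('v, 'e, 'k) leavitt_poly"
  defines "\<phi> \<equiv> gen_map E V A G" and "\<psi> \<equiv> gen_map F V' A' G'"
  assumes wf: "wf_digraph E" "wf_digraph F"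
    and fam: "leavitt_family F E V A G" "leavitt_family E F V' A' G'"
    and fa: "\<And>x. x \<in> leavitt_gens E \<Longrightarrow> \<phi> x \<in> free_algebra (leavitt_gens F)"
      "\<And>x. x \<in> leavitt_gens F \<Longrightarrow> \<psi> x \<in> free_algebra (leavitt_gens E)"
    and inv: "\<And>x. x \<in> leavitt_gens E \<Longrightarrow> subst \<psi> (\<phi> x) \<approx>\<^bsub>E\<^esub> gen x"
      "\<And>x. x \<in> leavitt_gens F \<Longrightarrow> subst \<phi> (\<psi> x) \<approx>\<^bsub>F\<^esub> gen x"
    and unit: "(\<Sum>v\<in>verts E. V v) \<approx>\<^bsub>F\<^esub> (\<Sum>v\<in>verts F. gen (Vertex v))"
  shows "algebra_isomorphic (leavitt_path_algebra TYPE('k) E) (leavitt_path_algebra TYPE('k) F)"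
proof -
  let ?FE = "free_algebra (leavitt_gens E) :: ('v, 'e, 'k) leavitt_poly set"
  let ?FF = "free_algebra (leavitt_gens F) :: ('w, 'f, 'k) leavitt_poly set"
  let ?LE = "leavitt_path_algebra TYPE('k) E" and ?LF = "leavitt_path_algebra TYPE('k) F"
  have cong\<phi>: "subst \<phi> f \<approx>\<^bsub>F\<^esub> subst \<phi> g" if "f \<approx>\<^bsub>E\<^esub> g" for f g
    using subst_gen_map_full_ideal[OF wf(1) fam(1)] that by (simp add: lcong_def \<phi>_def flip: subst_diff)
  have cong\<psi>: "subst \<psi> f \<approx>\<^bsub>E\<^esub> subst \<psi> g" if "f \<approx>\<^bsub>F\<^esub> g" for f g
    using subst_gen_map_full_ideal[OF wf(2) fam(2)] that by (simp add: lcong_def \<psi>_def flip: subst_diff)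
  have fa\<phi>: "subst \<phi> f \<in> ?FF" if "f \<in> ?FE" for f using that fa(1) by (rule subst_free_algebra)
  have fa\<psi>: "subst \<psi> f \<in> ?FE" if "f \<in> ?FF" for f using that fa(2) by (rule subst_free_algebra)
  have inv\<psi>: "subst \<psi> (subst \<phi> f) \<approx>\<^bsub>E\<^esub> f" if "f \<in> ?FE" for f
    using that by (induction rule: free_algebra_induct)
      (auto simp: subst_add subst_mult subst_scale inv intro: lcong_add lcong_mult lcong_scale)
  have inv\<phi>: "subst \<phi> (subst \<psi> f) \<approx>\<^bsub>F\<^esub> f" if "f \<in> ?FF" for f
    using that by (induction rule: free_algebra_induct)
      (auto simp: subst_add subst_mult subst_scale inv intro: lcong_add lcong_mult lcong_scale)
  define h where "h X = (\<Union>f\<in>X. leavitt_class F (subst \<phi> f))" for X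
  have h: "h (leavitt_class E f) = leavitt_class F (subst \<phi> f)" if f: "f \<in> ?FE" for f
  proof -
    have "leavitt_class F (subst \<phi> g) = leavitt_class F (subst \<phi> f)" if "g \<in> leavitt_class E f" for g
      using leavitt_class_memE[OF wf(1) f that] f cong\<phi>
      by (simp add: leavitt_class_eq_iff wf fa\<phi>)
    then have "h (leavitt_class E f) = (\<Union>g\<in>leavitt_class E f. leavitt_class F (subst \<phi> f))"
      unfolding h_def by (intro SUP_cong refl)
    also have "\<dots> = leavitt_class F (subst \<phi> f)" using leavitt_class_self[of f E] by auto
    finally show ?thesis .
  qed
  note ops = leavitt_carrier leavitt_mult leavitt_add leavitt_smult leavitt_one
  have one: "(\<Sum>v\<in>verts G. gen (Vertex v)) \<in> free_algebra (leavitt_gens G)"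
    for G :: "('x, 'y) pre_digraph"
    by (auto simp: leavitt_gens_def intro!: free_algebra_sum free_algebra_gen)
  have "h \<in> ring_hom ?LE ?LF"
  proof (rule ring_hom_memI)
    show "h \<one>\<^bsub>?LE\<^esub> = \<one>\<^bsub>?LF\<^esub>"
      using unit by (simp add: ops wf h one leavitt_class_eq_iff fa\<phi>) (simp add: subst_sum \<phi>_def)
  qed (auto simp: ops wf h fa\<phi> free_algebra_add free_algebra_mult subst_add subst_mult)
  moreover have "inj_on h (carrier ?LE)"
  proof (rule inj_onI, clarsimp simp: ops wf)
    fix f g assume fg: "f \<in> ?FE" "g \<in> ?FE" "h (leavitt_class E f) = h (leavitt_class E g)"
    then have "subst \<psi> (subst \<phi> f) \<approx>\<^bsub>E\<^esub> subst \<psi> (subst \<phi> g)"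
      by (intro cong\<psi>) (simp add: h leavitt_class_eq_iff wf fa\<phi>)
    then show "leavitt_class E f = leavitt_class E g"
      using fg inv\<psi> by (simp add: leavitt_class_eq_iff wf) (meson lcong_sym lcong_trans)
  qed
  moreover have "carrier ?LF \<subseteq> h ` carrier ?LE"
  proof (clarsimp simp: ops wf)
    fix f assume f: "f \<in> ?FF"
    then have "leavitt_class F f = h (leavitt_class E (subst \<psi> f))"
      by (simp add: h fa\<psi> leavitt_class_eq_iff wf fa\<phi>) (meson lcong_sym inv\<phi>)
    then show "leavitt_class F f \<in> h ` leavitt_class E ` ?FE" using fa\<psi>[OF f] by auto
  qed
  moreover have "h ` carrier ?LE \<subseteq> carrier ?LF" by (auto simp: ops wf h fa\<phi>)
  ultimately have "h \<in> ring_iso ?LE ?LF"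
    by (auto simp: ring_iso_def bij_betw_def)
  moreover have "\<forall>k. \<forall>x\<in>carrier ?LE. h (k \<odot>\<^bsub>?LE\<^esub> x) = k \<odot>\<^bsub>?LF\<^esub> h x"
    by (auto simp: ops wf h fa\<phi> free_algebra_scale subst_scale)
  ultimately show ?thesis by (auto simp: algebra_isomorphic_def)
qed

subsection \<open>The ring structure\<close>

text \<open>Every generator absorbs a vertex on its left, and orthogonality makes the other vertices
  vanish.\<close>

lemma unit_left:
  assumes "fin_digraph E" and "f \<in> free_algebra (leavitt_gens E)"
  shows "(\<Sum>v\<in>verts E. gen (Vertex v)) * f \<approx>\<^bsub>E\<^esub> f"
  using assms(2)
proof (induction rule: free_algebra_induct)
  interpret fin_digraph E by fact
  let ?u = "\<Sum>v\<in>verts E. gen (Vertex v) :: ('a, 'b, 'c) leavitt_poly"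
  have v: "?u * gen (Vertex w) \<approx>\<^bsub>E\<^esub> gen (Vertex w)" if "w \<in> verts E" for w
  proof -
    have "?u * gen (Vertex w) \<approx>\<^bsub>E\<^esub> (\<Sum>v\<in>verts E. if v = w then gen (Vertex w) else 0)"
      unfolding sum_distrib_right by (intro lcong_sum vertex_vertex that)
    also have "(\<Sum>v\<in>verts E. if v = w then gen (Vertex w) else 0) = gen (Vertex w)" using that by simp
    finally show ?thesis .
  qed
  have vg: "?u * g \<approx>\<^bsub>E\<^esub> g" if "w \<in> verts E" "gen (Vertex w) * g \<approx>\<^bsub>E\<^esub> g" for w g
  proof -
    have "?u * g \<approx>\<^bsub>E\<^esub> ?u * (gen (Vertex w) * g)" by (intro lcong_multL lcong_sym[OF that(2)])
    also have "\<dots> = (?u * gen (Vertex w)) * g" by (simp add: mult.assoc)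
    also have "\<dots> \<approx>\<^bsub>E\<^esub> gen (Vertex w) * g" by (intro lcong_multR v that)
    also note that(2)
    finally show ?thesis .
  qed
  case (gen x)
  then show ?case
    by (cases rule: leavitt_gensE) (auto intro: v vg[OF _ tail_edge] vg[OF _ head_ghost])
next
  case (add f g)
  then show ?case by (simp add: distrib_left lcong_add)
next
  case (scale k f)
  then show ?case
    using lcong_scale[OF scale(2), of k] by (simp add: scale_eq_mult single_zero_commute mult.assoc)
next
  case (mult f g)
  then show ?case using lcong_multR[OF mult(3), of g] by (simp add: mult.assoc)
qed simp

lemma unit_right:
  assumes "fin_digraph E" and "f \<in> free_algebra (leavitt_gens E)"
  shows "f * (\<Sum>v\<in>verts E. gen (Vertex v)) \<approx>\<^bsub>E\<^esub> f"
  using assms(2)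
proof (induction rule: free_algebra_induct)
  interpret fin_digraph E by fact
  let ?u = "\<Sum>v\<in>verts E. gen (Vertex v) :: ('a, 'b, 'c) leavitt_poly"
  have v: "gen (Vertex w) * ?u \<approx>\<^bsub>E\<^esub> gen (Vertex w)" if "w \<in> verts E" for w
  proof -
    have "gen (Vertex w) * ?u \<approx>\<^bsub>E\<^esub> (\<Sum>v\<in>verts E. if w = v then gen (Vertex v) else 0)"
      unfolding sum_distrib_left by (intro lcong_sum vertex_vertex that)
    also have "(\<Sum>v\<in>verts E. if w = v then gen (Vertex v) else 0) = gen (Vertex w)" using that by simp
    finally show ?thesis .
  qed
  have vg: "g * ?u \<approx>\<^bsub>E\<^esub> g" if "w \<in> verts E" "g * gen (Vertex w) \<approx>\<^bsub>E\<^esub> g" for w g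
  proof -
    have "g * ?u \<approx>\<^bsub>E\<^esub> (g * gen (Vertex w)) * ?u" by (intro lcong_multR lcong_sym[OF that(2)])
    also have "\<dots> = g * (gen (Vertex w) * ?u)" by (simp add: mult.assoc)
    also have "\<dots> \<approx>\<^bsub>E\<^esub> g * gen (Vertex w)" by (intro lcong_multL v that)
    also note that(2)
    finally show ?thesis .
  qed
  case (gen x)
  then show ?case
    by (cases rule: leavitt_gensE) (auto intro: v vg[OF _ edge_head] vg[OF _ ghost_tail])
next
  case (add f g)
  then show ?case by (simp add: distrib_right lcong_add)
next
  case (scale k f)
  then show ?case
    using lcong_scale[OF scale(2), of k] by (simp add: scale_eq_mult mult.assoc)
next
  case (mult f g)
  then show ?case using lcong_multL[OF mult(4), of f] by (simp add: mult.assoc)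
qed simp

lemma ring_leavitt_path_algebra:
  assumes "fin_digraph E"
  shows "ring (leavitt_path_algebra TYPE('k::field) E)"
proof -
  interpret fin_digraph E by fact
  let ?L = "leavitt_path_algebra TYPE('k) E"
  let ?F = "free_algebra (leavitt_gens E) :: ('a, 'b, 'k) leavitt_poly set"
  have wf: "wf_digraph E" by unfold_locales
  have one: "(\<Sum>v\<in>verts E. gen (Vertex v)) \<in> ?F"
    by (auto simp: leavitt_gens_def intro!: free_algebra_sum free_algebra_gen)
  note ops = leavitt_carrier leavitt_mult[OF wf] leavitt_add[OF wf] leavitt_zero leavitt_one
    free_algebra_add free_algebra_mult one algebra_simps
  have ex: "\<exists>g\<in>?F. leavitt_class E (f + g) = leavitt_class E 0" if "f \<in> ?F" for f
    using free_algebra_diff[OF free_algebra_0 that] by (intro bexI[of _ "- f"]) auto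
  have unit: "leavitt_class E ((\<Sum>v\<in>verts E. gen (Vertex v)) * f) = leavitt_class E f"
    "leavitt_class E (f * (\<Sum>v\<in>verts E. gen (Vertex v))) = leavitt_class E f" if "f \<in> ?F" for f
    using that unit_left[OF assms] unit_right[OF assms]
    by (simp_all add: leavitt_class_eq_iff[OF wf] free_algebra_mult one)
  show ?thesis
    by (intro ringI abelian_groupI monoidI) (auto simp: ops unit ex)
qed

section \<open>Isomorphism as an equivalence relation\<close>

lemma algebra_isomorphic_sym:
  assumes "ring A" "algebra_isomorphic A B"
    and closed: "\<And>k x. x \<in> carrier A \<Longrightarrow> k \<odot>\<^bsub>A\<^esub> x \<in> carrier A"
  shows "algebra_isomorphic B A"
proof -
  obtain h where h: "h \<in> ring_iso A B" "\<And>k x. x \<in> carrier A \<Longrightarrow> h (k \<odot>\<^bsub>A\<^esub> x) = k \<odot>\<^bsub>B\<^esub> h x"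
    using assms(2) by (auto simp: algebra_isomorphic_def)
  then have bij: "bij_betw h (carrier A) (carrier B)" by (simp add: ring_iso_def)
  have "inv_into (carrier A) h (k \<odot>\<^bsub>B\<^esub> y) = k \<odot>\<^bsub>A\<^esub> inv_into (carrier A) h y" if y: "y \<in> carrier B" for k y
  proof -
    have x: "inv_into (carrier A) h y \<in> carrier A" "h (inv_into (carrier A) h y) = y"
      using bij y by (auto simp: bij_betw_def inv_into_into f_inv_into_f)
    then have "k \<odot>\<^bsub>B\<^esub> y = h (k \<odot>\<^bsub>A\<^esub> inv_into (carrier A) h y)" by (simp add: h)
    then show ?thesis using bij closed[OF x(1)] by (simp add: bij_betw_def)
  qed
  then show ?thesis using ring_iso_set_sym[OF assms(1) h(1)] by (auto simp: algebra_isomorphic_def)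
qed

lemma algebra_isomorphic_trans:
  assumes "algebra_isomorphic A B" "algebra_isomorphic B C"
  shows "algebra_isomorphic A C"
proof -
  obtain g h where "g \<in> ring_iso A B" "\<And>k x. x \<in> carrier A \<Longrightarrow> g (k \<odot>\<^bsub>A\<^esub> x) = k \<odot>\<^bsub>B\<^esub> g x"
    "h \<in> ring_iso B C" "\<And>k x. x \<in> carrier B \<Longrightarrow> h (k \<odot>\<^bsub>B\<^esub> x) = k \<odot>\<^bsub>C\<^esub> h x"
    using assms by (auto simp: algebra_isomorphic_def)
  then show ?thesis
    using ring_iso_set_trans[of g A B h C] ring_iso_memE(1)[of g A B]
    by (auto simp: algebra_isomorphic_def intro!: bexI[of _ "h \<circ> g"])
qed

text \<open>Serves \<open>star_absorb\<close>, where a vertex is absorbed by reading a collapse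
  backwards.\<close>

lemma leavitt_isomorphic_sym:
  assumes "fin_digraph E"
    and "algebra_isomorphic (leavitt_path_algebra TYPE('k::field) E) (leavitt_path_algebra TYPE('k) F)"
  shows "algebra_isomorphic (leavitt_path_algebra TYPE('k) F) (leavitt_path_algebra TYPE('k) E)"
proof (rule algebra_isomorphic_sym[OF ring_leavitt_path_algebra[OF assms(1)] assms(2)])
  have "wf_digraph E" using assms(1) by (simp add: fin_digraph_def)
  then show "k \<odot>\<^bsub>leavitt_path_algebra TYPE('k) E\<^esub> x \<in> carrier (leavitt_path_algebra TYPE('k) E)"
    if "x \<in> carrier (leavitt_path_algebra TYPE('k) E)" for k x
    using that by (auto simp: leavitt_carrier leavitt_smult free_algebra_scale)
qed

lemma lcong_mult_assoc: "p * q \<approx>\<^bsub>E\<^esub> r \<Longrightarrow> p * (q * s) \<approx>\<^bsub>E\<^esub> r * s"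
  using lcong_multR[of "p * q" E r s] by (simp add: mult.assoc)

lemma lcong_mult_mid: "q * r \<approx>\<^bsub>E\<^esub> m \<Longrightarrow> (p * q) * (r * s) \<approx>\<^bsub>E\<^esub> p * m * s"
  using lcong_multR[OF lcong_multL[of "q * r" E m p], of s] by (simp add: mult.assoc)

lemma wf_digraph_fin: "fin_digraph E \<Longrightarrow> wf_digraph E"
  by (simp add: fin_digraph_def)

subsection \<open>Relabelling\<close>

definition graph_iso ::
    "('v \<Rightarrow> 'w) \<Rightarrow> ('e \<Rightarrow> 'f) \<Rightarrow> ('v, 'e) pre_digraph \<Rightarrow> ('w, 'f) pre_digraph \<Rightarrow> bool" where
  "graph_iso \<alpha> \<beta> E F \<longleftrightarrow> bij_betw \<alpha> (verts E) (verts F) \<and> bij_betw \<beta> (arcs E) (arcs F) \<and>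
     (\<forall>e\<in>arcs E. tail F (\<beta> e) = \<alpha> (tail E e) \<and> head F (\<beta> e) = \<alpha> (head E e))"

lemma graph_iso_sym:
  assumes "wf_digraph E" "graph_iso \<alpha> \<beta> E F"
  shows "graph_iso (inv_into (verts E) \<alpha>) (inv_into (arcs E) \<beta>) F E"
proof -
  interpret wf_digraph E by fact
  have b: "bij_betw \<alpha> (verts E) (verts F)" "bij_betw \<beta> (arcs E) (arcs F)"
    and t: "\<And>e. e \<in> arcs E \<Longrightarrow> tail F (\<beta> e) = \<alpha> (tail E e)" "\<And>e. e \<in> arcs E \<Longrightarrow> head F (\<beta> e) = \<alpha> (head E e)"
    using assms(2) by (auto simp: graph_iso_def)
  have "tail E (inv_into (arcs E) \<beta> f) = inv_into (verts E) \<alpha> (tail F f) \<and>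
        head E (inv_into (arcs E) \<beta> f) = inv_into (verts E) \<alpha> (head F f)" if "f \<in> arcs F" for f
  proof -
    obtain e where e: "e \<in> arcs E" "f = \<beta> e" using b(2) \<open>f \<in> arcs F\<close> by (auto simp: bij_betw_def)
    then show ?thesis using b by (simp add: t bij_betw_def)
  qed
  then show ?thesis using b by (simp add: graph_iso_def bij_betw_inv_into)
qed

lemma graph_iso_out_arcs:
  assumes "wf_digraph E" "graph_iso \<alpha> \<beta> E F" "x \<in> verts E"
  shows "out_arcs F (\<alpha> x) = \<beta> ` out_arcs E x"
proof -
  interpret wf_digraph E by fact
  have "arcs F = \<beta> ` arcs E" "inj_on \<alpha> (verts E)" using assms(2) by (auto simp: graph_iso_def bij_betw_def)
  then show ?thesis using assms by (auto simp: out_arcs_def graph_iso_def inj_on_eq_iff)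
qed

lemma graph_iso_in_arcs:
  assumes "wf_digraph E" "graph_iso \<alpha> \<beta> E F" "x \<in> verts E"
  shows "in_arcs F (\<alpha> x) = \<beta> ` in_arcs E x"
proof -
  interpret wf_digraph E by fact
  have "arcs F = \<beta> ` arcs E" "inj_on \<alpha> (verts E)" using assms(2) by (auto simp: graph_iso_def bij_betw_def)
  then show ?thesis using assms by (auto simp: in_arcs_def graph_iso_def inj_on_eq_iff)
qed

lemma graph_iso_leavitt_family:
  fixes E :: "('v, 'e) pre_digraph" and F :: "('w, 'f) pre_digraph"
  assumes wf: "wf_digraph E" and iso: "graph_iso \<alpha> \<beta> E F"
  shows "leavitt_family F E (\<lambda>v. gen (Vertex (\<alpha> v)) :: ('w, 'f, 'k::field) leavitt_poly) (\<lambda>e. gen (Edge (\<beta> e))) (\<lambda>e. gen (Ghost (\<beta> e)))"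
proof -
  interpret wf_digraph E by fact
  have \<alpha>: "\<And>v. v \<in> verts E \<Longrightarrow> \<alpha> v \<in> verts F" "inj_on \<alpha> (verts E)"
    and \<beta>: "\<And>e. e \<in> arcs E \<Longrightarrow> \<beta> e \<in> arcs F" "inj_on \<beta> (arcs E)"
    and t: "\<And>e. e \<in> arcs E \<Longrightarrow> tail F (\<beta> e) = \<alpha> (tail E e)" "\<And>e. e \<in> arcs E \<Longrightarrow> head F (\<beta> e) = \<alpha> (head E e)"
    using iso by (auto simp: graph_iso_def bij_betw_def)
  have v: "(gen (Vertex (\<alpha> x)) :: ('w, 'f, 'k) leavitt_poly) \<approx>\<^bsub>F\<^esub> (\<Sum>e\<in>out_arcs E x. gen (Edge (\<beta> e)) * gen (Ghost (\<beta> e)))"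
    if "is_regular E x" for x
  proof -
    have x: "x \<in> verts E" "out_arcs E x \<noteq> {}" "finite (out_arcs E x)" using that by (auto simp: is_regular_def)
    have "inj_on \<beta> (out_arcs E x)" using \<beta>(2) by (rule inj_on_subset) auto
    moreover have "is_regular F (\<alpha> x)"
      using x \<alpha> by (auto simp: is_regular_def graph_iso_out_arcs[OF wf iso])
    ultimately show ?thesis
      using vertex_sum[where 'k='k, of F "\<alpha> x"] by (simp add: graph_iso_out_arcs[OF wf iso x(1)] sum.reindex)
  qed
  show ?thesis
    unfolding leavitt_family_def
  proof (intro conjI ballI allI impI)
    fix x y assume "x \<in> verts E" "y \<in> verts E"
    then show "(gen (Vertex (\<alpha> x)) :: ('w, 'f, 'k) leavitt_poly) * gen (Vertex (\<alpha> y)) \<approx>\<^bsub>F\<^esub> (if x = y then gen (Vertex (\<alpha> y)) else 0)"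
      using vertex_vertex[where 'k='k, of "\<alpha> x" F "\<alpha> y"] by (cases "x = y") (simp_all add: \<alpha> inj_on_eq_iff[OF \<alpha>(2)])
  next
    fix a b assume "a \<in> arcs E" "b \<in> arcs E"
    then show "(gen (Ghost (\<beta> a)) :: ('w, 'f, 'k) leavitt_poly) * gen (Edge (\<beta> b)) \<approx>\<^bsub>F\<^esub> (if a = b then gen (Vertex (\<alpha> (head E a))) else 0)"
      using ghost_edge[where 'k='k, of "\<beta> a" F "\<beta> b"] by (cases "a = b") (simp_all add: \<beta> t inj_on_eq_iff[OF \<beta>(2)])
  qed (use v tail_edge[where 'k='k, of _ F] edge_head[where 'k='k, of _ F] head_ghost[where 'k='k, of _ F] ghost_tail[where 'k='k, of _ F] in \<open>auto simp: \<beta>(1) simp flip: t\<close>)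
qed

lemma graph_iso_isomorphic:
  assumes wf: "wf_digraph E" "wf_digraph F" and iso: "graph_iso \<alpha> \<beta> E F"
  shows "algebra_isomorphic (leavitt_path_algebra TYPE('k::field) E) (leavitt_path_algebra TYPE('k) F)"
proof (rule algebra_isomorphicI[OF wf graph_iso_leavitt_family[OF wf(1) iso]
      graph_iso_leavitt_family[OF wf(2) graph_iso_sym[OF wf(1) iso]]])
  have b: "bij_betw \<alpha> (verts E) (verts F)" "bij_betw \<beta> (arcs E) (arcs F)"
    using iso by (auto simp: graph_iso_def)
  have m: "\<And>v. v \<in> verts E \<Longrightarrow> \<alpha> v \<in> verts F" "\<And>e. e \<in> arcs E \<Longrightarrow> \<beta> e \<in> arcs F"
    "\<And>v. v \<in> verts F \<Longrightarrow> inv_into (verts E) \<alpha> v \<in> verts E" "\<And>e. e \<in> arcs F \<Longrightarrow> inv_into (arcs E) \<beta> e \<in> arcs E"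
    "\<And>v. v \<in> verts E \<Longrightarrow> inv_into (verts E) \<alpha> (\<alpha> v) = v" "\<And>v. v \<in> arcs E \<Longrightarrow> inv_into (arcs E) \<beta> (\<beta> v) = v"
    "\<And>v. v \<in> verts F \<Longrightarrow> \<alpha> (inv_into (verts E) \<alpha> v) = v" "\<And>v. v \<in> arcs F \<Longrightarrow> \<beta> (inv_into (arcs E) \<beta> v) = v"
    using b by (auto simp: bij_betw_def inv_into_into f_inv_into_f)
  have g: "\<And>v. v \<in> verts G \<Longrightarrow> Vertex v \<in> leavitt_gens G"
    "\<And>v. v \<in> arcs G \<Longrightarrow> Edge v \<in> leavitt_gens G" "\<And>v. v \<in> arcs G \<Longrightarrow> Ghost v \<in> leavitt_gens G"
    for G :: "('x, 'y) pre_digraph" by (auto simp: leavitt_gens_def)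
  {
    fix x assume "x \<in> leavitt_gens E"
    then show "gen_map E (\<lambda>v. gen (Vertex (\<alpha> v))) (\<lambda>e. gen (Edge (\<beta> e))) (\<lambda>e. gen (Ghost (\<beta> e))) x
        \<in> free_algebra (leavitt_gens F)"
      by (cases rule: leavitt_gensE) (auto simp: m g intro!: free_algebra_gen)
  next
    fix x assume "x \<in> leavitt_gens F"
    then show "gen_map F (\<lambda>v. gen (Vertex (inv_into (verts E) \<alpha> v))) (\<lambda>e. gen (Edge (inv_into (arcs E) \<beta> e)))
        (\<lambda>e. gen (Ghost (inv_into (arcs E) \<beta> e))) x \<in> free_algebra (leavitt_gens E)"
      by (cases rule: leavitt_gensE) (auto simp: m g intro!: free_algebra_gen)
  next
    fix x assume "x \<in> leavitt_gens E"
    then show "subst (gen_map F (\<lambda>v. gen (Vertex (inv_into (verts E) \<alpha> v))) (\<lambda>e. gen (Edge (inv_into (arcs E) \<beta> e)))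
        (\<lambda>e. gen (Ghost (inv_into (arcs E) \<beta> e))))
        (gen_map E (\<lambda>v. gen (Vertex (\<alpha> v))) (\<lambda>e. gen (Edge (\<beta> e))) (\<lambda>e. gen (Ghost (\<beta> e))) x) \<approx>\<^bsub>E\<^esub> gen x"
      by (cases rule: leavitt_gensE) (auto simp: m)
  next
    fix x assume "x \<in> leavitt_gens F"
    then show "subst (gen_map E (\<lambda>v. gen (Vertex (\<alpha> v))) (\<lambda>e. gen (Edge (\<beta> e))) (\<lambda>e. gen (Ghost (\<beta> e))))
        (gen_map F (\<lambda>v. gen (Vertex (inv_into (verts E) \<alpha> v))) (\<lambda>e. gen (Edge (inv_into (arcs E) \<beta> e)))
        (\<lambda>e. gen (Ghost (inv_into (arcs E) \<beta> e))) x) \<approx>\<^bsub>F\<^esub> gen x"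
      by (cases rule: leavitt_gensE) (auto simp: m)
  }
  show "(\<Sum>v\<in>verts E. gen (Vertex (\<alpha> v))) \<approx>\<^bsub>F\<^esub> (\<Sum>v\<in>verts F. gen (Vertex v))"
    using b(1) by (simp add: sum.reindex_bij_betw[OF b(1), where g = "\<lambda>v. gen (Vertex v)"])
qed

subsection \<open>Collapsing an edge\<close>

text \<open>The edge \<open>lab f\<close> stands for the path \<open>e f\<close>. Read backwards,
  this is the move on graphs known as the shift. The names are a parameter, so that the edge type
  does not change under iteration; \<open>lab\<close> may reuse the name \<open>e\<close> but no
  other old name, a freedom on which \<open>star_absorb\<close> relies.\<close>

definition collapse :: "('v, 'e) pre_digraph \<Rightarrow> 'e \<Rightarrow> ('e \<Rightarrow> 'e) \<Rightarrow> ('v, 'e) pre_digraph" where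
  "collapse G e lab = (let D = out_arcs G (head G e) in
     \<lparr>verts = verts G, arcs = (arcs G - {e}) \<union> lab ` D,
      tail = (\<lambda>a. if a \<in> lab ` D then tail G e else tail G a),
      head = (\<lambda>a. if a \<in> lab ` D then head G (inv_into D lab a) else head G a)\<rparr>)"

text \<open>The parameter \<open>K\<close> only fixes the coefficient field inside the locale.\<close>

locale edge_collapse = fin_digraph G for G :: "('v, 'e) pre_digraph" +
  fixes K :: "'k::field itself" and e :: 'e and lab :: "'e \<Rightarrow> 'e"
  assumes e: "e \<in> arcs G"
    and no_loop: "tail G e \<noteq> head G e"
    and nonsink: "out_arcs G (head G e) \<noteq> {}"
    and lab_inj: "inj_on lab (out_arcs G (head G e))"
    and lab_fresh: "lab ` out_arcs G (head G e) \<inter> (arcs G - {e}) = {}"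
begin

abbreviation vt :: "'v \<Rightarrow> ('v, 'e, 'k) leavitt_poly" where "vt v \<equiv> gen (Vertex v)"
abbreviation ed :: "'e \<Rightarrow> ('v, 'e, 'k) leavitt_poly" where "ed a \<equiv> gen (Edge a)"
abbreviation gh :: "'e \<Rightarrow> ('v, 'e, 'k) leavitt_poly" where "gh a \<equiv> gen (Ghost a)"
abbreviation "C \<equiv> collapse G e lab"
abbreviation "D \<equiv> out_arcs G (head G e)"

lemma collapse_verts [simp]: "verts C = verts G"
  by (simp add: collapse_def Let_def)

lemma collapse_arcs: "arcs C = (arcs G - {e}) \<union> lab ` D"
  by (simp add: collapse_def Let_def)

lemma collapse_ends_new [simp]:
  assumes "f \<in> D"
  shows "tail C (lab f) = tail G e" "head C (lab f) = head G f"
  using assms lab_inj by (auto simp: collapse_def Let_def)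

lemma collapse_ends_old [simp]:
  assumes "a \<in> arcs G" "a \<noteq> e"
  shows "a \<notin> lab ` D" "tail C a = tail G a" "head C a = head G a"
  using assms lab_fresh by (auto simp: collapse_def Let_def)

lemma D_arcs: "f \<in> D \<Longrightarrow> f \<in> arcs G \<and> f \<noteq> e \<and> tail G f = head G e"
  using no_loop by auto

lemma D_ne [simp]: "a \<in> arcs G \<Longrightarrow> tail G a = head G e \<Longrightarrow> a \<noteq> e"
  using no_loop by auto

lemma D_finite [simp]: "finite D"
  by (rule finite_subset[OF _ finite_arcs]) auto

lemma lab_ne [simp]:
  assumes "f \<in> D" "a \<in> arcs G" "a \<noteq> e"
  shows "lab f \<noteq> a" "a \<noteq> lab f"
  using assms lab_fresh by blast+

lemma mem_C [simp]: "a \<in> arcs G \<Longrightarrow> a \<noteq> e \<Longrightarrow> a \<in> arcs C" "f \<in> D \<Longrightarrow> lab f \<in> arcs C" "f \<in> D \<Longrightarrow> f \<in> arcs C"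
  by (auto simp: collapse_arcs)

lemma arcs_C_cases:
  assumes "a \<in> arcs C"
  obtains (old) "a \<in> arcs G" "a \<noteq> e" "a \<notin> lab ` D" | (new) f where "f \<in> D" "a = lab f"
  using assms lab_fresh by (auto simp: collapse_arcs)

lemma fin_digraph_collapse: "fin_digraph C"
proof
  fix a assume "a \<in> arcs C"
  then show "tail C a \<in> verts C" by (cases rule: arcs_C_cases) (auto simp: e)
  from \<open>a \<in> arcs C\<close> show "head C a \<in> verts C"
    by (cases rule: arcs_C_cases) auto
qed (simp_all add: collapse_arcs)

lemma out_arcs_other:
  assumes "v \<noteq> tail G e"
  shows "out_arcs C v = out_arcs G v"
proof (intro Set.set_eqI iffI)
  fix a assume "a \<in> out_arcs C v"
  then have "a \<in> arcs C" "tail C a = v" by auto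
  then show "a \<in> out_arcs G v" using assms by (cases rule: arcs_C_cases) simp_all
next
  fix a assume "a \<in> out_arcs G v"
  then have "a \<in> arcs G" "a \<noteq> e" "tail G a = v" using assms by auto
  then show "a \<in> out_arcs C v" by simp
qed

lemma out_arcs_tail: "out_arcs C (tail G e) = (out_arcs G (tail G e) - {e}) \<union> lab ` D"
proof (intro Set.set_eqI iffI)
  fix a assume "a \<in> out_arcs C (tail G e)"
  then have "a \<in> arcs C" "tail C a = tail G e" by simp_all
  then show "a \<in> (out_arcs G (tail G e) - {e}) \<union> lab ` D"
  proof (cases rule: arcs_C_cases)
    case (new f)
    then show ?thesis by blast
  qed simp
next
  fix a assume "a \<in> (out_arcs G (tail G e) - {e}) \<union> lab ` D"
  then consider "a \<in> arcs G" "a \<noteq> e" "tail G a = tail G e" | f where "f \<in> D" "a = lab f" by force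
  then show "a \<in> out_arcs C (tail G e)" by cases simp_all
qed

text \<open>\<open>A\<close> and \<open>A'\<close> are the images of edges and ghost edges on the
  way from \<open>G\<close> to the collapse; \<open>B\<close> and \<open>B'\<close> are those on the
  way back, where \<open>lab f\<close> becomes a path of length two.\<close>

definition A :: "'e \<Rightarrow> ('v, 'e, 'k) leavitt_poly" where
  "A a = (if a = e then \<Sum>f\<in>D. ed (lab f) * gh f else ed a)"

definition A' :: "'e \<Rightarrow> ('v, 'e, 'k) leavitt_poly" where
  "A' a = (if a = e then \<Sum>f\<in>D. ed f * gh (lab f) else gh a)"

definition B :: "'e \<Rightarrow> ('v, 'e, 'k) leavitt_poly" where
  "B a = (if a \<in> lab ` D then ed e * ed (inv_into D lab a) else ed a)"

definition B' :: "'e \<Rightarrow> ('v, 'e, 'k) leavitt_poly" where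
  "B' a = (if a \<in> lab ` D then gh (inv_into D lab a) * gh e else gh a)"

lemma A_simps [simp]:
  "A e = (\<Sum>f\<in>D. ed (lab f) * gh f)" "A' e = (\<Sum>f\<in>D. ed f * gh (lab f))"
  "a \<noteq> e \<Longrightarrow> A a = ed a" "a \<noteq> e \<Longrightarrow> A' a = gh a"
  by (simp_all add: A_def A'_def)

lemma B_simps [simp]:
  "f \<in> D \<Longrightarrow> B (lab f) = ed e * ed f" "f \<in> D \<Longrightarrow> B' (lab f) = gh f * gh e"
  "a \<notin> lab ` D \<Longrightarrow> B a = ed a" "a \<notin> lab ` D \<Longrightarrow> B' a = gh a"
  using lab_inj by (auto simp: B_def B'_def)

lemma lab_eq_iff [simp]: "f \<in> D \<Longrightarrow> g \<in> D \<Longrightarrow> lab f = lab g \<longleftrightarrow> f = g"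
  using lab_inj by (simp add: inj_on_eq_iff)

text \<open>Since \<open>e\<close> is not a loop, the edges leaving its range are the same in the
  collapse, and so is relation (4) at this vertex.\<close>

lemma sum_D_C: "(\<Sum>f\<in>D. ed f * gh f) \<approx>\<^bsub>C\<^esub> vt (head G e)"
proof -
  have "is_regular C (head G e)" using no_loop nonsink e by (simp add: is_regular_def out_arcs_other)
  from lcong_sym[OF vertex_sum[where 'k='k, OF this]] show ?thesis using no_loop by (simp add: out_arcs_other)
qed

lemma sum_D_G: "(\<Sum>f\<in>D. ed f * gh f) \<approx>\<^bsub>G\<^esub> vt (head G e)"
proof -
  have "is_regular G (head G e)" using nonsink e by (simp add: is_regular_def)
  from lcong_sym[OF vertex_sum[where 'k='k, OF this]] show ?thesis .
qed

lemma family_C: "leavitt_family C G (\<lambda>v. vt v) A A'"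
  unfolding leavitt_family_def
proof (intro conjI ballI allI impI)
  fix x y assume "x \<in> verts G" "y \<in> verts G"
  then show "vt x * vt y \<approx>\<^bsub>C\<^esub> (if x = y then vt y else 0)"
    by (intro vertex_vertex) simp_all
next
  fix a assume a: "a \<in> arcs G"
  show "vt (tail G a) * A a \<approx>\<^bsub>C\<^esub> A a"
  proof (cases "a = e")
    case True
    have "vt (tail G e) * (ed (lab f) * gh f) \<approx>\<^bsub>C\<^esub> ed (lab f) * gh f"
      if "f \<in> D" for f using tail_edge[where 'k='k, of "lab f" C] that by (intro lcong_mult_assoc) simp
    then show ?thesis by (simp only: True A_simps sum_distrib_left lcong_sum)
  qed (use a tail_edge[where 'k='k, of a C] in simp)
  show "A a * vt (head G a) \<approx>\<^bsub>C\<^esub> A a"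
  proof (cases "a = e")
    case True
    have "(ed (lab f) * gh f) * vt (head G e) \<approx>\<^bsub>C\<^esub> ed (lab f) * gh f"
      if "f \<in> D" for f
      using ghost_tail[where 'k='k, of f C] that D_arcs[OF that] by (simp add: mult.assoc lcong_multL)
    then show ?thesis by (simp only: True A_simps sum_distrib_right lcong_sum)
  qed (use a edge_head[where 'k='k, of a C] in simp)
  show "vt (head G a) * A' a \<approx>\<^bsub>C\<^esub> A' a"
  proof (cases "a = e")
    case True
    have "vt (head G e) * (ed f * gh (lab f)) \<approx>\<^bsub>C\<^esub> ed f * gh (lab f)"
      if "f \<in> D" for f using tail_edge[where 'k='k, of f C] that D_arcs[OF that] by (intro lcong_mult_assoc) simp
    then show ?thesis by (simp only: True A_simps sum_distrib_left lcong_sum)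
  qed (use a head_ghost[where 'k='k, of a C] in simp)
  show "A' a * vt (tail G a) \<approx>\<^bsub>C\<^esub> A' a"
  proof (cases "a = e")
    case True
    have "(ed f * gh (lab f)) * vt (tail G e) \<approx>\<^bsub>C\<^esub> ed f * gh (lab f)"
      if "f \<in> D" for f
      using ghost_tail[where 'k='k, of "lab f" C] that by (simp add: mult.assoc lcong_multL)
    then show ?thesis by (simp only: True A_simps sum_distrib_right lcong_sum)
  qed (use a ghost_tail[where 'k='k, of a C] in simp)
next
  fix a b assume a: "a \<in> arcs G" and b: "b \<in> arcs G"
  consider "a \<noteq> e" "b \<noteq> e" | "a = e" "b \<noteq> e" | "a \<noteq> e" "b = e" | "a = e" "b = e" by blast
  then show "A' a * A b \<approx>\<^bsub>C\<^esub> (if a = b then vt (head G a) else 0)"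
  proof cases
    case 1
    then show ?thesis using ghost_edge[where 'k='k, of a C b] a b by (cases "a = b") simp_all
  next
    case 2
    have "(ed f * gh (lab f)) * ed b \<approx>\<^bsub>C\<^esub> ed f * 0" if "f \<in> D" for f
      using ghost_edge[where 'k='k, of "lab f" C b] that b 2 by (simp only: mult.assoc) (intro lcong_multL, simp)
    then have "(\<Sum>f\<in>D. ed f * gh (lab f) * ed b) \<approx>\<^bsub>C\<^esub> (\<Sum>f\<in>D. ed f * 0)"
      by (rule lcong_sum)
    then show ?thesis using 2 by (simp add: sum_distrib_right)
  next
    case 3
    have "gh a * (ed (lab f) * gh f) \<approx>\<^bsub>C\<^esub> 0 * gh f" if "f \<in> D" for f
      using ghost_edge[where 'k='k, of a C "lab f"] that a 3 by (intro lcong_mult_assoc) simp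
    then have "(\<Sum>f\<in>D. gh a * (ed (lab f) * gh f)) \<approx>\<^bsub>C\<^esub> (\<Sum>f\<in>D. 0 * gh f)"
      by (rule lcong_sum)
    then show ?thesis using 3 by (simp add: sum_distrib_left)
  next
    case 4
    \<comment> \<open>The new edges are orthogonal, so only the diagonal of the double sum survives;
      it adds up to the range of \<open>e\<close> by relation (4).\<close>
    have "A' a * A b = (\<Sum>f\<in>D. \<Sum>g\<in>D. (ed f * gh (lab f)) * (ed (lab g) * gh g))"
      by (simp add: 4 sum_product)
    also have "\<dots> \<approx>\<^bsub>C\<^esub> (\<Sum>f\<in>D. \<Sum>g\<in>D. if f = g then ed f * gh f else 0)"
    proof (intro lcong_sum)
      fix f g assume fg: "f \<in> D" "g \<in> D"
      have "(ed f * gh (lab f)) * (ed (lab g) * gh g) \<approx>\<^bsub>C\<^esub>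
          ed f * (if lab f = lab g then vt ((head C (lab f))) else 0) * gh g"
        using fg by (intro lcong_mult_mid ghost_edge) simp_all
      also have "\<dots> = (if f = g then ed f * vt (head C f) * gh f else 0)"
        using fg D_arcs[OF fg(1)] by simp
      also have "\<dots> \<approx>\<^bsub>C\<^esub> (if f = g then ed f * gh f else 0)"
        using edge_head[where 'k='k, of f C] fg by (cases "f = g") (simp_all add: lcong_multR)
      finally show "(ed f * gh (lab f)) * (ed (lab g) * gh g) \<approx>\<^bsub>C\<^esub>
        (if f = g then ed f * gh f else 0)" .
    qed
    also have "(\<Sum>f\<in>D. \<Sum>g\<in>D. if f = g then ed f * gh f else 0) =
        (\<Sum>f\<in>D. ed f * gh f)" by simp
    also note sum_D_C
    finally show ?thesis using 4 by simp
  qed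
next
  fix x assume reg: "is_regular G x"
  show "vt x \<approx>\<^bsub>C\<^esub> (\<Sum>a\<in>out_arcs G x. A a * A' a)"
  proof (cases "x = tail G e")
    case False
    have "(\<Sum>a\<in>out_arcs G x. A a * A' a) = (\<Sum>a\<in>out_arcs G x. ed a * gh a)"
    proof (intro sum.cong refl)
      fix a assume "a \<in> out_arcs G x"
      then have "a \<noteq> e" using False by auto
      then show "A a * A' a = ed a * gh a" by simp
    qed
    moreover have "is_regular C x" using reg False by (simp add: is_regular_def out_arcs_other)
    ultimately show ?thesis using vertex_sum[where 'k='k, of C x] False by (simp add: out_arcs_other)
  next
    case True
    have fin: "finite (out_arcs G x)" using reg by (simp add: is_regular_def)
    have ex: "e \<in> out_arcs G x" using e True by simp
    have reg': "is_regular C x" using nonsink fin e True by (simp add: is_regular_def out_arcs_tail)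
    let ?p = "\<lambda>a. ed a * gh a"
    \<comment> \<open>In relation (4) at the source of \<open>e\<close>, the summand of
      \<open>e\<close> is taken over by the summands of the new edges.\<close>
    have AA: "A e * A' e \<approx>\<^bsub>C\<^esub> (\<Sum>f\<in>D. ?p (lab f))"
    proof -
      have "A e * A' e = (\<Sum>f\<in>D. \<Sum>g\<in>D. (ed (lab f) * gh f) * (ed g * gh (lab g)))"
        by (simp add: sum_product)
      also have "\<dots> \<approx>\<^bsub>C\<^esub> (\<Sum>f\<in>D. \<Sum>g\<in>D. if f = g then ?p (lab f) else 0)"
      proof (intro lcong_sum)
        fix f g assume fg: "f \<in> D" "g \<in> D"
        have "(ed (lab f) * gh f) * (ed g * gh (lab g)) \<approx>\<^bsub>C\<^esub>
          ed (lab f) * (if f = g then vt (head C f) else 0) * gh (lab g)"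
          using fg by (intro lcong_mult_mid ghost_edge) simp_all
        also have "\<dots> = (if f = g then ed (lab f) * vt ((head C (lab f))) * gh (lab f) else 0)"
          using fg D_arcs[OF fg(1)] by simp
        also have "\<dots> \<approx>\<^bsub>C\<^esub> (if f = g then ?p (lab f) else 0)"
          using edge_head[where 'k='k, of "lab f" C] fg by (cases "f = g") (simp_all add: lcong_multR)
        finally show "(ed (lab f) * gh f) * (ed g * gh (lab g)) \<approx>\<^bsub>C\<^esub>
          (if f = g then ?p (lab f) else 0)" .
      qed
      also have "(\<Sum>f\<in>D. \<Sum>g\<in>D. if f = g then ?p (lab f) else 0) = (\<Sum>f\<in>D. ?p (lab f))" by simp
      finally show ?thesis .
    qed
    have "vt x \<approx>\<^bsub>C\<^esub> (\<Sum>a\<in>(out_arcs G x - {e}) \<union> lab ` D. ?p a)"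
      using vertex_sum[where 'k='k, OF reg'] True by (simp add: out_arcs_tail)
    also have "(\<Sum>a\<in>(out_arcs G x - {e}) \<union> lab ` D. ?p a) = (\<Sum>a\<in>out_arcs G x - {e}. ?p a) + (\<Sum>f\<in>D. ?p (lab f))"
      using fin lab_inj lab_fresh by (subst sum.union_disjoint) (auto simp: sum.reindex)
    also have "\<dots> \<approx>\<^bsub>C\<^esub> (\<Sum>a\<in>out_arcs G x - {e}. ?p a) + A e * A' e"
      by (intro lcong_add lcong_refl lcong_sym[OF AA])
    also have "\<dots> = (\<Sum>a\<in>out_arcs G x. A a * A' a)"
      by (simp add: sum.remove[OF fin ex] add.commute del: A_simps(1,2))
    finally show ?thesis .
  qed
qed

lemma family_G: "leavitt_family G C (\<lambda>v. vt v) B B'"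
  unfolding leavitt_family_def
proof (intro conjI ballI allI impI)
  fix x y assume "x \<in> verts C" "y \<in> verts C"
  then show "vt x * vt y \<approx>\<^bsub>G\<^esub> (if x = y then vt y else 0)"
    by (intro vertex_vertex) simp_all
next
  fix a assume a: "a \<in> arcs C"
  from a show "vt (tail C a) * B a \<approx>\<^bsub>G\<^esub> B a"
    by (cases rule: arcs_C_cases) (auto simp: tail_edge e intro!: lcong_mult_assoc)
  from a show "B a * vt (head C a) \<approx>\<^bsub>G\<^esub> B a"
    by (cases rule: arcs_C_cases) (auto simp: edge_head mult.assoc intro!: lcong_multL)
  from a show "vt (head C a) * B' a \<approx>\<^bsub>G\<^esub> B' a"
    by (cases rule: arcs_C_cases) (auto simp: head_ghost intro!: lcong_mult_assoc)
  from a show "B' a * vt (tail C a) \<approx>\<^bsub>G\<^esub> B' a"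
    by (cases rule: arcs_C_cases) (auto simp: ghost_tail e mult.assoc intro!: lcong_multL)
next
  fix a b assume a: "a \<in> arcs C" and b: "b \<in> arcs C"
  show "B' a * B b \<approx>\<^bsub>G\<^esub> (if a = b then vt (head C a) else 0)"
    using a
  proof (cases rule: arcs_C_cases)
    case old
    from b show ?thesis
    proof (cases rule: arcs_C_cases)
      case old
      then show ?thesis using ghost_edge[where 'k='k, of a G b] \<open>a \<in> arcs G\<close> \<open>a \<noteq> e\<close> \<open>a \<notin> lab ` D\<close> by (cases "a = b") simp_all
    next
      case (new f)
      have "gh a * (ed e * ed f) \<approx>\<^bsub>G\<^esub> 0 * ed f"
        using ghost_edge[where 'k='k, of a G e] old e by (intro lcong_mult_assoc) simp
      then show ?thesis using new old by simp
    qed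
  next
    case (new f)
    note f = new
    from b show ?thesis
    proof (cases rule: arcs_C_cases)
      case old
      have "gh f * gh e * ed b \<approx>\<^bsub>G\<^esub> gh f * 0"
        using ghost_edge[where 'k='k, of e G b] old e by (simp only: mult.assoc) (intro lcong_multL, simp)
      then show ?thesis using new old by simp
    next
      case (new g)
      have fg: "f \<in> arcs G" "g \<in> arcs G" "tail G f = head G e" using f new by auto
      have "(gh f * gh e) * (ed e * ed g) \<approx>\<^bsub>G\<^esub>
          gh f * vt (head G e) * ed g"
        using ghost_edge[where 'k='k, of e G e] e by (intro lcong_mult_mid) simp
      also have "\<dots> \<approx>\<^bsub>G\<^esub> gh f * ed g"
        using ghost_tail[where 'k='k, of f G] fg by (intro lcong_multR) simp
      also have "\<dots> \<approx>\<^bsub>G\<^esub> (if f = g then vt (head G f) else 0)"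
        using fg by (intro ghost_edge)
      finally show ?thesis using f new by (cases "f = g") simp_all
    qed
  qed
next
  fix x assume reg: "is_regular C x"
  show "vt x \<approx>\<^bsub>G\<^esub> (\<Sum>a\<in>out_arcs C x. B a * B' a)"
  proof (cases "x = tail G e")
    case False
    have "(\<Sum>a\<in>out_arcs G x. B a * B' a) = (\<Sum>a\<in>out_arcs G x. ed a * gh a)"
    proof (intro sum.cong refl)
      fix a assume "a \<in> out_arcs G x"
      then have "a \<in> arcs G" "a \<noteq> e" using False by auto
      then show "B a * B' a = ed a * gh a" by simp
    qed
    moreover have "is_regular G x" using reg False by (simp add: is_regular_def out_arcs_other)
    ultimately show ?thesis using vertex_sum[where 'k='k, of G x] False by (simp add: out_arcs_other)
  next
    case True
    have fin: "finite (out_arcs G x)" by (rule finite_subset[OF _ finite_arcs]) auto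
    have ex: "e \<in> out_arcs G x" using e True by simp
    have reg': "is_regular G x" using ex fin e True by (auto simp: is_regular_def)
    let ?p = "\<lambda>a. ed a * gh a"
    \<comment> \<open>Relation (4) at the range of \<open>e\<close>, multiplied by \<open>e\<close>
      on the left and by its ghost on the right.\<close>
    have BB: "(\<Sum>f\<in>D. B (lab f) * B' (lab f)) \<approx>\<^bsub>G\<^esub> ?p e"
    proof -
      have "(\<Sum>f\<in>D. B (lab f) * B' (lab f)) = ed e * (\<Sum>f\<in>D. ?p f) * gh e"
        unfolding sum_distrib_left sum_distrib_right by (intro sum.cong) (simp_all add: mult.assoc)
      also have "\<dots> \<approx>\<^bsub>G\<^esub> ed e * vt (head G e) * gh e"
        by (intro lcong_multR lcong_multL sum_D_G)
      also have "\<dots> \<approx>\<^bsub>G\<^esub> ?p e" using e by (intro lcong_multR edge_head)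
      finally show ?thesis .
    qed
    have "vt x \<approx>\<^bsub>G\<^esub> (\<Sum>a\<in>out_arcs G x. ?p a)" by (rule vertex_sum[where 'k='k, OF reg'])
    also have "\<dots> = (\<Sum>a\<in>out_arcs G x - {e}. ?p a) + ?p e"
      by (simp add: sum.remove[OF fin ex] add.commute)
    also have "\<dots> \<approx>\<^bsub>G\<^esub> (\<Sum>a\<in>out_arcs G x - {e}. ?p a) + (\<Sum>f\<in>D. B (lab f) * B' (lab f))"
      by (intro lcong_add lcong_refl lcong_sym[OF BB])
    also have "(\<Sum>a\<in>out_arcs G x - {e}. ?p a) = (\<Sum>a\<in>out_arcs G x - {e}. B a * B' a)"
    proof (intro sum.cong refl)
      fix a assume "a \<in> out_arcs G x - {e}"
      then have "a \<in> arcs G" "a \<noteq> e" by auto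
      then show "?p a = B a * B' a" by simp
    qed
    also have "\<dots> + (\<Sum>f\<in>D. B (lab f) * B' (lab f)) = (\<Sum>a\<in>out_arcs C x. B a * B' a)"
      using fin lab_inj lab_fresh True
      by (simp only: out_arcs_tail True, subst sum.union_disjoint) (auto simp: sum.reindex)
    finally show ?thesis .
  qed
qed

text \<open>The substitutions undo each other on \<open>G\<close> by relation (4) at the range of
  \<open>e\<close>, and on the collapse by the orthogonality of the edges leaving that
  range.\<close>

theorem collapse_isomorphic:
  "algebra_isomorphic (leavitt_path_algebra TYPE('k) G) (leavitt_path_algebra TYPE('k) C)"
proof (rule algebra_isomorphicI[OF wf_digraph wf_digraph_fin[OF fin_digraph_collapse] family_C family_G])
  let ?V = "\<lambda>v. gen (Vertex v) :: ('v, 'e, 'k) leavitt_poly"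
  have g: "\<And>v. v \<in> verts H \<Longrightarrow> gen (Vertex v) \<in> free_algebra (leavitt_gens H)"
    "\<And>v. v \<in> arcs H \<Longrightarrow> ed v \<in> free_algebra (leavitt_gens H)"
    "\<And>v. v \<in> arcs H \<Longrightarrow> gh v \<in> free_algebra (leavitt_gens H)"
    for H :: "('v, 'e) pre_digraph" by (auto simp: leavitt_gens_def intro: free_algebra_gen)
  {
    fix x assume "x \<in> leavitt_gens G"
    then show "gen_map G ?V A A' x \<in> free_algebra (leavitt_gens C)"
    proof (cases rule: leavitt_gensE)
      case (2 a)
      then show ?thesis by (cases "a = e") (auto intro!: g free_algebra_sum free_algebra_mult simp: mem_C)
    next
      case (3 a)
      then show ?thesis by (cases "a = e") (auto intro!: g free_algebra_sum free_algebra_mult simp: mem_C)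
    qed (simp add: g)
  next
    fix x assume "x \<in> leavitt_gens C"
    then show "gen_map C ?V B B' x \<in> free_algebra (leavitt_gens G)"
    proof (cases rule: leavitt_gensE)
      case (2 a)
      from 2(1) show ?thesis
        by (cases rule: arcs_C_cases) (use 2 e in \<open>auto intro!: g free_algebra_mult\<close>)
    next
      case (3 a)
      from 3(1) show ?thesis
        by (cases rule: arcs_C_cases) (use 3 e in \<open>auto intro!: g free_algebra_mult\<close>)
    qed (simp add: g)
  next
    fix x assume "x \<in> leavitt_gens G"
    then show "subst (gen_map C ?V B B') (gen_map G ?V A A' x) \<approx>\<^bsub>G\<^esub> gen x"
    proof (cases rule: leavitt_gensE)
      case (2 a)
      show ?thesis
      proof (cases "a = e")
        case True
        have "subst (gen_map C ?V B B') (A e) = ed e * (\<Sum>f\<in>D. ed f * gh f)"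
          unfolding A_simps subst_sum sum_distrib_left
          by (intro sum.cong refl) (auto simp: subst_mult mult.assoc)
        also have "\<dots> \<approx>\<^bsub>G\<^esub> ed e * vt (head G e)" by (intro lcong_multL sum_D_G)
        also have "\<dots> \<approx>\<^bsub>G\<^esub> ed e" using e by (rule edge_head)
        finally show ?thesis using 2 True by simp
      qed (use 2 in simp)
    next
      case (3 a)
      show ?thesis
      proof (cases "a = e")
        case True
        have "subst (gen_map C ?V B B') (A' e) = (\<Sum>f\<in>D. ed f * gh f) * gh e"
          unfolding A_simps subst_sum sum_distrib_right
          by (intro sum.cong refl) (auto simp: subst_mult mult.assoc)
        also have "\<dots> \<approx>\<^bsub>G\<^esub> vt (head G e) * gh e" by (intro lcong_multR sum_D_G)
        also have "\<dots> \<approx>\<^bsub>G\<^esub> gh e" using e by (rule head_ghost)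
        finally show ?thesis using 3 True by simp
      qed (use 3 in simp)
    qed simp
  next
    fix x assume "x \<in> leavitt_gens C"
    then show "subst (gen_map G ?V A A') (gen_map C ?V B B' x) \<approx>\<^bsub>C\<^esub> gen x"
    proof (cases rule: leavitt_gensE)
      case (2 a)
      from 2(1) show ?thesis
      proof (cases rule: arcs_C_cases)
        case (new f)
        have "subst (gen_map G ?V A A') (B a) = (\<Sum>g\<in>D. ed (lab g) * gh g * ed f)"
          using new e D_arcs[of f, OF new(1)] by (simp add: subst_mult sum_distrib_right)
        also have "\<dots> \<approx>\<^bsub>C\<^esub> (\<Sum>g\<in>D. ed (lab g) * (if g = f then vt (head C g) else 0))"
          using new unfolding mult.assoc by (intro lcong_sum lcong_multL ghost_edge) simp_all
        also have "\<dots> = (\<Sum>g\<in>D. if g = f then ed (lab f) * vt (head C f) else 0)"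
          by (intro sum.cong) auto
        also have "\<dots> = ed (lab f) * vt ((head C (lab f)))" using new D_arcs[of f, OF new(1)] by simp
        also have "\<dots> \<approx>\<^bsub>C\<^esub> ed (lab f)" using new by (intro edge_head) simp
        finally show ?thesis using 2 new by simp
      qed (use 2 in simp)
    next
      case (3 a)
      from 3(1) show ?thesis
      proof (cases rule: arcs_C_cases)
        case (new f)
        have "subst (gen_map G ?V A A') (B' a) = (\<Sum>g\<in>D. gh f * (ed g * gh (lab g)))"
          using new e D_arcs[of f, OF new(1)] by (simp add: subst_mult sum_distrib_left)
        also have "\<dots> \<approx>\<^bsub>C\<^esub> (\<Sum>g\<in>D. (if f = g then vt (head C f) else 0) * gh (lab g))"
          using new by (intro lcong_sum lcong_mult_assoc ghost_edge) simp_all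
        also have "\<dots> = (\<Sum>g\<in>D. if f = g then vt (head C f) * gh (lab f) else 0)"
          by (intro sum.cong) auto
        also have "\<dots> = vt ((head C (lab f))) * gh (lab f)" using new D_arcs[of f, OF new(1)] by simp
        also have "\<dots> \<approx>\<^bsub>C\<^esub> gh (lab f)" using new by (intro head_ghost) simp
        finally show ?thesis using 3 new by simp
      qed (use 3 in simp)
    qed simp
  }
qed simp

end

subsection \<open>Splitting a source\<close>

lemma vertex_edge_other:
  assumes "wf_digraph E" "a \<in> arcs E" "x \<in> verts E" "x \<noteq> tail E a"
  shows "gen (Vertex x) * gen (Edge a) \<approx>\<^bsub>E\<^esub> 0"
proof -
  have t: "tail E a \<in> verts E" using assms by (simp add: wf_digraph.tail_in_verts)
  have "gen (Vertex x) * gen (Edge a) \<approx>\<^bsub>E\<^esub> gen (Vertex x) * (gen (Vertex (tail E a)) * gen (Edge a))"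
    by (intro lcong_multL lcong_sym[OF tail_edge] assms)
  also have "\<dots> \<approx>\<^bsub>E\<^esub> (if x = tail E a then gen (Vertex (tail E a)) else 0) * gen (Edge a)"
    by (intro lcong_mult_assoc vertex_vertex assms t)
  finally show ?thesis using assms by simp
qed

lemma ghost_vertex_other:
  assumes "wf_digraph E" "a \<in> arcs E" "x \<in> verts E" "x \<noteq> tail E a"
  shows "gen (Ghost a) * gen (Vertex x) \<approx>\<^bsub>E\<^esub> 0"
proof -
  have t: "tail E a \<in> verts E" using assms by (simp add: wf_digraph.tail_in_verts)
  have "gen (Ghost a) * gen (Vertex x) \<approx>\<^bsub>E\<^esub> (gen (Ghost a) * gen (Vertex (tail E a))) * gen (Vertex x)"
    by (intro lcong_multR lcong_sym[OF ghost_tail] assms)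
  also have "\<dots> \<approx>\<^bsub>E\<^esub> gen (Ghost a) * (if tail E a = x then gen (Vertex x) else 0)"
    unfolding mult.assoc by (intro lcong_multL vertex_vertex assms t)
  finally show ?thesis using assms by simp
qed

text \<open>At a source this is the out-split that separates \<open>f\<close> from the other edges
  with the same source; no incoming edges have to be doubled.\<close>

definition split_source :: "('v, 'e) pre_digraph \<Rightarrow> 'e \<Rightarrow> 'v \<Rightarrow> ('v, 'e) pre_digraph" where
  "split_source G f w = \<lparr>verts = insert w (verts G), arcs = arcs G, tail = (tail G)(f := w), head = head G\<rparr>"

text \<open>The assumption \<open>several\<close> ensures that the old vertex still emits an edge
  after \<open>f\<close> has moved to \<open>w\<close>, and hence stays regular.\<close>

locale source_split = fin_digraph G for G :: "('v, 'e) pre_digraph" +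
  fixes K :: "'k::field itself" and f :: 'e and w :: 'v
  assumes f: "f \<in> arcs G"
    and source: "in_arcs G (tail G f) = {}"
    and several: "out_arcs G (tail G f) \<noteq> {f}"
    and w: "w \<notin> verts G"
begin

abbreviation vt :: "'v \<Rightarrow> ('v, 'e, 'k) leavitt_poly" where "vt v \<equiv> gen (Vertex v)"
abbreviation ed :: "'e \<Rightarrow> ('v, 'e, 'k) leavitt_poly" where "ed a \<equiv> gen (Edge a)"
abbreviation gh :: "'e \<Rightarrow> ('v, 'e, 'k) leavitt_poly" where "gh a \<equiv> gen (Ghost a)"
abbreviation "S \<equiv> split_source G f w"
abbreviation "u \<equiv> tail G f"

lemma split_simps [simp]:
  "verts S = insert w (verts G)" "arcs S = arcs G" "head S = head G" "tail S f = w"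
  "a \<noteq> f \<Longrightarrow> tail S a = tail G a"
  by (simp_all add: split_source_def)

lemma u_w [simp]: "u \<noteq> w" "w \<noteq> u" "u \<in> verts G"
  using f w by auto

lemma head_ne [simp]: "a \<in> arcs G \<Longrightarrow> head G a \<noteq> u" "a \<in> arcs G \<Longrightarrow> head G a \<noteq> w"
  using source w by auto

lemma tail_ne [simp]: "a \<in> arcs G \<Longrightarrow> tail G a \<noteq> w" "a \<in> arcs G \<Longrightarrow> w \<noteq> tail G a"
  using w by auto

lemma fin_digraph_split: "fin_digraph S"
proof
  fix a assume "a \<in> arcs S"
  then show "tail S a \<in> verts S" by (cases "a = f") auto
qed auto

lemma wf_split: "wf_digraph S"
  using fin_digraph_split by (rule wf_digraph_fin)

lemma out_arcs_S:
  "out_arcs S w = {f}" "out_arcs S u = out_arcs G u - {f}" "v \<noteq> u \<Longrightarrow> v \<noteq> w \<Longrightarrow> out_arcs S v = out_arcs G v"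
  using f by (auto simp: out_arcs_def split_source_def)

lemma finite_out [simp]: "finite (out_arcs G v)"
  by (rule finite_subset[OF _ finite_arcs]) auto

lemma regular_S: "is_regular S w" "is_regular S u"
proof -
  have "f \<in> out_arcs G u" using f by simp
  then show "is_regular S w" "is_regular S u"
    using several by (auto simp: is_regular_def out_arcs_S simp del: in_out_arcs_conv)
qed

text \<open>The idempotent of \<open>f\<close> below the vertex \<open>u\<close>. In the algebra of
  \<open>G\<close> it plays the new vertex \<open>w\<close>, and its complement
  \<open>vt u - P\<close> plays what remains of \<open>u\<close>.\<close>

definition P :: "('v, 'e, 'k) leavitt_poly" where "P = ed f * gh f"

definition V :: "'v \<Rightarrow> ('v, 'e, 'k) leavitt_poly" where
  "V v = (if v = u then vt u + vt w else vt v)"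

definition W :: "'v \<Rightarrow> ('v, 'e, 'k) leavitt_poly" where
  "W v = (if v = w then P else if v = u then vt u - P else vt v)"

lemma V_simps [simp]: "V u = vt u + vt w" "v \<noteq> u \<Longrightarrow> V v = vt v"
  by (simp_all add: V_def)

lemma W_simps [simp]: "W w = P" "W u = vt u - P" "v \<noteq> u \<Longrightarrow> v \<noteq> w \<Longrightarrow> W v = vt v"
  by (simp_all add: W_def)

lemma P_S: "P \<approx>\<^bsub>S\<^esub> vt w"
  using lcong_sym[OF vertex_sum[where 'k='k, OF regular_S(1)]] by (simp add: out_arcs_S P_def)

lemma sum_u: "vt u - P \<approx>\<^bsub>G\<^esub> (\<Sum>a\<in>out_arcs G u - {f}. ed a * gh a)"
proof -
  have fo: "f \<in> out_arcs G u" using f by simp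
  then have "is_regular G u" by (auto simp: is_regular_def simp del: in_out_arcs_conv)
  from vertex_sum[where 'k='k, OF this] have "vt u \<approx>\<^bsub>G\<^esub> P + (\<Sum>a\<in>out_arcs G u - {f}. ed a * gh a)"
    by (simp add: sum.remove[OF finite_out fo] P_def)
  from lcong_diff[OF this lcong_refl[of P]] show ?thesis by simp
qed

lemma P_products:
  "P * P \<approx>\<^bsub>G\<^esub> P" "vt u * P \<approx>\<^bsub>G\<^esub> P" "P * vt u \<approx>\<^bsub>G\<^esub> P"
  "x \<in> verts G \<Longrightarrow> x \<noteq> u \<Longrightarrow> vt x * P \<approx>\<^bsub>G\<^esub> 0" "x \<in> verts G \<Longrightarrow> x \<noteq> u \<Longrightarrow> P * vt x \<approx>\<^bsub>G\<^esub> 0"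
proof -
  have "P * P \<approx>\<^bsub>G\<^esub> ed f * vt (head G f) * gh f"
    unfolding P_def using ghost_edge[where 'k='k, of f G f] f by (intro lcong_mult_mid) simp
  also have "\<dots> \<approx>\<^bsub>G\<^esub> P" unfolding P_def by (intro lcong_multR edge_head f)
  finally show "P * P \<approx>\<^bsub>G\<^esub> P" .
  show "vt u * P \<approx>\<^bsub>G\<^esub> P" unfolding P_def by (intro lcong_mult_assoc tail_edge f)
  show "P * vt u \<approx>\<^bsub>G\<^esub> P" unfolding P_def mult.assoc by (intro lcong_multL ghost_tail f)
  show "vt x * P \<approx>\<^bsub>G\<^esub> 0" if "x \<in> verts G" "x \<noteq> u"
    using lcong_mult_assoc[OF vertex_edge_other[OF wf_digraph f that], of "gh f"] by (simp add: P_def)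
  show "P * vt x \<approx>\<^bsub>G\<^esub> 0" if "x \<in> verts G" "x \<noteq> u"
    using lcong_multL[OF ghost_vertex_other[OF wf_digraph f that], of "ed f"] by (simp add: P_def mult.assoc)
qed

lemma family_S: "leavitt_family S G V ed gh"
  unfolding leavitt_family_def
proof (intro conjI ballI allI impI)
  have vv: "vt x * vt y \<approx>\<^bsub>S\<^esub> (if x = y then vt y else 0)" if "x \<in> verts S" "y \<in> verts S" for x y
    using that by (rule vertex_vertex)
  fix x y assume xy: "x \<in> verts G" "y \<in> verts G"
  consider "x = u" "y = u" | "x = u" "y \<noteq> u" | "x \<noteq> u" "y = u" | "x \<noteq> u" "y \<noteq> u" by blast
  then show "V x * V y \<approx>\<^bsub>S\<^esub> (if x = y then V y else 0)"
  proof cases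
    case 1
    have "(vt u + vt w) * (vt u + vt w) = (vt u * vt u + vt u * vt w) + (vt w * vt u + vt w * vt w)"
      by (simp add: distrib_left distrib_right)
    also have "\<dots> \<approx>\<^bsub>S\<^esub> (vt u + 0) + (0 + vt w)"
      using vv[of u u] vv[of u w] vv[of w u] vv[of w w] by (intro lcong_add) simp_all
    finally show ?thesis using 1 by simp
  next
    case 2
    have "vt u * vt y + vt w * vt y \<approx>\<^bsub>S\<^esub> 0 + 0"
      using vv[of u y] vv[of w y] xy 2 w by (intro lcong_add) (auto split: if_splits)
    then show ?thesis using 2 by (simp add: distrib_right)
  next
    case 3
    have "vt x * vt u + vt x * vt w \<approx>\<^bsub>S\<^esub> 0 + 0"
      using vv[of x u] vv[of x w] xy 3 w by (intro lcong_add) (auto split: if_splits)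
    then show ?thesis using 3 by (simp add: distrib_left)
  next
    case 4
    then show ?thesis using vv[of x y] xy by (cases "x = y") simp_all
  qed
next
  fix a assume a: "a \<in> arcs G"
  have aS: "a \<in> arcs S" using a by simp
  show "V (tail G a) * ed a \<approx>\<^bsub>S\<^esub> ed a"
  proof (cases "a = f")
    case True
    have "vt u * ed a + vt w * ed a \<approx>\<^bsub>S\<^esub> 0 + ed a"
      using vertex_edge_other[OF wf_split aS, of u, where ?'c='k] tail_edge[where 'k='k, OF aS] True
      by (intro lcong_add) simp_all
    then show ?thesis using True by (simp add: distrib_right)
  next
    case False
    show ?thesis
    proof (cases "tail G a = u")
      case True
      have "vt u * ed a + vt w * ed a \<approx>\<^bsub>S\<^esub> ed a + 0"
        using vertex_edge_other[OF wf_split aS, of w, where ?'c='k] tail_edge[where 'k='k, OF aS] True False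
        by (intro lcong_add) simp_all
      then show ?thesis using True by (simp add: distrib_right)
    qed (use False tail_edge[where 'k='k, OF aS] in simp)
  qed
  show "gh a * V (tail G a) \<approx>\<^bsub>S\<^esub> gh a"
  proof (cases "a = f")
    case True
    have "gh a * vt u + gh a * vt w \<approx>\<^bsub>S\<^esub> 0 + gh a"
      using ghost_vertex_other[OF wf_split aS, of u, where ?'c='k] ghost_tail[where 'k='k, OF aS] True
      by (intro lcong_add) simp_all
    then show ?thesis using True by (simp add: distrib_left)
  next
    case False
    show ?thesis
    proof (cases "tail G a = u")
      case True
      have "gh a * vt u + gh a * vt w \<approx>\<^bsub>S\<^esub> gh a + 0"
        using ghost_vertex_other[OF wf_split aS, of w, where ?'c='k] ghost_tail[where 'k='k, OF aS] True False
        by (intro lcong_add) simp_all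
      then show ?thesis using True by (simp add: distrib_left)
    qed (use False ghost_tail[where 'k='k, OF aS] in simp)
  qed
  show "ed a * V (head G a) \<approx>\<^bsub>S\<^esub> ed a" using a edge_head[where 'k='k, OF aS] by simp
  show "V (head G a) * gh a \<approx>\<^bsub>S\<^esub> gh a" using a head_ghost[where 'k='k, OF aS] by simp
next
  fix a b assume "a \<in> arcs G" "b \<in> arcs G"
  then show "gh a * ed b \<approx>\<^bsub>S\<^esub> (if a = b then V (head G a) else 0)"
    using ghost_edge[where 'k='k, of a S b] by (cases "a = b") simp_all
next
  fix x assume reg: "is_regular G x"
  show "V x \<approx>\<^bsub>S\<^esub> (\<Sum>a\<in>out_arcs G x. ed a * gh a)"
  proof (cases "x = u")
    case True
    have fo: "f \<in> out_arcs G u" using f by simp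
    have "vt u + vt w \<approx>\<^bsub>S\<^esub> (\<Sum>a\<in>out_arcs G u - {f}. ed a * gh a) + P"
      using vertex_sum[where 'k='k, OF regular_S(2)] by (intro lcong_add lcong_sym[OF P_S]) (simp add: out_arcs_S)
    then show ?thesis using True by (simp add: sum.remove[OF finite_out fo] P_def add.commute)
  next
    case False
    have "x \<noteq> w" using reg w by (auto simp: is_regular_def)
    moreover from this have "is_regular S x" using reg False by (simp add: is_regular_def out_arcs_S)
    ultimately show ?thesis using vertex_sum[where 'k='k, of S x] False by (simp add: out_arcs_S)
  qed
qed

lemma family_G: "leavitt_family G S W ed gh"
  unfolding leavitt_family_def
proof (intro conjI ballI allI impI)
  have vv: "vt x * vt y \<approx>\<^bsub>G\<^esub> (if x = y then vt y else 0)" if "x \<in> verts G" "y \<in> verts G" for x y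
    using that by (rule vertex_vertex)
  have uu: "vt u * vt u \<approx>\<^bsub>G\<^esub> vt u" using vv[of u u] by simp
  fix x y assume "x \<in> verts S" "y \<in> verts S"
  then have x: "x = w \<or> x = u \<or> (x \<in> verts G \<and> x \<noteq> u \<and> x \<noteq> w)"
    and y: "y = w \<or> y = u \<or> (y \<in> verts G \<and> y \<noteq> u \<and> y \<noteq> w)" using w by auto
  have ux: "vt u * vt x \<approx>\<^bsub>G\<^esub> 0" "vt x * vt u \<approx>\<^bsub>G\<^esub> 0" if "x \<in> verts G" "x \<noteq> u" for x
    using vv[of u x] vv[of x u] that by auto
  \<comment> \<open>\<open>P\<close> is an idempotent below \<open>vt u\<close>, so \<open>P\<close>
    and its complement in \<open>vt u\<close> are orthogonal idempotents.\<close>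
  have 1: "P * (vt u - P) \<approx>\<^bsub>G\<^esub> 0" "(vt u - P) * P \<approx>\<^bsub>G\<^esub> 0" "(vt u - P) * (vt u - P) \<approx>\<^bsub>G\<^esub> vt u - P"
  proof -
    show "P * (vt u - P) \<approx>\<^bsub>G\<^esub> 0" using lcong_diff[OF P_products(3,1)] by (simp add: right_diff_distrib)
    show *: "(vt u - P) * P \<approx>\<^bsub>G\<^esub> 0" using lcong_diff[OF P_products(2,1)] by (simp add: left_diff_distrib)
    have "(vt u * vt u - P * vt u) - (vt u - P) * P \<approx>\<^bsub>G\<^esub> (vt u - P) - 0"
      by (intro lcong_diff uu P_products *)
    then show "(vt u - P) * (vt u - P) \<approx>\<^bsub>G\<^esub> vt u - P"
      by (simp add: right_diff_distrib left_diff_distrib)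
  qed
  have 2: "(vt u - P) * vt x \<approx>\<^bsub>G\<^esub> 0" "vt x * (vt u - P) \<approx>\<^bsub>G\<^esub> 0" if "x \<in> verts G" "x \<noteq> u" for x
    using lcong_diff[OF ux(1) P_products(5), OF that that] lcong_diff[OF ux(2) P_products(4), OF that that]
    by (simp_all add: right_diff_distrib left_diff_distrib)
  show "W x * W y \<approx>\<^bsub>G\<^esub> (if x = y then W y else 0)"
    using x y vv[of x y] by (elim disjE conjE) (simp_all add: 1 2 P_products split: if_splits)
next
  fix a assume "a \<in> arcs S"
  then have a: "a \<in> arcs G" by simp
  show "W (tail S a) * ed a \<approx>\<^bsub>G\<^esub> ed a"
  proof (cases "a = f")
    case True
    have "ed f * (gh f * ed f) \<approx>\<^bsub>G\<^esub> ed f * vt (head G f)"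
      using ghost_edge[where 'k='k, of f G f] f by (intro lcong_multL) simp
    also have "\<dots> \<approx>\<^bsub>G\<^esub> ed f" by (intro edge_head f)
    finally show ?thesis using True by (simp add: P_def mult.assoc)
  next
    case False
    show ?thesis
    proof (cases "tail G a = u")
      case True
      have "ed f * (gh f * ed a) \<approx>\<^bsub>G\<^esub> ed f * 0"
        using ghost_edge[where 'k='k, of f G a] f a False by (intro lcong_multL) simp
      then have "vt u * ed a - P * ed a \<approx>\<^bsub>G\<^esub> ed a - 0"
        using tail_edge[where 'k='k, OF a] True by (intro lcong_diff) (simp_all add: P_def mult.assoc)
      then show ?thesis using False True by (simp add: left_diff_distrib)
    qed (use a False tail_edge[where 'k='k, OF a] in simp)
  qed
  show "gh a * W (tail S a) \<approx>\<^bsub>G\<^esub> gh a"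
  proof (cases "a = f")
    case True
    have "gh f * (ed f * gh f) \<approx>\<^bsub>G\<^esub> vt (head G f) * gh f"
      using ghost_edge[where 'k='k, of f G f] f by (intro lcong_mult_assoc) simp
    also have "\<dots> \<approx>\<^bsub>G\<^esub> gh f" by (intro head_ghost f)
    finally show ?thesis using True by (simp add: P_def)
  next
    case False
    show ?thesis
    proof (cases "tail G a = u")
      case True
      have "gh a * (ed f * gh f) \<approx>\<^bsub>G\<^esub> 0 * gh f"
        using ghost_edge[where 'k='k, of a G f] f a False by (intro lcong_mult_assoc) simp
      then have "gh a * vt u - gh a * P \<approx>\<^bsub>G\<^esub> gh a - 0"
        using ghost_tail[where 'k='k, OF a] True by (intro lcong_diff) (simp_all add: P_def)
      then show ?thesis using False True by (simp add: right_diff_distrib)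
    qed (use a False ghost_tail[where 'k='k, OF a] in simp)
  qed
  show "ed a * W (head S a) \<approx>\<^bsub>G\<^esub> ed a" using a edge_head[where 'k='k, OF a] by simp
  show "W (head S a) * gh a \<approx>\<^bsub>G\<^esub> gh a" using a head_ghost[where 'k='k, OF a] by simp
next
  fix a b assume "a \<in> arcs S" "b \<in> arcs S"
  then show "gh a * ed b \<approx>\<^bsub>G\<^esub> (if a = b then W (head S a) else 0)"
    using ghost_edge[where 'k='k, of a G b] by (cases "a = b") simp_all
next
  fix x assume reg: "is_regular S x"
  consider "x = w" | "x = u" | "x \<noteq> w" "x \<noteq> u" by blast
  then show "W x \<approx>\<^bsub>G\<^esub> (\<Sum>a\<in>out_arcs S x. ed a * gh a)"
  proof cases
    case 1
    then show ?thesis by (simp add: out_arcs_S P_def)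
  next
    case 2
    then show ?thesis using sum_u by (simp add: out_arcs_S)
  next
    case 3
    then have "is_regular G x" using reg by (simp add: is_regular_def out_arcs_S)
    then show ?thesis using vertex_sum[where 'k='k, of G x] 3 by (simp add: out_arcs_S)
  qed
qed

theorem split_isomorphic:
  "algebra_isomorphic (leavitt_path_algebra TYPE('k) G) (leavitt_path_algebra TYPE('k) S)"
proof (rule algebra_isomorphicI[OF wf_digraph wf_split family_S family_G])
  have g: "\<And>v. v \<in> verts H \<Longrightarrow> gen (Vertex v) \<in> free_algebra (leavitt_gens H)"
    "\<And>v. v \<in> arcs H \<Longrightarrow> gen (Edge v) \<in> free_algebra (leavitt_gens H)"
    "\<And>v. v \<in> arcs H \<Longrightarrow> gen (Ghost v) \<in> free_algebra (leavitt_gens H)"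
    for H :: "('v, 'e) pre_digraph" by (auto simp: leavitt_gens_def intro: free_algebra_gen)
  {
    fix x assume "x \<in> leavitt_gens G"
    then show "gen_map G V ed gh x \<in> free_algebra (leavitt_gens S)"
      by (cases rule: leavitt_gensE) (auto simp: V_def intro!: g free_algebra_add)
  next
    fix x assume "x \<in> leavitt_gens S"
    then show "gen_map S W ed gh x \<in> free_algebra (leavitt_gens G)"
      by (cases rule: leavitt_gensE) (auto simp: W_def P_def f intro!: g free_algebra_diff free_algebra_mult)
  next
    fix x assume "x \<in> leavitt_gens G"
    then show "subst (gen_map S W ed gh) (gen_map G V ed gh x) \<approx>\<^bsub>G\<^esub> gen x"
    proof (cases rule: leavitt_gensE)
      case (1 v)
      then have "v \<noteq> w" using w by auto
      then show ?thesis using 1 by (cases "v = u") (simp_all add: subst_add)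
    qed simp_all
  next
    fix x assume "x \<in> leavitt_gens S"
    then show "subst (gen_map G V ed gh) (gen_map S W ed gh x) \<approx>\<^bsub>S\<^esub> gen x"
    proof (cases rule: leavitt_gensE)
      case (1 v)
      have P: "subst (gen_map G V ed gh) P = P" using f by (simp add: P_def subst_mult)
      consider "v = w" | "v = u" | "v \<noteq> w" "v \<noteq> u" "v \<in> verts G" using 1 by auto
      then show ?thesis
      proof cases
        case 1
        then show ?thesis using \<open>x = Vertex v\<close> P_S by (simp add: P)
      next
        case 2
        have "vt u + vt w - P \<approx>\<^bsub>S\<^esub> vt u + vt w - vt w" by (intro lcong_diff P_S lcong_refl)
        then show ?thesis using \<open>x = Vertex v\<close> 2 by (simp add: P subst_diff)
      qed (use \<open>x = Vertex v\<close> in simp)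
    qed simp_all
  }
  \<comment> \<open>The second summand of \<open>V u\<close> is exactly the vertex by which the
    identity of the split graph grows.\<close>
  have "(\<Sum>v\<in>verts G. V v) = (\<Sum>v\<in>verts G. vt v) + vt w"
    using sum.remove[of "verts G" u V] sum.remove[of "verts G" u vt] by (simp add: algebra_simps)
  then show "(\<Sum>v\<in>verts G. V v) \<approx>\<^bsub>S\<^esub> (\<Sum>v\<in>verts S. gen (Vertex v))"
    using w by (simp add: add.commute)
qed

end

subsection \<open>Cycles up to rotation\<close>

text \<open>Cutting a list in two replaces the rotation count, which does not survive insertion or
  deletion of edges.\<close>

lemma cycle_class_append: "cycle_class c = {ys @ xs | xs ys. c = xs @ ys}"
proof (intro Set.set_eqI iffI)
  fix d assume "d \<in> cycle_class c"
  then obtain n where "d = rotate n c" by (auto simp: cycle_class_def)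
  then have "d = drop (n mod length c) c @ take (n mod length c) c" by (simp add: rotate_drop_take)
  then show "d \<in> {ys @ xs | xs ys. c = xs @ ys}" by (metis (mono_tags, lifting) append_take_drop_id mem_Collect_eq)
next
  fix d assume "d \<in> {ys @ xs | xs ys. c = xs @ ys}"
  then obtain xs ys where "d = ys @ xs" "c = xs @ ys" by blast
  then have "d = rotate (length xs) c" by (simp add: rotate_append)
  then show "d \<in> cycle_class c" by (auto simp: cycle_class_def)
qed

lemma cycle_class_self: "c \<in> cycle_class c"
  by (auto simp: cycle_class_append)

lemma cycle_class_eq:
  assumes "d \<in> cycle_class c"
  shows "cycle_class d = cycle_class c"
proof -
  have sub: "cycle_class d \<subseteq> cycle_class c" if "d \<in> cycle_class c" for d c :: "'a list"
    using that by (auto simp: cycle_class_def rotate_rotate)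
  have "c \<in> cycle_class d" using assms by (auto simp: cycle_class_append)
  then show ?thesis using sub assms by blast
qed

lemma cas_tails_heads: "pre_digraph.cas G x c y \<Longrightarrow> map (tail G) c @ [y] = x # map (head G) c"
  by (induction c arbitrary: x) (auto simp: pre_digraph.cas.simps)

text \<open>Along a closed walk the list of ranges is the list of sources rotated by one place, so
  distinctness may be tested on the sources. These do not change when the range of an edge is
  redirected.\<close>

lemma cycle_iff:
  assumes "wf_digraph G"
  shows "pre_digraph.cycle G c \<longleftrightarrow>
    c \<noteq> [] \<and> set c \<subseteq> arcs G \<and> (\<exists>x. pre_digraph.cas G x c x) \<and> distinct (map (tail G) c)"
proof -
  interpret wf_digraph G by fact
  have "distinct (tl (awalk_verts x c)) \<longleftrightarrow> distinct (map (tail G) c)" if cx: "cas x c x" and ne: "c \<noteq> []" for x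
  proof -
    have "map (tail G) c @ [x] = x # map (head G) c" by (rule cas_tails_heads[OF cx])
    then obtain r where "map (tail G) c = x # r" "map (head G) c = r @ [x]"
      using ne by (cases "map (tail G) c") auto
    then show ?thesis using ne by (auto simp: awalk_verts_conv'[OF cx])
  qed
  moreover have "x \<in> verts G" if "cas x c x" "c \<noteq> []" "set c \<subseteq> arcs G" for x
    using that by (cases c) auto
  ultimately show ?thesis unfolding cycle_def awalk_def by blast
qed

lemma cycle_heads:
  assumes "wf_digraph G" "pre_digraph.cycle G c"
  shows "head G ` set c = tail G ` set c"
proof -
  obtain x where "pre_digraph.cas G x c x" "c \<noteq> []" using assms by (auto simp: cycle_iff)
  from cas_tails_heads[OF this(1)] this(2) obtain r where "map (tail G) c = x # r" "map (head G) c = r @ [x]"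
    by (cases "map (tail G) c") auto
  then have "set (map (head G) c) = set (map (tail G) c)" by simp
  then show ?thesis by simp
qed

lemma cas_append: "pre_digraph.cas G x (p @ q) y \<longleftrightarrow> (\<exists>z. pre_digraph.cas G x p z \<and> pre_digraph.cas G z q y)"
  by (induction p arbitrary: x) (auto simp: pre_digraph.cas.simps)

lemma cycle_rotate:
  assumes "wf_digraph G" "pre_digraph.cycle G c" "d \<in> cycle_class c"
  shows "pre_digraph.cycle G d"
proof -
  obtain xs ys where "c = xs @ ys" "d = ys @ xs" using assms(3) by (auto simp: cycle_class_append)
  moreover obtain x z where "pre_digraph.cas G x xs z" "pre_digraph.cas G z ys x"
    using assms(2) calculation by (auto simp: cycle_iff[OF assms(1)] cas_append)
  then have "pre_digraph.cas G z (ys @ xs) z" by (auto simp: cas_append)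
  ultimately show ?thesis using assms(2) by (auto simp: cycle_iff[OF assms(1)])
qed

lemma cycle_class_set: "d \<in> cycle_class c \<Longrightarrow> set d = set c"
  by (auto simp: cycle_class_append)

text \<open>Being without exits and being a source cycle are both conditions on the single edges of
  a cycle, so one bijection can serve both kinds.\<close>

definition cycles_with :: "('v, 'e) pre_digraph \<Rightarrow> ('e \<Rightarrow> bool) \<Rightarrow> 'e list set set" where
  "cycles_with G P = cycle_class ` {c. pre_digraph.cycle G c \<and> (\<forall>a\<in>set c. P a)}"

lemma cycles_withI: "pre_digraph.cycle G c \<Longrightarrow> (\<And>a. a \<in> set c \<Longrightarrow> P a) \<Longrightarrow> cycle_class c \<in> cycles_with G P"
  by (auto simp: cycles_with_def)

lemma cycles_without_exits_eq:
  "cycles_without_exits G = cycles_with G (\<lambda>a. \<forall>b\<in>arcs G. tail G b = tail G a \<longrightarrow> b = a)"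
  unfolding cycles_without_exits_def cycles_with_def has_exit_def by (rule arg_cong[where f = "image _"]) auto

lemma source_cycles_eq:
  assumes "wf_digraph G"
  shows "source_cycles G = cycles_with G (\<lambda>a. card (in_arcs G (tail G a)) = 1)"
proof -
  have "source_cycle G c \<longleftrightarrow> pre_digraph.cycle G c \<and> (\<forall>a\<in>set c. card (in_arcs G (tail G a)) = 1)" for c
    using cycle_heads[OF assms, of c] by (simp add: source_cycle_def path_verts_def cong: conj_cong)
  then show ?thesis by (simp add: source_cycles_def cycles_with_def)
qed

lemma map_cycle_class: "map \<beta> ` cycle_class c = cycle_class (map \<beta> c)"
  by (auto simp: cycle_class_def rotate_map)

lemma cas_map:
  assumes "graph_iso \<alpha> \<beta> G H" "set c \<subseteq> arcs G" "pre_digraph.cas G x c y"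
  shows "pre_digraph.cas H (\<alpha> x) (map \<beta> c) (\<alpha> y)"
  using assms(2,3)
  by (induction c arbitrary: x) (use assms(1) in \<open>auto simp: pre_digraph.cas.simps graph_iso_def\<close>)

lemma cycle_map:
  assumes "wf_digraph G" "wf_digraph H" "graph_iso \<alpha> \<beta> G H" "pre_digraph.cycle G c"
  shows "pre_digraph.cycle H (map \<beta> c)"
proof -
  interpret wf_digraph G by fact
  obtain x where c: "c \<noteq> []" "set c \<subseteq> arcs G" "cas x c x" "distinct (map (tail G) c)"
    using assms by (auto simp: cycle_iff)
  have "map (tail H) (map \<beta> c) = map \<alpha> (map (tail G) c)"
    using c(2) assms(3) by (auto simp: graph_iso_def)
  moreover have "inj_on \<alpha> (set (map (tail G) c))"
    by (rule inj_on_subset[of \<alpha> "verts G"]) (use assms(3) c(2) in \<open>auto simp: graph_iso_def bij_betw_def\<close>)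
  ultimately have "distinct (map (tail H) (map \<beta> c))" using c(4) by (simp only: distinct_map)
  moreover have "set (map \<beta> c) \<subseteq> arcs H"
    using assms(3) image_mono[OF c(2), of \<beta>] by (simp add: graph_iso_def bij_betw_def)
  ultimately show ?thesis
    using c cas_map[OF assms(3) c(2,3)] by (auto simp: cycle_iff[OF assms(2)])
qed

lemma cycles_with_graph_iso:
  assumes wf: "wf_digraph G" "wf_digraph H" and iso: "graph_iso \<alpha> \<beta> G H"
    and P: "\<And>a. a \<in> arcs G \<Longrightarrow> Q (\<beta> a) \<longleftrightarrow> P a"
  shows "\<exists>\<phi>. bij_betw \<phi> (cycles_with G P) (cycles_with H Q)"
proof (intro exI bij_betw_imageI)
  have \<beta>: "inj_on \<beta> (arcs G)" "\<beta> ` arcs G = arcs H" using iso by (auto simp: graph_iso_def bij_betw_def)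
  have arcsG: "set c \<subseteq> arcs G" if "pre_digraph.cycle G c" for c using that wf by (simp add: cycle_iff)
  have arcsH: "set c \<subseteq> arcs H" if "pre_digraph.cycle H c" for c using that wf by (simp add: cycle_iff)
  have "inj_on (map \<beta>) (lists (arcs G))" using \<beta>(1) by (rule inj_on_mapI[OF inj_on_subset]) auto
  then have "inj_on (image (map \<beta>)) (Pow (lists (arcs G)))" by (rule inj_on_image_Pow)
  moreover have "cycles_with G P \<subseteq> Pow (lists (arcs G))"
    using arcsG by (auto simp: cycles_with_def dest!: cycle_class_set)
  ultimately show "inj_on (image (map \<beta>)) (cycles_with G P)" by (rule inj_on_subset)
  show "image (map \<beta>) ` cycles_with G P = cycles_with H Q"
  proof (intro equalityI subsetI)
    fix X assume "X \<in> image (map \<beta>) ` cycles_with G P"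
    then obtain c where c: "X = cycle_class (map \<beta> c)" "pre_digraph.cycle G c" "\<forall>a\<in>set c. P a"
      by (auto simp: cycles_with_def map_cycle_class)
    show "X \<in> cycles_with H Q"
      unfolding c(1) using c(3) arcsG[OF c(2)] P by (intro cycles_withI cycle_map[OF wf iso c(2)]) auto
  next
    fix X assume "X \<in> cycles_with H Q"
    then obtain c where c: "X = cycle_class c" "pre_digraph.cycle H c" "\<forall>a\<in>set c. Q a"
      by (auto simp: cycles_with_def)
    define d where "d = map (inv_into (arcs G) \<beta>) c"
    have *: "b \<in> \<beta> ` arcs G" if "b \<in> set c" for b using arcsH[OF c(2)] \<beta>(2) that by blast
    have "map (\<beta> \<circ> inv_into (arcs G) \<beta>) c = c" by (rule map_idI) (simp add: f_inv_into_f *)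
    then have d: "map \<beta> d = c" by (simp add: d_def)
    have dG: "set d \<subseteq> arcs G" using * by (auto simp: d_def inv_into_into)
    have "pre_digraph.cycle G d"
      unfolding d_def by (rule cycle_map[OF wf(2,1) graph_iso_sym[OF wf(1) iso] c(2)])
    moreover have "P a" if "a \<in> set d" for a
    proof -
      have "\<beta> a \<in> set (map \<beta> d)" using that by simp
      then show ?thesis using c(3) P[of a] dG that unfolding d by blast
    qed
    ultimately have "cycle_class d \<in> cycles_with G P" by (rule cycles_withI)
    moreover have "X = map \<beta> ` cycle_class d" by (simp add: map_cycle_class d c)
    ultimately show "X \<in> image (map \<beta>) ` cycles_with G P" by blast
  qed
qed

lemma graph_iso_cycles:
  assumes wf: "wf_digraph G" "wf_digraph H" and iso: "graph_iso \<alpha> \<beta> G H"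
  shows "\<exists>\<phi>. bij_betw \<phi> (cycles_without_exits G) (cycles_without_exits H)"
    and "\<exists>\<phi>. bij_betw \<phi> (source_cycles G) (source_cycles H)"
proof -
  have i: "inj_on \<alpha> (verts G)" "inj_on \<beta> (arcs G)" "arcs H = \<beta> ` arcs G" 
    and t: "\<And>a. a \<in> arcs G \<Longrightarrow> tail H (\<beta> a) = \<alpha> (tail G a)"
    and v: "\<And>a. a \<in> arcs G \<Longrightarrow> tail G a \<in> verts G"
    using iso wf by (auto simp: graph_iso_def bij_betw_def wf_digraph_def)
  show "\<exists>\<phi>. bij_betw \<phi> (cycles_without_exits G) (cycles_without_exits H)"
    unfolding cycles_without_exits_eq
    by (rule cycles_with_graph_iso[OF wf iso]) (simp add: i(3) t v inj_on_eq_iff[OF i(1)] inj_on_eq_iff[OF i(2)])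
  have "card (in_arcs H (tail H (\<beta> a))) = card (in_arcs G (tail G a))" if "a \<in> arcs G" for a
  proof -
    have "inj_on \<beta> (in_arcs G (tail G a))" by (rule inj_on_subset[OF i(2)]) auto
    then show ?thesis using that by (simp add: t graph_iso_in_arcs[OF wf(1) iso v] card_image)
  qed
  then show "\<exists>\<phi>. bij_betw \<phi> (source_cycles G) (source_cycles H)"
    unfolding source_cycles_eq[OF wf(1)] source_cycles_eq[OF wf(2)]
    by (intro cycles_with_graph_iso[OF wf iso]) simp
qed

subsection \<open>Subdividing an edge\<close>

text \<open>A cut of the filtered list lifts to a cut of the original list; on which side the
  discarded entries fall is immaterial.\<close>

lemma filter_eq_appendE:
  assumes "filter P d = as @ bs"
  obtains xs ys where "d = xs @ ys" "filter P xs = as" "filter P ys = bs"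
  using assms
proof (induction d arbitrary: as thesis)
  case (Cons a d)
  show ?case
  proof (cases "P a \<and> as \<noteq> []")
    case True
    then obtain as' where "as = a # as'" "filter P d = as' @ bs" using Cons.prems(2) by (cases as) auto
    then obtain xs ys where "d = xs @ ys" "filter P xs = as'" "filter P ys = bs" using Cons.IH by blast
    then show ?thesis using Cons.prems(1)[of "a # xs" ys] True \<open>as = a # as'\<close> by simp
  next
    case False
    show ?thesis
    proof (cases "P a")
      case True
      then show ?thesis using False Cons.prems(1)[of "[]" "a # d"] Cons.prems(2) by simp
    next
      case nP: False
      then have "filter P d = as @ bs" using Cons.prems(2) by simp
      then obtain xs ys where "d = xs @ ys" "filter P xs = as" "filter P ys = bs" using Cons.IH by blast
      then show ?thesis using Cons.prems(1)[of "a # xs" ys] nP by simp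
    qed
  qed
qed auto

text \<open>Cuts descend to the filtered list and lift back by \<open>filter_eq_appendE\<close>, so
  deletion maps rotation classes onto rotation classes.\<close>

lemma filter_cycle_class: "filter P ` cycle_class d = cycle_class (filter P d)"
proof (intro equalityI subsetI)
  fix X assume "X \<in> filter P ` cycle_class d"
  then show "X \<in> cycle_class (filter P d)" by (fastforce simp: cycle_class_append)
next
  fix X assume "X \<in> cycle_class (filter P d)"
  then obtain as bs where X: "X = bs @ as" and "filter P d = as @ bs" by (auto simp: cycle_class_append)
  from this(2) obtain xs ys where "d = xs @ ys" "filter P xs = as" "filter P ys = bs" by (rule filter_eq_appendE)
  then have "ys @ xs \<in> cycle_class d" "X = filter P (ys @ xs)" by (auto simp: cycle_class_append X)
  then show "X \<in> filter P ` cycle_class d" by blast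
qed

text \<open>The first half of the subdivided edge keeps the name \<open>e\<close> and
  \<open>f\<close> is the second half. Hence old edges keep their sources, and the only range that
  moves is that of \<open>e\<close>.\<close>

locale edge_subdivision = wf_digraph G for G :: "('v, 'e) pre_digraph" +
  fixes G' :: "('v, 'e) pre_digraph" and e f :: 'e and u :: 'v
  assumes u: "u \<notin> verts G" and f: "f \<notin> arcs G" and e: "e \<in> arcs G"
    and verts': "verts G' = insert u (verts G)" and arcs': "arcs G' = insert f (arcs G)"
    and tail': "\<And>a. a \<in> arcs G \<Longrightarrow> tail G' a = tail G a" and tail_f: "tail G' f = u"
    and head': "\<And>a. a \<in> arcs G \<Longrightarrow> a \<noteq> e \<Longrightarrow> head G' a = head G a"
    and head_e: "head G' e = u" and head_f: "head G' f = head G e"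
begin

lemma wf': "wf_digraph G'"
proof
  fix a assume "a \<in> arcs G'"
  then show "tail G' a \<in> verts G'" by (auto simp: arcs' verts' tail' tail_f)
  from \<open>a \<in> arcs G'\<close> show "head G' a \<in> verts G'"
    using e by (cases "a = e"; cases "a = f") (auto simp: arcs' verts' head' head_f head_e)
qed

text \<open>Together with the deletion \<open>fl\<close> this translates walks between old vertices
  in both directions.\<close>

definition \<sigma> :: "'e list \<Rightarrow> 'e list" where
  "\<sigma> c = concat (map (\<lambda>a. if a = e then [e, f] else [a]) c)"

abbreviation fl :: "'e list \<Rightarrow> 'e list" where
  "fl \<equiv> filter (\<lambda>a. a \<noteq> f)"

lemma \<sigma>_simps [simp]: "\<sigma> [] = []" "\<sigma> (e # c) = e # f # \<sigma> c" "a \<noteq> e \<Longrightarrow> \<sigma> (a # c) = a # \<sigma> c"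
  by (simp_all add: \<sigma>_def)

lemma ef: "e \<noteq> f" using e f by auto

lemma verts_ne [simp]: "a \<in> arcs G \<Longrightarrow> tail G a \<noteq> u" "a \<in> arcs G \<Longrightarrow> head G a \<noteq> u"
  "a \<in> arcs G \<Longrightarrow> u \<noteq> tail G a" "a \<in> arcs G \<Longrightarrow> u \<noteq> head G a"
  using u by auto

lemma cas_\<sigma>:
  assumes "cas x c y" "set c \<subseteq> arcs G"
  shows "pre_digraph.cas G' x (\<sigma> c) y"
  using assms
proof (induction c arbitrary: x)
  case (Cons a c)
  then show ?case
    by (cases "a = e") (auto simp: pre_digraph.cas.simps tail' tail_f head' head_e head_f)
qed (simp add: pre_digraph.cas.simps)

text \<open>Only \<open>e\<close> enters \<open>u\<close> and only \<open>f\<close> leaves it. A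
  walk whose ends avoid \<open>u\<close> therefore contains the two edges only as consecutive pairs.
  Such a pair is consumed at once, hence the induction on the length.\<close>

lemma cas_fl:
  assumes "pre_digraph.cas G' x d y" "set d \<subseteq> arcs G'" "x \<noteq> u" "y \<noteq> u"
  shows "cas x (fl d) y \<and> \<sigma> (fl d) = d"
  using assms
proof (induction d arbitrary: x rule: length_induct)
  case (1 d)
  show ?case
  proof (cases d)
    case Nil
    then show ?thesis using 1 by (simp add: pre_digraph.cas.simps)
  next
    case (Cons a r)
    have a: "a \<in> arcs G" "a \<noteq> f" "tail G a = x" and r: "pre_digraph.cas G' (head G' a) r y" "set r \<subseteq> arcs G'"
      using 1(2-4) Cons f tail_f by (auto simp: pre_digraph.cas.simps arcs' tail')
    show ?thesis
    proof (cases "a = e")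
      case True
      have "r \<noteq> []" using r(1) 1(5) True head_e by (auto simp: pre_digraph.cas.simps)
      then obtain b r' where r': "r = b # r'" by (cases r) auto
      have "b = f" using r True by (auto simp: r' pre_digraph.cas.simps head_e arcs' tail' dest: verts_ne)
      then have "cas (head G e) (fl r') y \<and> \<sigma> (fl r') = r'"
        using 1(1) r 1(5) e by (auto simp: Cons r' pre_digraph.cas.simps head_f)
      then show ?thesis using True a \<open>b = f\<close> by (simp add: Cons r')
    next
      case False
      then have "cas (head G a) (fl r) y \<and> \<sigma> (fl r) = r"
        using 1(1) r 1(5) a by (auto simp: Cons head')
      then show ?thesis using False a by (simp add: Cons)
    qed
  qed
qed

lemma fl_\<sigma>: "f \<notin> set c \<Longrightarrow> fl (\<sigma> c) = c"
proof (induction c)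
  case (Cons a c)
  then show ?case using ef by (cases "a = e") auto
qed simp

lemma set_\<sigma>: "set (\<sigma> c) = set c \<union> (if e \<in> set c then {f} else {})"
  by (auto simp: \<sigma>_def)

lemma distinct_\<sigma>:
  assumes "distinct (map (tail G) c)" "set c \<subseteq> arcs G"
  shows "distinct (map (tail G') (\<sigma> c))"
  using assms
proof (induction c)
  case (Cons a c)
  have sub: "set c \<subseteq> arcs G" "a \<in> arcs G" "tail G a \<notin> tail G ` set c" using Cons.prems by auto
  have "tail G' ` set (\<sigma> c) = tail G ` set c \<union> (if e \<in> set c then {u} else {})"
    using sub by (auto simp: set_\<sigma> tail_f tail' image_iff subset_iff)
  then show ?case using Cons sub by (cases "a = e") (auto simp: tail' tail_f subset_iff)
qed simp

lemma cycle_\<sigma>: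
  assumes "cycle c"
  shows "pre_digraph.cycle G' (\<sigma> c)"
proof -
  obtain x where c: "c \<noteq> []" "set c \<subseteq> arcs G" "cas x c x" "distinct (map (tail G) c)"
    using assms by (auto simp: cycle_iff[OF wf_digraph])
  have "fl (\<sigma> c) = c" using c(2) f by (intro fl_\<sigma>) auto
  then have "\<sigma> c \<noteq> []" using c(1) by auto
  then show ?thesis
    using c cas_\<sigma>[OF c(3,2)] distinct_\<sigma>[OF c(4,2)]
    by (auto simp: cycle_iff[OF wf'] set_\<sigma> arcs' split: if_splits)
qed

text \<open>A cycle based at \<open>u\<close> has its pair of halves torn apart, one at each end.
  Another base point repairs this, and deleting \<open>f\<close> does not notice the change.\<close>

lemma cycle_normalize:
  assumes "pre_digraph.cycle G' d"
  obtains d0 where "d0 \<in> cycle_class d" "fl d0 = fl d" "\<sigma> (fl d0) = d0" "cycle (fl d)"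
proof -
  obtain x where d: "d \<noteq> []" "set d \<subseteq> arcs G'" "pre_digraph.cas G' x d x" "distinct (map (tail G') d)"
    using assms by (auto simp: cycle_iff[OF wf'])
  have ex: "\<exists>d0 y. d0 \<in> cycle_class d \<and> fl d0 = fl d \<and> pre_digraph.cas G' y d0 y \<and> y \<noteq> u"
  proof (cases "x = u")
    case False
    then show ?thesis using d(3) cycle_class_self by blast
  next
    case True
    \<comment> \<open>A cycle based at \<open>u\<close> starts with \<open>f\<close>. Moving this
      edge to the end bases the cycle at the range of \<open>f\<close>, an old vertex.\<close>
    obtain a r where ar: "d = a # r" using d(1) by (cases d) auto
    then have "tail G' a = u" "pre_digraph.cas G' (head G' a) r u" using d(3) True by (auto simp: pre_digraph.cas.simps)
    moreover from this have "a = f" using d(2) ar verts_ne(1)[of a] tail'[of a] by (auto simp: arcs')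
    ultimately have "pre_digraph.cas G' (head G e) (r @ [f]) (head G e)"
      by (auto simp: cas_append pre_digraph.cas.simps tail_f head_f)
    moreover have "r @ [f] \<in> cycle_class ([f] @ r)" unfolding cycle_class_append by blast
    ultimately show ?thesis using ar \<open>a = f\<close> e
      by (intro exI[of _ "r @ [f]"] exI[of _ "head G e"]) simp
  qed
  then obtain d0 y where d0: "d0 \<in> cycle_class d" "fl d0 = fl d" "pre_digraph.cas G' y d0 y" "y \<noteq> u" by blast
  have set: "set d0 \<subseteq> arcs G'" using d(2) cycle_class_set[OF d0(1)] by simp
  have fl: "cas y (fl d) y" "\<sigma> (fl d0) = d0" using cas_fl[OF d0(3) set d0(4,4)] d0(2) by auto
  have "d0 \<noteq> []" using cycle_class_set[OF d0(1)] d(1) by auto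
  then have "fl d \<noteq> []" using fl(2) d0(2) by auto
  moreover have arcs: "set (fl d) \<subseteq> arcs G" using d(2) by (auto simp: arcs')
  moreover have "distinct (map (tail G) (fl d))"
  proof -
    have "map (tail G) (fl d) = map (tail G') (fl d)" using arcs by (intro map_cong refl) (auto simp: tail')
    then show ?thesis by (simp only: distinct_map_filter[OF d(4)])
  qed
  ultimately have "cycle (fl d)" using fl(1) by (auto simp: cycle_iff[OF wf_digraph])
  then show ?thesis using that d0 fl by blast
qed

text \<open>The bijection is deletion of \<open>f\<close> on classes. It is injective because a
  normalized representative is recovered by \<sigma>. The condition at \<open>f\<close> is met in
  both applications, as \<open>u\<close> emits only \<open>f\<close> and receives only
  \<open>e\<close>.\<close>

lemma cycles_with_subdivision:
  assumes "P' f" and P: "\<And>a. a \<in> arcs G \<Longrightarrow> P' a \<longleftrightarrow> P a"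
  shows "\<exists>\<phi>. bij_betw \<phi> (cycles_with G' P') (cycles_with G P)"
proof (intro exI bij_betw_imageI)
  show "inj_on (image fl) (cycles_with G' P')"
  proof (rule inj_onI)
    fix X Y assume XY: "X \<in> cycles_with G' P'" "Y \<in> cycles_with G' P'" "fl ` X = fl ` Y"
    then obtain c d where c: "X = cycle_class c" "pre_digraph.cycle G' c" and d: "Y = cycle_class d" "pre_digraph.cycle G' d"
      by (auto simp: cycles_with_def)
    obtain c0 where c0: "c0 \<in> cycle_class c" "fl c0 = fl c" "\<sigma> (fl c0) = c0" using cycle_normalize[OF c(2)] .
    have "fl c \<in> fl ` Y" using XY(3) c cycle_class_self by blast
    then obtain d1 where d1: "d1 \<in> cycle_class d" "fl d1 = fl c" using d by force
    then obtain d0 where d0: "d0 \<in> cycle_class d1" "fl d0 = fl d1" "\<sigma> (fl d0) = d0"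
      using cycle_normalize[OF cycle_rotate[OF wf' d(2)]] by metis
    have "c0 = d0" using c0 d0 d1 by simp
    then show "X = Y" using c0(1) d0(1) d1(1) c d by (metis cycle_class_eq)
  qed
  show "image fl ` cycles_with G' P' = cycles_with G P"
  proof (intro equalityI subsetI)
    fix X assume "X \<in> image fl ` cycles_with G' P'"
    then obtain d where d: "X = cycle_class (fl d)" "pre_digraph.cycle G' d" "\<forall>a\<in>set d. P' a"
      by (auto simp: cycles_with_def filter_cycle_class)
    have "cycle (fl d)" using cycle_normalize[OF d(2)] .
    moreover have "\<forall>a\<in>set (fl d). P a" using d(3) P calculation by (auto simp: cycle_iff[OF wf_digraph])
    ultimately show "X \<in> cycles_with G P" using d by (auto simp: cycles_with_def)
  next
    fix X assume "X \<in> cycles_with G P"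
    then obtain c where c: "X = cycle_class c" "cycle c" "\<forall>a\<in>set c. P a" by (auto simp: cycles_with_def)
    have sub: "set c \<subseteq> arcs G" using c by (simp add: cycle_iff[OF wf_digraph])
    have "cycle_class (\<sigma> c) \<in> cycles_with G' P'"
      using c(3) sub P assms(1) by (intro cycles_withI cycle_\<sigma> c(2)) (auto simp: set_\<sigma> split: if_splits)
    moreover have "fl ` cycle_class (\<sigma> c) = X" using sub f c(1) by (subst filter_cycle_class, subst fl_\<sigma>) auto
    ultimately show "X \<in> image fl ` cycles_with G' P'" by blast
  qed
qed

lemma subdivision_cycles:
  shows "\<exists>\<phi>. bij_betw \<phi> (cycles_without_exits G') (cycles_without_exits G)"
    and "\<exists>\<phi>. bij_betw \<phi> (source_cycles G') (source_cycles G)"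
proof -
  show "\<exists>\<phi>. bij_betw \<phi> (cycles_without_exits G') (cycles_without_exits G)"
    unfolding cycles_without_exits_eq
    by (rule cycles_with_subdivision) (auto simp: arcs' tail_f tail' dest: verts_ne)
  have ne: "head G' a \<noteq> u" if "a \<in> arcs G" "a \<noteq> e" for a using that by (simp add: head')
  have hd: "head G' a = (if a = e then u else head G a)" if "a \<in> arcs G" for a
    using that by (simp add: head' head_e)
  from ne have in_u: "in_arcs G' u = {e}" using e by (auto simp: in_arcs_def arcs' head_e head_f)
  have "card (in_arcs G' v) = card (in_arcs G v)" if "v \<in> verts G" for v
  proof (cases "v = head G e")
    case True
    \<comment> \<open>At the range of \<open>e\<close> the edge \<open>f\<close> takes the place of
      \<open>e\<close>, so the number of incoming edges is unchanged.\<close>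
    have "in_arcs G' v = (\<lambda>a. if a = e then f else a) ` in_arcs G v"
      using e f ef True u by (auto simp: in_arcs_def arcs' head_f hd image_iff split: if_splits)
    moreover have "inj_on (\<lambda>a. if a = e then f else a) (in_arcs G v)" using f by (auto simp: inj_on_def)
    ultimately show ?thesis by (metis card_image)
  next
    case False
    have "in_arcs G' v = in_arcs G v"
      using e f ef False u that by (auto simp: in_arcs_def arcs' head_f hd split: if_splits)
    then show ?thesis by simp
  qed
  then show "\<exists>\<phi>. bij_betw \<phi> (source_cycles G') (source_cycles G)"
    unfolding source_cycles_eq[OF wf'] source_cycles_eq[OF wf_digraph]
    by (intro cycles_with_subdivision) (simp_all add: tail_f tail' in_u)
qed

end

subsection \<open>Source elimination as a chain of hereditary vertex sets\<close>

text \<open>Only sources of edges are tested; for hereditary \<open>H\<close> the ranges lie in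
  \<open>H\<close> as well.\<close>

definition restrict_graph :: "('v, 'e) pre_digraph \<Rightarrow> 'v set \<Rightarrow> ('v, 'e) pre_digraph" where
  "restrict_graph G H = \<lparr>verts = H, arcs = {a \<in> arcs G. tail G a \<in> H}, tail = tail G, head = head G\<rparr>"

lemma restrict_graph_simps [simp]:
  "verts (restrict_graph G H) = H" "arcs (restrict_graph G H) = {a \<in> arcs G. tail G a \<in> H}"
  "tail (restrict_graph G H) = tail G" "head (restrict_graph G H) = head G"
  by (simp_all add: restrict_graph_def)

definition hereditary :: "('v, 'e) pre_digraph \<Rightarrow> 'v set \<Rightarrow> bool" where
  "hereditary G H \<longleftrightarrow> H \<subseteq> verts G \<and> (\<forall>a\<in>arcs G. tail G a \<in> H \<longrightarrow> head G a \<in> H)"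

lemma wf_restrict: "hereditary G H \<Longrightarrow> wf_digraph (restrict_graph G H)"
  by unfold_locales (auto simp: hereditary_def)

lemma restrict_graph_verts: "wf_digraph G \<Longrightarrow> restrict_graph G (verts G) = G"
  by (auto simp: restrict_graph_def wf_digraph_def intro!: pre_digraph.equality)

lemma process_step:
  assumes "source_elimination_process E Es t" "i < t"
  shows "if trivial_graph (Es i) then Suc i = t \<and> Es (Suc i) = Es i
    else \<exists>v. is_source (Es i) v \<and> Es (Suc i) = eliminate_source (Es i) v"
  using assms unfolding source_elimination_process_def by blast

lemma restrict_source:
  assumes "is_source (restrict_graph E H) v"
  shows "v \<in> H" "\<And>a. a \<in> arcs E \<Longrightarrow> tail E a \<in> H \<Longrightarrow> head E a \<noteq> v"
    "eliminate_source (restrict_graph E H) v = restrict_graph E (H - {v})"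
proof -
  have v: "v \<in> H" "in_arcs (restrict_graph E H) v = {}" using assms by (auto simp: is_source_def)
  show "v \<in> H" by fact
  show "head E a \<noteq> v" if "a \<in> arcs E" "tail E a \<in> H" for a
  proof
    assume "head E a = v"
    then have "a \<in> in_arcs (restrict_graph E H) v" using that by simp
    then show False using v(2) by blast
  qed
  show "eliminate_source (restrict_graph E H) v = restrict_graph E (H - {v})"
    by (auto simp: eliminate_source_def restrict_graph_def out_arcs_def)
qed

text \<open>An edge into the vertex being eliminated starts at a vertex eliminated earlier. A walk
  ending there thus extends by one edge a walk that ends at an earlier vertex, and the length bound
  grows by one with each step.\<close>

lemma process_restrict:
  assumes wf: "wf_digraph E" and process: "source_elimination_process E Es t" and "i \<le> t"
  shows "\<exists>H. hereditary E H \<and> Es i = restrict_graph E H \<and>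
    (\<forall>x p y. pre_digraph.awalk E x p y \<longrightarrow> y \<notin> H \<longrightarrow> length p < i)"
  using \<open>i \<le> t\<close>
proof (induction i)
  case 0
  have "Es 0 = restrict_graph E (verts E)"
    using process wf by (simp add: source_elimination_process_def restrict_graph_verts)
  moreover have "hereditary E (verts E)" using wf by (auto simp: hereditary_def wf_digraph_def)
  ultimately show ?case using wf_digraph.awalk_last_in_verts[OF wf] by blast
next
  case (Suc i)
  then obtain H where her: "hereditary E H" and eq: "Es i = restrict_graph E H"
    and len: "\<And>x p y. pre_digraph.awalk E x p y \<Longrightarrow> y \<notin> H \<Longrightarrow> length p < i" by auto
  have i: "i < t" using Suc.prems by simp
  show ?case
  proof (cases "trivial_graph (Es i)")
    case True
    then have "Es (Suc i) = restrict_graph E H" using process_step[OF process i] eq by metis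
    moreover have "length p < Suc i" if "pre_digraph.awalk E x p y" "y \<notin> H" for x p y
      using len[OF that] by simp
    ultimately show ?thesis using her by blast
  next
    case False
    then obtain v where v: "is_source (restrict_graph E H) v" "Es (Suc i) = eliminate_source (restrict_graph E H) v"
      using process_step[OF process i] unfolding eq by auto
    have "hereditary E (H - {v})" using her restrict_source(2)[OF v(1)] by (auto simp: hereditary_def)
    moreover have "length p < Suc i" if p: "pre_digraph.awalk E x p y" "y \<notin> H - {v}" for x p y
    proof (cases "y \<in> H")
      case True
      then have "y = v" using p by simp
      show ?thesis
      proof (cases p rule: rev_cases)
        case (snoc q a)
        have "pre_digraph.awalk E x q (tail E a)" "a \<in> arcs E" "head E a = v"
          using p(1) \<open>y = v\<close> unfolding snoc wf_digraph.awalk_append_iff[OF wf]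
          by (auto simp: wf_digraph.awalk_simps[OF wf])
        then show ?thesis using restrict_source(2)[OF v(1), of a] len[of x q "tail E a"] snoc by auto
      qed simp
    next
      case False
      then show ?thesis using len[OF p(1)] by simp
    qed
    ultimately show ?thesis using v(2) restrict_source(3)[OF v(1)] by auto
  qed
qed

text \<open>Only the surviving vertices are recorded. That no eliminated vertex is a sink of
  \<open>E\<close> is the form in which the absence of isolated vertices enters.\<close>

inductive eliminates :: "('v, 'e) pre_digraph \<Rightarrow> 'v set \<Rightarrow> bool" for E where
  all: "eliminates E (verts E)"
| step: "eliminates E H \<Longrightarrow> u \<in> H \<Longrightarrow> (\<And>a. a \<in> arcs E \<Longrightarrow> tail E a \<in> H \<Longrightarrow> head E a \<noteq> u) \<Longrightarrow>
    out_arcs E u \<noteq> {} \<Longrightarrow> eliminates E (H - {u})"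

lemma eliminates_hereditary: "eliminates E H \<Longrightarrow> wf_digraph E \<Longrightarrow> hereditary E H"
  by (induction rule: eliminates.induct) (auto simp: hereditary_def wf_digraph_def)

lemma process_eliminates:
  assumes wf: "wf_digraph E" and ne: "verts E \<noteq> {}" and process: "source_elimination_process E Es t"
    and no_isolated: "\<And>i v. i \<le> t \<Longrightarrow> \<not> is_isolated (Es i) v" and "i \<le> t"
  shows "eliminates E (verts (Es i)) \<and> verts (Es i) \<noteq> {}"
  using \<open>i \<le> t\<close>
proof (induction i)
  case 0
  have "Es 0 = E" using process by (simp add: source_elimination_process_def)
  then show ?case using ne by (simp add: eliminates.all)
next
  case (Suc i)
  have i: "i < t" using Suc.prems by simp
  obtain H where her: "hereditary E H" and eq: "Es i = restrict_graph E H"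
    using process_restrict[OF wf process, of i] i by auto
  \<comment> \<open>The vertex of a trivial graph is isolated, so the stopping convention is never
    invoked here.\<close>
  have "\<not> trivial_graph (Es i)"
  proof
    assume "trivial_graph (Es i)"
    then obtain v where "is_isolated (Es i) v"
      by (auto simp: trivial_graph_def is_isolated_def is_source_def is_sink_def in_arcs_def out_arcs_def)
    then show False using no_isolated[of i v] i by simp
  qed
  then obtain v where v: "is_source (restrict_graph E H) v" "Es (Suc i) = restrict_graph E (H - {v})"
    using process_step[OF process i] restrict_source(3)[of E H] by (auto simp: eq)
  have "\<not> is_sink (restrict_graph E H) v" using no_isolated[of i v] i v(1) by (simp add: eq is_isolated_def)
  then have "out_arcs (restrict_graph E H) v \<noteq> {}" using restrict_source(1)[OF v(1)] by (simp add: is_sink_def)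
  then obtain a where "a \<in> out_arcs (restrict_graph E H) v" by blast
  then have a: "a \<in> arcs E" "tail E a = v" "v \<in> H" by auto
  \<comment> \<open>The range of an edge leaving the eliminated vertex survives, so the graph never
    becomes empty.\<close>
  have "head E a \<in> H - {v}" using a restrict_source(2)[OF v(1), of a] her by (auto simp: hereditary_def)
  moreover have "a \<in> out_arcs E v" using a by simp
  then have "out_arcs E v \<noteq> {}" by blast
  then have "eliminates E (H - {v})"
    using Suc.IH i a(3) restrict_source(2)[OF v(1)] by (intro eliminates.step) (auto simp: eq)
  ultimately show ?case using v(2) by auto
qed

lemma cas_cong:
  assumes "tail G = tail G'" "head G = head G'"
  shows "pre_digraph.cas G x c y = pre_digraph.cas G' x c y"
  by (induction c arbitrary: x) (simp_all add: pre_digraph.cas.simps assms)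

text \<open>Every vertex of a cycle is the range of one of its edges. While all vertices of the
  cycle are present, none of them can be a source.\<close>

lemma eliminates_cycle_tails:
  assumes "eliminates E H" "wf_digraph E" "pre_digraph.cycle E c"
  shows "tail E ` set c \<subseteq> H"
  using assms(1)
proof (induction rule: eliminates.induct)
  case all
  then show ?case using assms(2,3) by (auto simp: cycle_iff wf_digraph_def)
next
  case (step H u)
  have "u \<notin> head E ` set c"
  proof
    assume "u \<in> head E ` set c"
    then obtain a where "a \<in> set c" "head E a = u" by blast
    moreover have "a \<in> arcs E" using \<open>a \<in> set c\<close> assms(2,3) by (auto simp: cycle_iff)
    ultimately show False using step by blast
  qed
  then show ?case using step.IH cycle_heads[OF assms(2,3)] by auto
qed

text \<open>A surviving vertex keeps all edges that leave it, so the exits of a cycle in the core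
  are the same before and after elimination.\<close>

lemma eliminates_cycles_without_exits:
  assumes "eliminates E H" "wf_digraph E"
  shows "cycles_without_exits (restrict_graph E H) = cycles_without_exits E"
proof -
  let ?R = "restrict_graph E H"
  have wfR: "wf_digraph ?R" using assms by (intro wf_restrict eliminates_hereditary)
  have cyc: "pre_digraph.cycle ?R c \<longleftrightarrow> pre_digraph.cycle E c" for c
    using eliminates_cycle_tails[OF assms, of c]
    by (auto simp: cycle_iff[OF wfR] cycle_iff[OF assms(2)] cas_cong[of ?R E])
  have "has_exit ?R c \<longleftrightarrow> has_exit E c" if "pre_digraph.cycle E c" for c
    using eliminates_cycle_tails[OF assms that] by (fastforce simp: has_exit_def)
  then show ?thesis by (simp add: cycles_without_exits_def cyc cong: conj_cong)
qed

subsection \<open>Collapsing the edges between eliminated vertices\<close>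

text \<open>Modified graphs may differ elsewhere, and their end maps may differ off the edges, so
  equality of records is too strong. What must be preserved is the part of the graph leaving
  \<open>H\<close>.\<close>

definition agree_on :: "'v set \<Rightarrow> ('v, 'e) pre_digraph \<Rightarrow> ('v, 'e) pre_digraph \<Rightarrow> bool" where
  "agree_on H G G' \<longleftrightarrow> (\<forall>a. (a \<in> arcs G \<and> tail G a \<in> H \<longleftrightarrow> a \<in> arcs G' \<and> tail G' a \<in> H) \<and>
     (a \<in> arcs G \<and> tail G a \<in> H \<longrightarrow> tail G' a = tail G a \<and> head G' a = head G a))"

lemma agree_on_trans: "agree_on H G G' \<Longrightarrow> agree_on H G' G'' \<Longrightarrow> agree_on H G G''"
  unfolding agree_on_def by metis

lemma agree_on_subset: "agree_on H G G' \<Longrightarrow> H' \<subseteq> H \<Longrightarrow> agree_on H' G G'"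
  unfolding agree_on_def by (metis subsetD)

lemma agree_on_graph_iso: "agree_on H G G' \<Longrightarrow> graph_iso id id (restrict_graph G H) (restrict_graph G' H)"
  by (auto simp: agree_on_def graph_iso_def bij_betw_def)

lemma graph_iso_source_free:
  assumes "wf_digraph G" "graph_iso \<alpha> \<beta> G H" "source_free G"
  shows "source_free H"
  unfolding source_free_def is_source_def
proof (intro notI, elim exE conjE)
  fix v assume v: "v \<in> verts H" "in_arcs H v = {}"
  have "v \<in> \<alpha> ` verts G" using v(1) assms(2) by (simp add: graph_iso_def bij_betw_def)
  then obtain x where x: "x \<in> verts G" "v = \<alpha> x" by blast
  then have "in_arcs G x = {}" using v(2) graph_iso_in_arcs[OF assms(1,2) x(1)] by simp
  then show False using assms(3) x(1) by (auto simp: source_free_def is_source_def)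
qed

lemma algebra_isomorphic_refl: "algebra_isomorphic A A"
  unfolding algebra_isomorphic_def by (rule bexI[of _ id]) (simp_all add: ring_iso_set_refl)

text \<open>All vertices outside the core \<open>H\<close> are then sources, and each of them leads
  directly into the core.\<close>

definition star :: "('v, 'e) pre_digraph \<Rightarrow> 'v set \<Rightarrow> bool" where
  "star T H \<longleftrightarrow> fin_digraph T \<and> H \<subseteq> verts T \<and> (\<forall>a\<in>arcs T. head T a \<in> H) \<and>
     (\<forall>v\<in>verts T - H. out_arcs T v \<noteq> {})"

lemma star_hereditary: "star T H \<Longrightarrow> hereditary T H"
  by (auto simp: star_def hereditary_def)

text \<open>Edges leaving \<open>u\<close> end in \<open>H\<close>, so collapsing an edge into
  \<open>u\<close> creates only edges into \<open>H\<close>, and the number of edges into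
  \<open>u\<close> drops until \<open>u\<close> is a source.\<close>

lemma collapse_in_arcs:
  fixes T :: "('v, nat) pre_digraph"
  assumes "fin_digraph T" "H \<subseteq> verts T" "u \<in> verts T" "u \<notin> H"
    and "\<And>a. a \<in> arcs T \<Longrightarrow> head T a \<in> insert u H"
    and "\<And>a. a \<in> arcs T \<Longrightarrow> tail T a \<in> insert u H \<Longrightarrow> head T a \<in> H"
    and "\<And>v. v \<in> verts T - H \<Longrightarrow> out_arcs T v \<noteq> {}"
  shows "\<exists>T'::('v, nat) pre_digraph. star T' H \<and> agree_on H T T' \<and>
    algebra_isomorphic (leavitt_path_algebra TYPE('k::field) T) (leavitt_path_algebra TYPE('k) T')"
  using assms
proof (induction "card (in_arcs T u)" arbitrary: T rule: less_induct)
  case less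
  interpret fin_digraph T by fact
  have fin: "finite (in_arcs T u)" by (rule finite_subset[OF _ finite_arcs]) auto
  show ?case
  proof (cases "in_arcs T u = {}")
    case True
    then have "head T a \<in> H" if "a \<in> arcs T" for a
      using less.prems(5)[OF that] that by auto
    then have "star T H" using less.prems by (simp add: star_def)
    then show ?thesis
      by (intro exI[of _ T]) (simp add: algebra_isomorphic_refl agree_on_def)
  next
    case False
    then obtain e where "e \<in> in_arcs T u" by blast
    then have e: "e \<in> arcs T" "head T e = u" by simp_all
    obtain m where m: "\<And>a. a \<in> arcs T \<Longrightarrow> a < m"
      using finite_nat_set_iff_bounded[of "arcs T"] by auto
    \<comment> \<open>Shifting by a bound for all edge names in use makes the labels distinct and
      fresh.\<close>
    define lab where "lab = (\<lambda>a. m + a)"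
    \<comment> \<open>Neither the core nor \<open>u\<close> emits an edge into \<open>u\<close>.
      Hence \<open>e\<close> is not a loop, and the core is untouched by the collapse.\<close>
    have te: "tail T e \<notin> insert u H" using less.prems(6)[OF e(1)] e(2) less.prems(4) by auto
    interpret col: edge_collapse T "TYPE('k)" e lab
    proof
      show "tail T e \<noteq> head T e" using te e(2) by auto
      show "out_arcs T (head T e) \<noteq> {}" using less.prems e(2) by blast
      show "inj_on lab (out_arcs T (head T e))" by (auto simp: lab_def inj_on_def)
      show "lab ` out_arcs T (head T e) \<inter> (arcs T - {e}) = {}"
        using m by (force simp: lab_def)
    qed (use e in auto)
    have D: "head T a \<in> H" if "a \<in> out_arcs T u" for a using that less.prems(6)[of a] by auto
    have old: "a \<in> arcs T \<and> a \<noteq> e \<and> tail T a = tail col.C a \<and> head col.C a = head T a"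
      if "a \<in> arcs col.C" "tail col.C a \<in> insert u H" for a
      using that(1)
    proof (cases rule: col.arcs_C_cases)
      case (new b)
      then show ?thesis using that(2) te by simp
    qed simp
    have heads: "head col.C a \<in> insert u H \<and> (head col.C a = u \<longrightarrow> a \<in> in_arcs T u - {e})"
      if "a \<in> arcs col.C" for a
      using that
    proof (cases rule: col.arcs_C_cases)
      case old
      then show ?thesis using less.prems(5)[of a] by auto
    next
      case (new b)
      then have "head col.C a \<in> H" using D[of b] e(2) by simp
      then show ?thesis using less.prems(4) by auto
    qed
    have "in_arcs col.C u \<subseteq> in_arcs T u - {e}"
    proof
      fix a assume "a \<in> in_arcs col.C u"
      then have "a \<in> arcs col.C" "head col.C a = u" by simp_all
      then show "a \<in> in_arcs T u - {e}" using heads[of a] by blast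
    qed
    then have "card (in_arcs col.C u) \<le> card (in_arcs T u - {e})" using fin by (intro card_mono) auto
    also have "\<dots> < card (in_arcs T u)" using fin e by (intro card_Diff1_less) auto
    finally have "card (in_arcs col.C u) < card (in_arcs T u)" .
    moreover have "out_arcs col.C v \<noteq> {}" if "v \<in> verts col.C - H" for v
    proof (cases "v = tail T e")
      case True
      then show ?thesis using col.nonsink by (simp add: col.out_arcs_tail)
    next
      case False
      then show ?thesis using less.prems(7)[of v] that by (simp add: col.out_arcs_other)
    qed
    moreover have "head col.C a \<in> H" if "a \<in> arcs col.C" "tail col.C a \<in> insert u H" for a
      using old[OF that] less.prems(6)[of a] that(2) by metis
    moreover have "head col.C a \<in> insert u H" if "a \<in> arcs col.C" for a
      using heads[OF that] by simp
    ultimately have "\<exists>T'. star T' H \<and> agree_on H col.C T' \<and>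
        algebra_isomorphic (leavitt_path_algebra TYPE('k) col.C) (leavitt_path_algebra TYPE('k) T')"
      using less.prems(2-4) by (intro less.hyps col.fin_digraph_collapse) simp_all
    then obtain T' where T': "star T' H" "agree_on H col.C T'"
        "algebra_isomorphic (leavitt_path_algebra TYPE('k) col.C) (leavitt_path_algebra TYPE('k) T')" by blast
    have "agree_on H T col.C"
      unfolding agree_on_def
    proof (intro allI conjI iffI impI)
      fix a assume a: "a \<in> arcs T \<and> tail T a \<in> H"
      then have "a \<noteq> e" using te by auto
      then show "a \<in> arcs col.C" "tail col.C a \<in> H" "tail col.C a = tail T a" "head col.C a = head T a"
        using a by simp_all
    next
      fix a assume "a \<in> arcs col.C \<and> tail col.C a \<in> H"
      then show "a \<in> arcs T" "tail T a \<in> H" using old[of a] by (metis insertCI)+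
    qed
    then show ?thesis
      using T' agree_on_trans algebra_isomorphic_trans[OF col.collapse_isomorphic] by blast
  qed
qed

text \<open>Vertices leave the core in the order of elimination. When \<open>u\<close> leaves, no
  core edge enters it, so only edges from vertices eliminated earlier have to be collapsed.\<close>

lemma eliminates_star:
  fixes E :: "('v, nat) pre_digraph"
  assumes "eliminates E H" "fin_digraph E"
  shows "\<exists>T::('v, nat) pre_digraph. star T H \<and> agree_on H E T \<and>
    algebra_isomorphic (leavitt_path_algebra TYPE('k::field) E) (leavitt_path_algebra TYPE('k) T)"
  using assms(1)
proof (induction rule: eliminates.induct)
  case all
  have "star E (verts E)" using assms(2) by (simp add: star_def fin_digraph_def wf_digraph_def)
  then show ?case by (intro exI[of _ E]) (simp add: algebra_isomorphic_refl agree_on_def)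
next
  case (step H u)
  then obtain T :: "('v, nat) pre_digraph" where T: "star T H" "agree_on H E T"
    "algebra_isomorphic (leavitt_path_algebra TYPE('k) E) (leavitt_path_algebra TYPE('k) T)" by blast
  have core: "a \<in> arcs E \<and> tail E a = tail T a \<and> head E a = head T a"
    if "a \<in> arcs T" "tail T a \<in> H" for a using T(2) that unfolding agree_on_def by metis
  obtain b where "b \<in> out_arcs E u" using step.hyps(4) by blast
  then have "b \<in> arcs E" "tail E b = u" by simp_all
  then have b: "b \<in> arcs T" "tail T b = u" using T(2) step.hyps(2) unfolding agree_on_def by metis+
  have Hu: "insert u (H - {u}) = H" using step.hyps by auto
  have "\<exists>T'::('v, nat) pre_digraph. star T' (H - {u}) \<and> agree_on (H - {u}) T T' \<and>
    algebra_isomorphic (leavitt_path_algebra TYPE('k) T) (leavitt_path_algebra TYPE('k) T')"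
  proof (rule collapse_in_arcs[of T "H - {u}" u], unfold Hu)
    show "head T a \<in> H - {u}" if "a \<in> arcs T" "tail T a \<in> H" for a
      using core[OF that] step.hyps(3)[of a] T(1) that by (auto simp: star_def)
    show "out_arcs T v \<noteq> {}" if "v \<in> verts T - (H - {u})" for v
      using that T(1) b by (cases "v = u") (auto simp: star_def)
  qed (use T(1) step.hyps(2) in \<open>auto simp: star_def\<close>)
  then show ?case
    using T agree_on_trans[OF agree_on_subset[OF T(2), of "H - {u}"]] algebra_isomorphic_trans[OF T(3)] by blast
qed

subsection \<open>Absorbing the remaining sources\<close>

text \<open>The measure for absorbing all sources: absorption moves an edge into the core and
  splitting preserves these edges, whereas splitting increases the number of vertices
  outside.\<close>

definition outer_arcs :: "('v, 'e) pre_digraph \<Rightarrow> 'v set \<Rightarrow> 'e set" where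
  "outer_arcs T H = {a \<in> arcs T. tail T a \<notin> H}"

text \<open>As \<open>u\<close> emits only \<open>f\<close>, collapsing the redirected edge replaces
  it by a single edge to the range of \<open>f\<close>, which may carry the name \<open>e\<close>
  again. The result is literally \<open>T\<close>, which explains the constant labelling.\<close>

lemma star_absorb:
  assumes star: "star T H" and sf: "source_free (restrict_graph T H)"
    and u: "u \<in> verts T" "u \<notin> H" "out_arcs T u = {f}"
  shows "\<exists>T'. star T' (insert u H) \<and> source_free (restrict_graph T' (insert u H)) \<and>
    outer_arcs T' (insert u H) \<subset> outer_arcs T H \<and>
    algebra_isomorphic (leavitt_path_algebra TYPE('k::field) T) (leavitt_path_algebra TYPE('k) T') \<and>
    (\<exists>\<phi>. bij_betw \<phi> (cycles_without_exits (restrict_graph T' (insert u H))) (cycles_without_exits (restrict_graph T H))) \<and>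
    (\<exists>\<phi>. bij_betw \<phi> (source_cycles (restrict_graph T' (insert u H))) (source_cycles (restrict_graph T H)))"
proof -
  have fin: "fin_digraph T" using star by (simp add: star_def)
  interpret fin_digraph T by fact
  have f: "f \<in> arcs T" "tail T f = u" using u(3) by auto
  have fu: "a = f" if "a \<in> arcs T" "tail T a = u" for a
  proof -
    have "a \<in> out_arcs T u" using that by simp
    then show ?thesis using u(3) by simp
  qed
  have head_H: "head T a \<in> H" if "a \<in> arcs T" for a using star that by (simp add: star_def)
  have inn: "\<exists>a\<in>arcs T. tail T a \<in> H \<and> head T a = h" if "h \<in> H" for h
    using sf that by (fastforce simp: source_free_def is_source_def)
  \<comment> \<open>The core is source-free and contains the range of \<open>f\<close>, so this
    vertex also receives an edge of the core.\<close>
  obtain e where e: "e \<in> arcs T" "tail T e \<in> H" "head T e = head T f" using inn[OF head_H[OF f(1)]] by blast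
  have ef: "e \<noteq> f" using e f u by auto
  define T' where "T' = T\<lparr>head := (head T)(e := u)\<rparr>"
  have T'_simps [simp]: "verts T' = verts T" "arcs T' = arcs T" "tail T' = tail T" "head T' e = u"
    "\<And>a. a \<noteq> e \<Longrightarrow> head T' a = head T a" by (simp_all add: T'_def)
  have out: "out_arcs T' v = out_arcs T v" for v by (simp add: out_arcs_def)
  have fin': "fin_digraph T'"
  proof
    fix a assume "a \<in> arcs T'"
    then show "head T' a \<in> verts T'" using u(1) by (cases "a = e") auto
  qed auto
  \<comment> \<open>collapsing \<open>e\<close> in \<open>T'\<close> gives back \<open>T\<close>\<close>
  interpret col: edge_collapse T' "TYPE('k)" e "\<lambda>_. e"
    by (intro edge_collapse.intro edge_collapse_axioms.intro fin') (use e u in \<open>auto simp: out\<close>)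
  have "inv_into {f} (\<lambda>_. e) e = f" using inv_into_into[of e "\<lambda>_. e" "{f}"] by auto
  moreover have "out_arcs T' (head T' e) = {f}" by (simp add: out u(3))
  ultimately have "col.C = T"
    unfolding collapse_def Let_def
    using e ef by (intro pre_digraph.equality) (auto simp: fun_eq_iff)
  then have iso: "algebra_isomorphic (leavitt_path_algebra TYPE('k) T) (leavitt_path_algebra TYPE('k) T')"
    using leavitt_isomorphic_sym[OF fin' col.collapse_isomorphic] by simp
  have star': "star T' (insert u H)"
    unfolding star_def
  proof (intro conjI ballI fin')
    fix a assume "a \<in> arcs T'"
    then show "head T' a \<in> insert u H" using head_H by (cases "a = e") auto
  qed (use star u in \<open>auto simp: star_def out\<close>)
  have sf': "source_free (restrict_graph T' (insert u H))"
    unfolding source_free_def is_source_def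
  proof (intro notI, elim exE conjE)
    fix h assume h: "h \<in> verts (restrict_graph T' (insert u H))" "in_arcs (restrict_graph T' (insert u H)) h = {}"
    have no: "head T' a \<noteq> h" if "a \<in> arcs T" "tail T a \<in> insert u H" for a
    proof
      assume "head T' a = h"
      then have "a \<in> in_arcs (restrict_graph T' (insert u H)) h" using that by simp
      then show False using h(2) by blast
    qed
    \<comment> \<open>The absorbed vertex now receives \<open>e\<close>; the range of
      \<open>f\<close>, which has lost \<open>e\<close>, receives \<open>f\<close> as a core edge;
      every other vertex keeps its incoming core edges.\<close>
    consider "h = u" | "h = head T f" | "h \<in> H" "h \<noteq> head T f" using h(1) by auto
    then show False
    proof cases
      case 1
      then show ?thesis using no[of e] e by simp
    next
      case 2
      then show ?thesis using no[of f] f ef by simp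
    next
      case 3
      then obtain a where a: "a \<in> arcs T" "tail T a \<in> H" "head T a = h" using inn by blast
      then have "a \<noteq> e" using e(3) 3 by blast
      then show ?thesis using no[of a] a by simp
    qed
  qed
  have outer: "outer_arcs T' (insert u H) \<subset> outer_arcs T H"
  proof
    show "outer_arcs T' (insert u H) \<subseteq> outer_arcs T H" by (auto simp: outer_arcs_def)
    have "f \<in> outer_arcs T H" "f \<notin> outer_arcs T' (insert u H)" using f u by (auto simp: outer_arcs_def)
    then show "outer_arcs T' (insert u H) \<noteq> outer_arcs T H" by auto
  qed
  let ?R = "restrict_graph T H" and ?R' = "restrict_graph T' (insert u H)"
  have "edge_subdivision_axioms ?R ?R' e f u"
  proof (rule edge_subdivision_axioms.intro)
    show "arcs ?R' = insert f (arcs ?R)" by (auto simp: f dest: fu)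
    show "u \<notin> verts ?R" "f \<notin> arcs ?R" "tail ?R' f = u" "verts ?R' = insert u (verts ?R)"
      using u(2) f by simp_all
    show "e \<in> arcs ?R" "head ?R' e = u" using e by simp_all
    show "head ?R' f = head ?R e" using e ef by simp
  qed simp_all
  then interpret sub: edge_subdivision ?R ?R' e f u
    by (intro edge_subdivision.intro wf_restrict star_hereditary star)
  show ?thesis
    by (rule exI[of _ T']) (intro conjI star' sf' outer iso sub.subdivision_cycles)
qed

lemma star_split:
  fixes T :: "(nat, 'e) pre_digraph"
  assumes star: "star T H" and u: "u \<in> verts T" "u \<notin> H" and f: "f \<in> out_arcs T u" "out_arcs T u \<noteq> {f}"
  shows "\<exists>T' w. star T' H \<and> w \<in> verts T' \<and> w \<notin> H \<and> out_arcs T' w = {f} \<and> agree_on H T T' \<and>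
    outer_arcs T' H = outer_arcs T H \<and>
    algebra_isomorphic (leavitt_path_algebra TYPE('k::field) T) (leavitt_path_algebra TYPE('k) T')"
proof -
  have fin: "fin_digraph T" using star by (simp add: star_def)
  interpret fin_digraph T by fact
  have fa: "f \<in> arcs T" "tail T f = u" using f by auto
  obtain w where w: "w \<notin> verts T" using ex_new_if_finite[OF infinite_UNIV_nat finite_verts] by blast
  have wH: "w \<notin> H" using w star by (auto simp: star_def)
  have "in_arcs T u = {}" using star u(2) by (auto simp: star_def)
  then interpret spl: source_split T "TYPE('k)" f w
    by (intro source_split.intro source_split_axioms.intro fin) (use fa f w in simp_all)
  have tl: "tail spl.S a \<in> H \<longleftrightarrow> tail T a \<in> H" "tail T a \<in> H \<Longrightarrow> tail spl.S a = tail T a" for a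
    using fa u wH by (cases "a = f"; simp)+
  have "star spl.S H"
    unfolding star_def
  proof (intro conjI ballI spl.fin_digraph_split)
    fix v assume v: "v \<in> verts spl.S - H"
    consider "v = w" | "v = u" | "v \<noteq> w" "v \<noteq> u" by blast
    then show "out_arcs spl.S v \<noteq> {}"
    proof cases
      case 2
      then show ?thesis using spl.regular_S(2) fa by (simp add: is_regular_def)
    next
      case 3
      then show ?thesis using v star fa by (simp add: spl.out_arcs_S star_def)
    qed (simp add: spl.out_arcs_S)
  qed (use star in \<open>auto simp: star_def\<close>)
  moreover have "agree_on H T spl.S" by (auto simp: agree_on_def tl)
  moreover have "outer_arcs spl.S H = outer_arcs T H" by (simp add: outer_arcs_def tl)
  ultimately show ?thesis
    using spl.split_isomorphic spl.out_arcs_S(1) wH by (intro exI[of _ spl.S] exI[of _ w]) simp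
qed

lemma bij_betw_ex_refl: "\<exists>\<phi>. bij_betw \<phi> A A"
  by (rule exI[of _ id]) simp

lemma bij_betw_ex_trans:
  "\<exists>\<phi>. bij_betw \<phi> A B \<Longrightarrow> \<exists>\<phi>. bij_betw \<phi> B C \<Longrightarrow> \<exists>\<phi>. bij_betw \<phi> A C"
  by (blast intro: bij_betw_trans)

lemma bij_betw_ex_sym: "\<exists>\<phi>. bij_betw \<phi> A B \<Longrightarrow> \<exists>\<phi>. bij_betw \<phi> B A"
  by (blast intro: bij_betw_inv_into)

text \<open>In each round a source outside the core is split, if necessary, until some source emits
  a single edge, and that source is absorbed.\<close>

lemma star_source_free:
  fixes T :: "(nat, 'e) pre_digraph"
  assumes "star T H" "source_free (restrict_graph T H)"
  shows "\<exists>F::(nat, 'e) pre_digraph. fin_digraph F \<and> H \<subseteq> verts F \<and> source_free F \<and>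
    algebra_isomorphic (leavitt_path_algebra TYPE('k::field) T) (leavitt_path_algebra TYPE('k) F) \<and>
    (\<exists>\<phi>. bij_betw \<phi> (cycles_without_exits F) (cycles_without_exits (restrict_graph T H))) \<and>
    (\<exists>\<phi>. bij_betw \<phi> (source_cycles F) (source_cycles (restrict_graph T H)))"
  using assms
proof (induction "card (outer_arcs T H)" arbitrary: T H rule: less_induct)
  case less
  have fin: "fin_digraph T" using less.prems by (simp add: star_def)
  then interpret fin_digraph T .
  show ?case
  proof (cases "verts T \<subseteq> H")
    case True
    then have "H = verts T" using less.prems by (auto simp: star_def)
    then have "restrict_graph T H = T" using restrict_graph_verts[OF wf_digraph] by simp
    then show ?thesis
      using less.prems fin by (intro exI[of _ T]) (simp add: star_def algebra_isomorphic_refl bij_betw_ex_refl)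
  next
    case False
    then obtain u where u: "u \<in> verts T" "u \<notin> H" by blast
    then have "out_arcs T u \<noteq> {}" using less.prems(1) unfolding star_def by blast
    then obtain f where f: "f \<in> out_arcs T u" by blast
    have "\<exists>S w. star S H \<and> w \<in> verts S \<and> w \<notin> H \<and> out_arcs S w = {f} \<and> agree_on H T S \<and>
      outer_arcs S H = outer_arcs T H \<and>
      algebra_isomorphic (leavitt_path_algebra TYPE('k) T) (leavitt_path_algebra TYPE('k) S)"
    proof (cases "out_arcs T u = {f}")
      case True
      then show ?thesis using less.prems(1) u
        by (intro exI[of _ T] exI[of _ u]) (simp add: agree_on_def algebra_isomorphic_refl)
    next
      case False
      then show ?thesis by (rule star_split[OF less.prems(1) u f])
    qed
    then obtain S w where S: "star S H" "w \<in> verts S" "w \<notin> H" "out_arcs S w = {f}" "agree_on H T S"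
      "outer_arcs S H = outer_arcs T H"
      "algebra_isomorphic (leavitt_path_algebra TYPE('k) T) (leavitt_path_algebra TYPE('k) S)" by blast
    have wf: "wf_digraph (restrict_graph T H)" "wf_digraph (restrict_graph S H)"
      using less.prems(1) S(1) by (auto intro!: wf_restrict star_hereditary)
    note iso = agree_on_graph_iso[OF S(5)]
    have "source_free (restrict_graph S H)" by (rule graph_iso_source_free[OF wf(1) iso less.prems(2)])
    from star_absorb[OF S(1) this S(2,3,4), where 'k='k] obtain T' where T': "star T' (insert w H)"
      "source_free (restrict_graph T' (insert w H))" "outer_arcs T' (insert w H) \<subset> outer_arcs S H"
      "algebra_isomorphic (leavitt_path_algebra TYPE('k) S) (leavitt_path_algebra TYPE('k) T')"
      "\<exists>\<phi>. bij_betw \<phi> (cycles_without_exits (restrict_graph T' (insert w H))) (cycles_without_exits (restrict_graph S H))"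
      "\<exists>\<phi>. bij_betw \<phi> (source_cycles (restrict_graph T' (insert w H))) (source_cycles (restrict_graph S H))" by metis
    have "finite (outer_arcs T H)" by (rule finite_subset[OF _ finite_arcs]) (auto simp: outer_arcs_def)
    then have "card (outer_arcs T' (insert w H)) < card (outer_arcs T H)"
      using T'(3) S(6) by (intro psubset_card_mono) simp_all
    from less.hyps[OF this T'(1,2)] obtain F :: "(nat, 'e) pre_digraph" where F: "fin_digraph F" "insert w H \<subseteq> verts F" "source_free F"
      "algebra_isomorphic (leavitt_path_algebra TYPE('k) T') (leavitt_path_algebra TYPE('k) F)"
      "\<exists>\<phi>. bij_betw \<phi> (cycles_without_exits F) (cycles_without_exits (restrict_graph T' (insert w H)))"
      "\<exists>\<phi>. bij_betw \<phi> (source_cycles F) (source_cycles (restrict_graph T' (insert w H)))" by blast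
    note cyc = graph_iso_cycles[OF wf iso]
    show ?thesis
    proof (intro exI[of _ F] conjI F(1,3))
      show "H \<subseteq> verts F" using F(2) by simp
      show "algebra_isomorphic (leavitt_path_algebra TYPE('k) T) (leavitt_path_algebra TYPE('k) F)"
        by (rule algebra_isomorphic_trans[OF S(7) algebra_isomorphic_trans[OF T'(4) F(4)]])
      show "\<exists>\<phi>. bij_betw \<phi> (cycles_without_exits F) (cycles_without_exits (restrict_graph T H))"
        by (rule bij_betw_ex_trans[OF F(5) bij_betw_ex_trans[OF T'(5) bij_betw_ex_sym[OF cyc(1)]]])
      show "\<exists>\<phi>. bij_betw \<phi> (source_cycles F) (source_cycles (restrict_graph T H))"
        by (rule bij_betw_ex_trans[OF F(6) bij_betw_ex_trans[OF T'(6) bij_betw_ex_sym[OF cyc(2)]]])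
    qed
  qed
qed

section \<open>Transport to natural number labels and the source-free model\<close>

lemma eliminates_graph_iso:
  assumes "eliminates E H" "wf_digraph E" "graph_iso \<alpha> \<beta> E F"
  shows "eliminates F (\<alpha> ` H)" "graph_iso \<alpha> \<beta> (restrict_graph E H) (restrict_graph F (\<alpha> ` H))"
proof -
  interpret wf_digraph E by fact
  have \<alpha>: "inj_on \<alpha> (verts E)" "\<alpha> ` verts E = verts F" and \<beta>: "inj_on \<beta> (arcs E)" "arcs F = \<beta> ` arcs E"
    and t: "\<And>e. e \<in> arcs E \<Longrightarrow> tail F (\<beta> e) = \<alpha> (tail E e)" "\<And>e. e \<in> arcs E \<Longrightarrow> head F (\<beta> e) = \<alpha> (head E e)"
    using assms(3) by (auto simp: graph_iso_def bij_betw_def)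
  have sub: "H \<subseteq> verts E" if "eliminates E H" for H
    using eliminates_hereditary[OF that assms(2)] by (simp add: hereditary_def)
  have mem: "\<alpha> x \<in> \<alpha> ` H \<longleftrightarrow> x \<in> H" if "x \<in> verts E" "H \<subseteq> verts E" for x H
    using inj_on_image_mem_iff[OF \<alpha>(1) that] .
  show "eliminates F (\<alpha> ` H)"
    using assms(1)
  proof (induction rule: eliminates.induct)
    case all
    then show ?case using eliminates.all[of F] \<alpha>(2) by simp
  next
    case (step H u)
    have H: "H \<subseteq> verts E" "u \<in> verts E" using sub[OF step.hyps(1)] step.hyps(2) by auto
    have "\<alpha> ` (H - {u}) = \<alpha> ` H - {\<alpha> u}"
      using H inj_on_image_set_diff[OF \<alpha>(1), of H "{u}"] by auto
    moreover have "eliminates F (\<alpha> ` H - {\<alpha> u})"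
    proof (rule eliminates.step[OF step.IH])
      show "out_arcs F (\<alpha> u) \<noteq> {}"
        using step.hyps(4) graph_iso_out_arcs[OF assms(2,3) H(2)] by simp
      fix a assume a: "a \<in> arcs F" "tail F a \<in> \<alpha> ` H"
      then obtain b where b: "b \<in> arcs E" "a = \<beta> b" using \<beta>(2) by blast
      then have "tail E b \<in> H" using a(2) mem[of "tail E b" H] H(1) by (simp add: t)
      then show "head F a \<noteq> \<alpha> u" using step.hyps(3)[of b] b inj_on_eq_iff[OF \<alpha>(1), of "head E b" u] H(2) by (simp add: t)
    qed (use step.hyps(2) in simp)
    ultimately show ?case by simp
  qed
  have H: "H \<subseteq> verts E" by (rule sub[OF assms(1)])
  have "bij_betw \<alpha> H (\<alpha> ` H)" using inj_on_subset[OF \<alpha>(1) H] by (simp add: bij_betw_def)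
  moreover have "\<beta> ` {a \<in> arcs E. tail E a \<in> H} = {a \<in> arcs F. tail F a \<in> \<alpha> ` H}"
  proof -
    have "tail F (\<beta> a) \<in> \<alpha> ` H \<longleftrightarrow> tail E a \<in> H" if "a \<in> arcs E" for a
      using mem[OF tail_in_verts[OF that] H] that by (simp add: t)
    then show ?thesis unfolding \<beta>(2) by blast
  qed
  ultimately show "graph_iso \<alpha> \<beta> (restrict_graph E H) (restrict_graph F (\<alpha> ` H))"
    using inj_on_subset[OF \<beta>(1), of "{a \<in> arcs E. tail E a \<in> H}"]
    by (auto simp: graph_iso_def bij_betw_def t)
qed

text \<open>The given types may be finite and have no room for the new vertices and edges; natural
  numbers supply fresh names at every step.\<close>

lemma relabel_nat:
  assumes "fin_digraph E"
  shows "\<exists>(F::(nat, nat) pre_digraph) \<alpha> \<beta>. fin_digraph F \<and> graph_iso \<alpha> \<beta> E F"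
proof -
  interpret fin_digraph E by fact
  obtain \<alpha> :: "'a \<Rightarrow> nat" where \<alpha>: "inj_on \<alpha> (verts E)" using finite_imp_inj_to_nat_seg[OF finite_verts] by blast
  obtain \<beta> :: "'b \<Rightarrow> nat" where \<beta>: "inj_on \<beta> (arcs E)" using finite_imp_inj_to_nat_seg[OF finite_arcs] by blast
  define F where "F = \<lparr>verts = \<alpha> ` verts E, arcs = \<beta> ` arcs E,
    tail = \<alpha> \<circ> tail E \<circ> inv_into (arcs E) \<beta>, head = \<alpha> \<circ> head E \<circ> inv_into (arcs E) \<beta>\<rparr>"
  have "fin_digraph F" by unfold_locales (auto simp: F_def \<beta>)
  moreover have "graph_iso \<alpha> \<beta> E F" using \<alpha> \<beta> by (simp add: F_def graph_iso_def bij_betw_def)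
  ultimately show ?thesis by blast
qed

text \<open>Being without exits concerns outgoing edges, which the core retains, so these cycles are
  compared with those of \<open>E\<close>. Source cycles depend on incoming edges, some of which
  elimination removes, so they are compared with those of the core.\<close>

theorem eliminates_source_free_model:
  fixes E :: "('v, 'e) pre_digraph"
  assumes fin: "fin_digraph E" and elim: "eliminates E H" and ne: "H \<noteq> {}"
    and sf: "source_free (restrict_graph E H)"
  shows "\<exists>F::(nat, nat) pre_digraph. fin_digraph F \<and> verts F \<noteq> {} \<and> source_free F \<and>
    algebra_isomorphic (leavitt_path_algebra TYPE('k::field) E) (leavitt_path_algebra TYPE('k) F) \<and>
    (\<exists>\<phi>. bij_betw \<phi> (cycles_without_exits F) (cycles_without_exits E)) \<and>
    (\<exists>\<psi>. bij_betw \<psi> (source_cycles F) (source_cycles (restrict_graph E H)))"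
proof -
  have wf: "wf_digraph E" using fin by (rule wf_digraph_fin)
  obtain D :: "(nat, nat) pre_digraph" and \<alpha> \<beta> where D: "fin_digraph D" "graph_iso \<alpha> \<beta> E D"
    using relabel_nat[OF fin] by blast
  let ?H = "\<alpha> ` H"
  have wfD: "wf_digraph D" using D(1) by (rule wf_digraph_fin)
  note el = eliminates_graph_iso[OF elim wf D(2)]
  obtain T :: "(nat, nat) pre_digraph" where T: "star T ?H" "agree_on ?H D T"
    "algebra_isomorphic (leavitt_path_algebra TYPE('k) D) (leavitt_path_algebra TYPE('k) T)"
    using eliminates_star[OF el(1) D(1)] by blast
  have wfs: "wf_digraph (restrict_graph E H)" "wf_digraph (restrict_graph D ?H)" "wf_digraph (restrict_graph T ?H)"
    using wf_restrict[OF eliminates_hereditary[OF elim wf]] wf_restrict[OF eliminates_hereditary[OF el(1) wfD]]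
      wf_restrict[OF star_hereditary[OF T(1)]] by simp_all
  note iso = agree_on_graph_iso[OF T(2)]
  have "source_free (restrict_graph T ?H)"
    by (rule graph_iso_source_free[OF wfs(2) iso graph_iso_source_free[OF wfs(1) el(2) sf]])
  from star_source_free[OF T(1) this, where 'k='k] obtain F :: "(nat, nat) pre_digraph" where F:
    "fin_digraph F" "?H \<subseteq> verts F" "source_free F"
    "algebra_isomorphic (leavitt_path_algebra TYPE('k) T) (leavitt_path_algebra TYPE('k) F)"
    "\<exists>\<phi>. bij_betw \<phi> (cycles_without_exits F) (cycles_without_exits (restrict_graph T ?H))"
    "\<exists>\<phi>. bij_betw \<phi> (source_cycles F) (source_cycles (restrict_graph T ?H))" by blast
  note back1 = graph_iso_cycles[OF wfs(2,3) iso, THEN bij_betw_ex_sym]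
  note back2 = graph_iso_cycles[OF wfs(1,2) el(2), THEN bij_betw_ex_sym]
  show ?thesis
  proof (intro exI[of _ F] conjI F(1,3))
    show "verts F \<noteq> {}" using F(2) ne by auto
    show "algebra_isomorphic (leavitt_path_algebra TYPE('k) E) (leavitt_path_algebra TYPE('k) F)"
      by (rule algebra_isomorphic_trans[OF graph_iso_isomorphic[OF wf wfD D(2)] algebra_isomorphic_trans[OF T(3) F(4)]])
    show "\<exists>\<phi>. bij_betw \<phi> (cycles_without_exits F) (cycles_without_exits E)"
      using bij_betw_ex_trans[OF F(5) bij_betw_ex_trans[OF back1(1) back2(1)]]
      by (simp add: eliminates_cycles_without_exits[OF elim wf])
    show "\<exists>\<phi>. bij_betw \<phi> (source_cycles F) (source_cycles (restrict_graph E H))"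
      by (rule bij_betw_ex_trans[OF F(6) bij_betw_ex_trans[OF back1(2) back2(2)]])
  qed
qed

subsection \<open>Invariant basis number from a finite-dimensional representation\<close>

text \<open>Gaussian elimination: the unknowns are indexed by \<open>A\<close> and the equations by
  \<open>B\<close>. A pivot removes one unknown and one equation.\<close>

lemma homogeneous_system_nontrivial:
  fixes M :: "'a \<Rightarrow> 'b \<Rightarrow> 'k::field"
  assumes "finite B" "finite A" "card B < card A"
  shows "\<exists>c. (\<exists>a\<in>A. c a \<noteq> 0) \<and> (\<forall>b\<in>B. (\<Sum>a\<in>A. c a * M a b) = 0)"
  using assms
proof (induction B arbitrary: A M rule: finite_induct)
  case empty
  then have "A \<noteq> {}" by auto
  then show ?case by (intro exI[of _ "\<lambda>_. 1"]) auto
next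
  case (insert b B)
  show ?case
  proof (cases "\<forall>a\<in>A. M a b = 0")
    case True
    have "card B < card A" using insert by simp
    from insert.IH[OF insert.prems(1) this, of M] show ?thesis using True by auto
  next
    case False
    then obtain z where z: "z \<in> A" "M z b \<noteq> 0" by blast
    let ?A = "A - {z}" and ?M = "\<lambda>a b'. M a b' - M a b / M z b * M z b'"
    have "card B < card ?A" using insert z by simp
    from insert.IH[OF _ this, of ?M] insert.prems(1) obtain c where c: "\<exists>a\<in>?A. c a \<noteq> 0"
      "\<And>b'. b' \<in> B \<Longrightarrow> (\<Sum>a\<in>?A. c a * ?M a b') = 0" by auto
    \<comment> \<open>The value at \<open>z\<close> is the one that makes the equation of the pivot
      hold.\<close>
    define d where "d = c(z := - (\<Sum>a\<in>?A. c a * M a b) / M z b)"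
    have sum: "(\<Sum>a\<in>A. d a * M a b') = (\<Sum>a\<in>?A. c a * M a b') - (\<Sum>a\<in>?A. c a * M a b) / M z b * M z b'" for b'
    proof -
      have "(\<Sum>a\<in>A. d a * M a b') = d z * M z b' + (\<Sum>a\<in>?A. d a * M a b')"
        by (rule sum.remove[OF insert.prems(1) z(1)])
      also have "(\<Sum>a\<in>?A. d a * M a b') = (\<Sum>a\<in>?A. c a * M a b')" by (intro sum.cong) (auto simp: d_def)
      finally show ?thesis by (simp add: d_def)
    qed
    have "(\<Sum>a\<in>A. d a * M a b') = 0" if "b' \<in> insert b B" for b'
    proof (cases "b' = b")
      case True
      then show ?thesis using z(2) by (simp add: sum)
    next
      case False
      then have "(\<Sum>a\<in>?A. c a * ?M a b') = 0" using c(2) that by simp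
      then show ?thesis
        by (simp add: sum right_diff_distrib sum_subtractf sum_distrib_right sum_divide_distrib mult.assoc)
    qed
    moreover have "\<exists>a\<in>A. d a \<noteq> 0" using c(1) by (auto simp: d_def)
    ultimately show ?thesis by (intro exI[of _ d]) simp
  qed
qed

text \<open>If there were fewer columns than rows, a nonzero row vector would be annihilated by
  \<open>M\<close>; multiplying by the right inverse would make it zero.\<close>

lemma right_inverse_card_le:
  fixes M :: "'a \<Rightarrow> 'b \<Rightarrow> 'k::field"
  assumes "finite A" "finite B"
    and MN: "\<And>a a'. a \<in> A \<Longrightarrow> a' \<in> A \<Longrightarrow> (\<Sum>b\<in>B. M a b * N b a') = (if a = a' then 1 else 0)"
  shows "card A \<le> card B"
proof (rule ccontr)
  assume "\<not> card A \<le> card B"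
  then have "card B < card A" by simp
  from homogeneous_system_nontrivial[OF assms(2,1) this, of M] obtain c z where c: "z \<in> A" "c z \<noteq> 0"
    "\<And>b. b \<in> B \<Longrightarrow> (\<Sum>a\<in>A. c a * M a b) = 0" by blast
  have "c z = (\<Sum>a\<in>A. c a * (if a = z then 1 else 0))" 
    using assms(1) c(1) by (simp add: if_distrib[of "(*) _"] cong: if_cong)
  also have "\<dots> = (\<Sum>a\<in>A. c a * (\<Sum>b\<in>B. M a b * N b z))" using c(1) MN by (intro sum.cong) auto
  also have "\<dots> = (\<Sum>b\<in>B. (\<Sum>a\<in>A. c a * M a b) * N b z)"
    unfolding sum_distrib_left sum_distrib_right by (subst sum.swap) (simp add: mult.assoc)
  also have "\<dots> = 0" using c(3) by simp
  finally show False using c(2) by simp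
qed

text \<open>A unital ring homomorphism into the matrices over a field with index set
  \<open>S\<close>. Only entries with indices in \<open>S\<close> are meaningful.\<close>

locale matrix_representation = ring R for R :: "('r, 'm) ring_scheme" (structure) +
  fixes \<rho> :: "'r \<Rightarrow> 'p \<Rightarrow> 'p \<Rightarrow> 'k::field" and S :: "'p set"
  assumes S: "finite S" "S \<noteq> {}"
    and \<rho>_add: "x \<in> carrier R \<Longrightarrow> y \<in> carrier R \<Longrightarrow> p \<in> S \<Longrightarrow> q \<in> S \<Longrightarrow> \<rho> (x \<oplus> y) p q = \<rho> x p q + \<rho> y p q"
    and \<rho>_mult: "x \<in> carrier R \<Longrightarrow> y \<in> carrier R \<Longrightarrow> p \<in> S \<Longrightarrow> q \<in> S \<Longrightarrow>
      \<rho> (x \<otimes> y) p q = (\<Sum>r\<in>S. \<rho> x p r * \<rho> y r q)"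
    and \<rho>_one: "p \<in> S \<Longrightarrow> q \<in> S \<Longrightarrow> \<rho> \<one> p q = (if p = q then 1 else 0)"
begin

lemma \<rho>_zero: "p \<in> S \<Longrightarrow> q \<in> S \<Longrightarrow> \<rho> \<zero> p q = 0"
  using \<rho>_add[of \<zero> \<zero> p q] by (metis add_cancel_right_right r_zero zero_closed)

definition unit_vec :: "nat \<Rightarrow> nat \<Rightarrow> nat \<Rightarrow> 'r" where
  "unit_vec m j = (\<lambda>i\<in>{..<m}. if i = j then \<one> else \<zero>)"

lemma unit_vec: "unit_vec m j \<in> free_right_module R m"
  by (auto simp: unit_vec_def free_right_module_def)

text \<open>A map of free right modules is left multiplication by the matrix whose columns are the
  images of the unit vectors. Applying \<rho> to its entries gives a block matrix over the
  field.\<close>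

lemma module_map_matrix:
  assumes into: "\<And>x. x \<in> free_right_module R m \<Longrightarrow> h x \<in> free_right_module R n"
    and add: "\<And>x y. x \<in> free_right_module R m \<Longrightarrow> y \<in> free_right_module R m \<Longrightarrow>
      h (\<lambda>i\<in>{..<m}. x i \<oplus> y i) = (\<lambda>i\<in>{..<n}. h x i \<oplus> h y i)"
    and mult: "\<And>x r. x \<in> free_right_module R m \<Longrightarrow> r \<in> carrier R \<Longrightarrow>
      h (\<lambda>i\<in>{..<m}. x i \<otimes> r) = (\<lambda>i\<in>{..<n}. h x i \<otimes> r)"
    and x: "x \<in> free_right_module R m" and i: "i < n" and pq: "p \<in> S" "q \<in> S"
  shows "\<rho> (h x i) p q = (\<Sum>j<m. \<Sum>r\<in>S. \<rho> (h (unit_vec m j) i) p r * \<rho> (x j) r q)"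
proof -
  let ?M = "free_right_module R m"
  \<comment> \<open>Truncation to the first \<open>l\<close> coordinates. Additivity is available
    for two vectors only, so the coordinates are added one at a time.\<close>
  define tr where "tr l = (\<lambda>i\<in>{..<m}. if i < l then x i else \<zero>)" for l
  have xc: "x j \<in> carrier R" if "j < m" for j using x that by (auto simp: free_right_module_def)
  have hc: "h y i \<in> carrier R" if "y \<in> ?M" for y using into[OF that] i by (auto simp: free_right_module_def)
  have tr: "tr l \<in> ?M" for l using xc by (auto simp: tr_def free_right_module_def)
  have "\<rho> (h (tr l) i) p q = (\<Sum>j<l. \<Sum>r\<in>S. \<rho> (h (unit_vec m j) i) p r * \<rho> (x j) r q)" if "l \<le> m" for l
    using that
  proof (induction l)
    case 0
    \<comment> \<open>The zero vector is its own double, which forces its image to be represented by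
      0.\<close>
    have "tr 0 = (\<lambda>i\<in>{..<m}. tr 0 i \<oplus> tr 0 i)" by (auto simp: tr_def)
    then have "h (tr 0) i = h (tr 0) i \<oplus> h (tr 0) i"
      using add[OF tr tr, of 0 0] i by (metis lessThan_iff restrict_apply')
    then have "\<rho> (h (tr 0) i) p q = \<rho> (h (tr 0) i) p q + \<rho> (h (tr 0) i) p q"
      using \<rho>_add[OF hc[OF tr] hc[OF tr] pq, of 0 0] by simp
    then have "\<rho> (h (tr 0) i) p q = 0" by (simp only: add_cancel_right_right)
    then show ?case by simp
  next
    case (Suc l)
    let ?y = "\<lambda>i\<in>{..<m}. unit_vec m l i \<otimes> x l"
    have xl: "x l \<in> carrier R" using xc Suc.prems by simp
    have y: "?y \<in> ?M" using xl by (auto simp: unit_vec_def free_right_module_def)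
    have "tr (Suc l) = (\<lambda>i\<in>{..<m}. tr l i \<oplus> ?y i)"
    proof
      fix k
      consider "\<not> k < m" | "k < m" "k < l" | "k < m" "k = l" | "k < m" "l < k" by linarith
      then show "tr (Suc l) k = (\<lambda>i\<in>{..<m}. tr l i \<oplus> ?y i) k"
        by cases (use xc xl in \<open>simp_all add: tr_def unit_vec_def\<close>)
    qed
    then have "h (tr (Suc l)) i = h (tr l) i \<oplus> h (unit_vec m l) i \<otimes> x l"
      using add[OF tr y, of l] mult[OF unit_vec xl, of l] i by simp
    then have "\<rho> (h (tr (Suc l)) i) p q = \<rho> (h (tr l) i) p q + (\<Sum>r\<in>S. \<rho> (h (unit_vec m l) i) p r * \<rho> (x l) r q)"
      using \<rho>_add[OF hc[OF tr] m_closed[OF hc[OF unit_vec] xl] pq] \<rho>_mult[OF hc[OF unit_vec] xl pq] by simp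
    then show ?case using Suc by simp
  qed
  moreover have "tr m = x"
  proof
    fix k
    show "tr m k = x k"
      using PiE_arb[OF x[unfolded free_right_module_def], of k] by (cases "k < m") (simp_all add: tr_def)
  qed
  ultimately show ?thesis by (metis (no_types) order_refl)
qed

text \<open>Preimages of the unit vectors provide a right inverse of the block matrix of
  \<open>h\<close>. This bounds \<open>n * card S\<close> by \<open>m * card S\<close>, and the
  nonempty \<open>S\<close> can be cancelled.\<close>

lemma surjective_module_map_rank_le:
  assumes bij: "bij_betw h (free_right_module R m) (free_right_module R n)"
    and add: "\<And>x y. x \<in> free_right_module R m \<Longrightarrow> y \<in> free_right_module R m \<Longrightarrow>
      h (\<lambda>i\<in>{..<m}. x i \<oplus> y i) = (\<lambda>i\<in>{..<n}. h x i \<oplus> h y i)"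
    and mult: "\<And>x r. x \<in> free_right_module R m \<Longrightarrow> r \<in> carrier R \<Longrightarrow>
      h (\<lambda>i\<in>{..<m}. x i \<otimes> r) = (\<lambda>i\<in>{..<n}. h x i \<otimes> r)"
  shows "n \<le> m"
proof -
  have into: "h x \<in> free_right_module R n" if "x \<in> free_right_module R m" for x
    using bij that by (auto simp: bij_betw_def)
  define g where "g k = inv_into (free_right_module R m) h (unit_vec n k)" for k
  have "unit_vec n k \<in> h ` free_right_module R m" for k using bij unit_vec[of n k] by (simp add: bij_betw_def)
  then have g: "g k \<in> free_right_module R m" "h (g k) = unit_vec n k" for k
    unfolding g_def by (simp_all add: inv_into_into f_inv_into_f)
  let ?M = "\<lambda>(i, p) (j, r). \<rho> (h (unit_vec m j) i) p r" and ?N = "\<lambda>(j, r) (k, q). \<rho> (g k j) r q"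
  have "card ({..<n} \<times> S) \<le> card ({..<m} \<times> S)"
  proof (rule right_inverse_card_le[where M = ?M and N = ?N])
    fix a a' assume aa: "a \<in> {..<n} \<times> S" "a' \<in> {..<n} \<times> S"
    obtain i p k q where a: "a = (i, p)" "a' = (k, q)" by (cases a, cases a')
    have ik: "i < n" "p \<in> S" "k < n" "q \<in> S" using aa a by auto
    have "(\<Sum>b\<in>{..<m} \<times> S. ?M a b * ?N b a') = (\<Sum>j<m. \<Sum>r\<in>S. \<rho> (h (unit_vec m j) i) p r * \<rho> (g k j) r q)"
      by (simp add: a sum.cartesian_product case_prod_beta)
    also have "\<dots> = \<rho> (h (g k) i) p q"
      by (rule module_map_matrix[OF into add mult g(1) ik(1,2,4), symmetric])
    also have "\<dots> = (if a = a' then 1 else 0)"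
      using ik by (auto simp: g a unit_vec_def \<rho>_one \<rho>_zero)
    finally show "(\<Sum>b\<in>{..<m} \<times> S. ?M a b * ?N b a') = (if a = a' then 1 else 0)" .
  qed (use S in auto)
  then show ?thesis using S by (simp add: card_cartesian_product card_gt_0_iff)
qed

lemma free_right_modules_isomorphic_sym:
  assumes "free_right_modules_isomorphic R m n"
  shows "free_right_modules_isomorphic R n m"
proof -
  let ?M = "free_right_module R m" and ?N = "free_right_module R n"
  obtain h where h: "bij_betw h ?M ?N"
    and add: "\<And>x y. x \<in> ?M \<Longrightarrow> y \<in> ?M \<Longrightarrow> h (\<lambda>i\<in>{..<m}. x i \<oplus> y i) = (\<lambda>i\<in>{..<n}. h x i \<oplus> h y i)"
    and mult: "\<And>x r. x \<in> ?M \<Longrightarrow> r \<in> carrier R \<Longrightarrow> h (\<lambda>i\<in>{..<m}. x i \<otimes> r) = (\<lambda>i\<in>{..<n}. h x i \<otimes> r)"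
    using assms unfolding free_right_modules_isomorphic_def by blast
  let ?g = "inv_into ?M h"
  have g: "?g x \<in> ?M" "h (?g x) = x" if "x \<in> ?N" for x
    using h that by (auto simp: bij_betw_def inv_into_into f_inv_into_f)
  have inv: "?g (h y) = y" if "y \<in> ?M" for y using h that by (simp add: bij_betw_def)
  show ?thesis
    unfolding free_right_modules_isomorphic_def
  proof (intro exI[of _ ?g] conjI ballI)
    show "bij_betw ?g ?N ?M" by (rule bij_betw_inv_into[OF h])
    fix x y assume xy: "x \<in> ?N" "y \<in> ?N"
    have "(\<lambda>i\<in>{..<m}. ?g x i \<oplus> ?g y i) \<in> ?M" using g(1)[OF xy(1)] g(1)[OF xy(2)] by (auto simp: free_right_module_def)
    from inv[OF this] show "?g (\<lambda>i\<in>{..<n}. x i \<oplus> y i) = (\<lambda>i\<in>{..<m}. ?g x i \<oplus> ?g y i)"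
      using add[OF g(1) g(1), OF xy] g(2) xy by simp
  next
    fix x r assume x: "x \<in> ?N" "r \<in> carrier R"
    have "(\<lambda>i\<in>{..<m}. ?g x i \<otimes> r) \<in> ?M" using g(1)[OF x(1)] x(2) by (auto simp: free_right_module_def)
    from inv[OF this] show "?g (\<lambda>i\<in>{..<n}. x i \<otimes> r) = (\<lambda>i\<in>{..<m}. ?g x i \<otimes> r)"
      using mult[OF g(1) x(2), OF x(1)] g(2)[OF x(1)] by simp
  qed
qed

theorem invariant_basis_number: "invariant_basis_number R"
proof -
  have "n \<le> m" if "free_right_modules_isomorphic R m n" for m n
    using that unfolding free_right_modules_isomorphic_def by (auto intro: surjective_module_map_rank_le)
  then show ?thesis
    unfolding invariant_basis_number_def using free_right_modules_isomorphic_sym by (metis le_antisym)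
qed

end

subsection \<open>The representation on the paths into a sink\<close>

locale sink_paths = fin_digraph E for E :: "('v, 'e) pre_digraph" +
  fixes K :: "'k::field itself" and z :: 'v
  assumes z: "z \<in> verts E" "out_arcs E z = {}"
    and finite_paths: "finite {(x, p). awalk x p z}"
begin

text \<open>The starting vertex is carried along, so that vertices and edges can act without
  inspecting the edge list.\<close>

definition S :: "('v \<times> 'e list) set" where
  "S = {(x, p). awalk x p z}"

text \<open>Edges are prepended and ghost edges strip the first edge. Every generator sends a basis
  path to a basis path or to the zero vector, which is represented by \<open>None\<close>.\<close>

fun gact :: "('v, 'e) leavitt_gen \<Rightarrow> 'v \<times> 'e list \<Rightarrow> ('v \<times> 'e list) option" where
  "gact (Vertex x) (y, p) = (if x = y then Some (y, p) else None)"
| "gact (Edge a) (y, p) = (if a \<in> arcs E \<and> head E a = y then Some (tail E a, a # p) else None)"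
| "gact (Ghost a) (y, b # p) = (if a = b then Some (head E a, p) else None)"
| "gact (Ghost a) (y, []) = None"

lemma gact_S: "s \<in> S \<Longrightarrow> gact x s = Some s' \<Longrightarrow> s' \<in> S"
  by (cases "(x, s)" rule: gact.cases) (auto simp: S_def awalk_simps split: if_splits)

fun wact :: "('v, 'e) leavitt_gen list \<Rightarrow> 'v \<times> 'e list \<Rightarrow> ('v \<times> 'e list) option" where
  "wact [] s = Some s"
| "wact (x # xs) s = Option.bind (wact xs s) (gact x)"

lemma wact_append: "wact (xs @ ys) s = Option.bind (wact ys s) (wact xs)"
  by (induction xs) (auto simp: Option.bind_assoc)

lemma wact_S: "s \<in> S \<Longrightarrow> wact xs s = Some s' \<Longrightarrow> s' \<in> S"
  by (induction xs arbitrary: s') (auto simp: bind_eq_Some_conv intro: gact_S)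

text \<open>The first index is the row and the second the column of the matrix of the
  action.\<close>

definition \<rho> :: "('v, 'e, 'k) leavitt_poly \<Rightarrow> 'v \<times> 'e list \<Rightarrow> 'v \<times> 'e list \<Rightarrow> 'k" where
  "\<rho> f s s' = (\<Sum>w\<in>Poly_Mapping.keys f. Poly_Mapping.lookup f w * of_bool (wact (letters w) s' = Some s))"

lemma \<rho>_superset:
  assumes "finite W" "Poly_Mapping.keys f \<subseteq> W"
  shows "\<rho> f s s' = (\<Sum>w\<in>W. Poly_Mapping.lookup f w * of_bool (wact (letters w) s' = Some s))"
  unfolding \<rho>_def by (rule sum.mono_neutral_left[OF assms]) (simp add: not_in_keys_iff_lookup_eq_zero)

lemma \<rho>_add: "\<rho> (f + g) s s' = \<rho> f s s' + \<rho> g s s'"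
proof -
  let ?W = "Poly_Mapping.keys f \<union> Poly_Mapping.keys g"
  have "\<rho> (f + g) s s' = (\<Sum>w\<in>?W. Poly_Mapping.lookup (f + g) w * of_bool (wact (letters w) s' = Some s))"
    using keys_add[of f g] by (intro \<rho>_superset) auto
  then show ?thesis
    by (simp add: \<rho>_superset[of ?W f] \<rho>_superset[of ?W g] lookup_add distrib_right sum.distrib)
qed

lemma \<rho>_single: "\<rho> (Poly_Mapping.single w c) s s' = c * of_bool (wact (letters w) s' = Some s)"
  by (subst \<rho>_superset[of "{w}"]) auto

lemma \<rho>_0 [simp]: "\<rho> 0 s s' = 0"
  by (simp add: \<rho>_def)

lemma \<rho>_diff: "\<rho> (f - g) s s' = \<rho> f s s' - \<rho> g s s'"
  using \<rho>_add[of "f - g" g s s'] by simp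

lemma \<rho>_sum: "\<rho> (\<Sum>i\<in>I. f i) s s' = (\<Sum>i\<in>I. \<rho> (f i) s s')"
  by (induction I rule: infinite_finite_induct) (simp_all add: \<rho>_add)

text \<open>A composite of two words passes through at most one intermediate path, and this path
  lies in \<open>S\<close> because \<open>S\<close> is invariant.\<close>

lemma \<rho>_mult:
  assumes s': "s' \<in> S"
  shows "\<rho> (f * g) s s' = (\<Sum>r\<in>S. \<rho> f s r * \<rho> g r s')"
proof (induction f rule: poly_mapping_single_induct)
  case (single u a)
  show ?case
  proof (induction g rule: poly_mapping_single_induct)
    case (single w b)
    have "of_bool (wact (letters u @ letters w) s' = Some s) =
        (\<Sum>r\<in>S. of_bool (wact (letters u) r = Some s) * of_bool (wact (letters w) s' = Some r) :: 'k)"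
    proof (cases "wact (letters w) s'")
      case None
      then show ?thesis by (simp add: wact_append)
    next
      case (Some r0)
      have "r0 \<in> S" by (rule wact_S[OF s' Some])
      have "(\<Sum>r\<in>S. of_bool (wact (letters u) r = Some s) * of_bool (wact (letters w) s' = Some r) :: 'k)
          = (\<Sum>r\<in>S. if r0 = r then of_bool (wact (letters u) r = Some s) else 0)"
        by (intro sum.cong) (auto simp: Some)
      then show ?thesis using finite_paths \<open>r0 \<in> S\<close> by (simp add: wact_append Some S_def)
    qed
    then show ?case
      by (simp add: mult_single \<rho>_single sum_distrib_left mult_ac)
  qed (simp_all add: \<rho>_add distrib_left sum.distrib)
qed (simp_all add: \<rho>_add distrib_right sum.distrib)

lemma \<rho>_gen: "\<rho> (gen x) s s' = of_bool (gact x s' = Some s)"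
  by (simp add: gen_def \<rho>_single)

lemma \<rho>_gen_gen: "\<rho> (gen x * gen y) s s' = of_bool (Option.bind (gact y s') (gact x) = Some s)"
  by (simp add: gen_def mult_single \<rho>_single)

text \<open>Relation (4) is where the sink matters. The empty path has no first edge and is killed
  by every product of an edge with its ghost; this is consistent because its vertex \<open>z\<close>
  is not regular.\<close>

lemma \<rho>_relation:
  assumes r: "r \<in> leavitt_relations E" and s': "s' \<in> S"
  shows "\<rho> r s s' = 0"
proof -
  obtain y p where yp: "s' = (y, p)" by (cases s')
  then have walk: "awalk y p z" using s' by (simp add: S_def)
  have ck: "\<rho> (gen (Vertex v) - (\<Sum>a\<in>out_arcs E v. gen (Edge a) * gen (Ghost a))) s s' = 0"
    if v: "is_regular E v" for v
  proof (cases p)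
    case Nil
    then have "y = z" using walk by (simp add: awalk_simps)
    then have "v \<noteq> y" using v z by (auto simp: is_regular_def)
    then show ?thesis by (simp add: \<rho>_diff \<rho>_sum \<rho>_gen \<rho>_gen_gen yp Nil)
  next
    case (Cons a q)
    then have a: "a \<in> arcs E" "tail E a = y" using walk by (simp_all add: awalk_simps)
    \<comment> \<open>On a nonempty path only its first edge contributes: it is stripped and put
      back.\<close>
    have "\<rho> (gen (Edge b) * gen (Ghost b)) s s' = (if b = a then of_bool (s' = s) else 0)"
      if "b \<in> out_arcs E v" for b
      using a by (auto simp: \<rho>_gen_gen yp Cons)
    then have "\<rho> (\<Sum>b\<in>out_arcs E v. gen (Edge b) * gen (Ghost b)) s s' =
        (\<Sum>b\<in>out_arcs E v. if b = a then of_bool (s' = s) else 0)"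
      unfolding \<rho>_sum by (intro sum.cong) simp_all
    also have "\<dots> = (if v = y then of_bool (s' = s) else 0)"
      using v a by (auto simp: is_regular_def)
    finally show ?thesis by (simp add: \<rho>_diff \<rho>_gen yp)
  qed
  show ?thesis
    using r unfolding leavitt_relations_def
    by (elim UnE CollectE exE conjE;
        ((simp only: ck; fail) | (use walk in \<open>cases p; auto simp: \<rho>_diff \<rho>_gen_gen \<rho>_gen yp awalk_simps\<close>)))
qed

lemma \<rho>_ideal:
  assumes "f \<in> leavitt_ideal E" "s \<in> S" "s' \<in> S"
  shows "\<rho> f s s' = 0"
  using assms unfolding leavitt_ideal_def
proof (induction arbitrary: s s' rule: generated_ideal.induct)
  case (scale f k)
  then show ?case by (simp add: scale_eq_mult \<rho>_mult)
qed (simp_all add: \<rho>_relation \<rho>_add \<rho>_mult)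

text \<open>The chosen representative is immaterial on \<open>S\<close>, since the ideal acts as
  zero there.\<close>

definition \<rho>_class :: "('v, 'e, 'k) leavitt_poly set \<Rightarrow> 'v \<times> 'e list \<Rightarrow> 'v \<times> 'e list \<Rightarrow> 'k" where
  "\<rho>_class X = \<rho> (SOME f. f \<in> X)"

lemma \<rho>_class:
  assumes "s \<in> S" "s' \<in> S"
  shows "\<rho>_class (leavitt_class E f) s s' = \<rho> f s s'"
proof -
  have "(SOME g. g \<in> leavitt_class E f) \<in> leavitt_class E f" 
    by (rule someI[where P = "\<lambda>g. g \<in> leavitt_class E f", OF leavitt_class_self])
  then have "(SOME g. g \<in> leavitt_class E f) - f \<in> leavitt_ideal E" by (simp add: leavitt_class_def)
  from \<rho>_ideal[OF this assms] show ?thesis by (simp add: \<rho>_class_def \<rho>_diff)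
qed

theorem leavitt_invariant_basis_number: "invariant_basis_number (leavitt_path_algebra TYPE('k) E)"
proof -
  let ?L = "leavitt_path_algebra TYPE('k) E"
  interpret L: ring ?L by (rule ring_leavitt_path_algebra) unfold_locales
  note ops = leavitt_carrier leavitt_mult[OF wf_digraph] leavitt_add[OF wf_digraph] leavitt_one
  interpret matrix_representation ?L \<rho>_class S
  proof
    show "finite S" using finite_paths by (simp add: S_def)
    have "(z, []) \<in> S" using z by (simp add: S_def awalk_simps)
    then show "S \<noteq> {}" by blast
  next
    fix s s' assume s: "s \<in> S" "s' \<in> S"
    obtain y p where yp: "s' = (y, p)" "y \<in> verts E" using s(2) by (auto simp: S_def)
    have "\<rho>_class \<one>\<^bsub>?L\<^esub> s s' = (\<Sum>v\<in>verts E. if v = y then of_bool (s' = s) else 0)"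
      unfolding ops \<rho>_class[OF s] \<rho>_sum \<rho>_gen by (intro sum.cong) (auto simp: yp)
    then show "\<rho>_class \<one>\<^bsub>?L\<^esub> s s' = (if s = s' then 1 else 0)" using yp(2) by auto
  qed (auto simp: ops \<rho>_class \<rho>_add \<rho>_mult)
  show ?thesis by (rule invariant_basis_number)
qed

end

section \<open>Proof of the two statements\<close>

theorem isolated_invariant_basis_number:
  assumes fin: "fin_digraph E" and process: "source_elimination_process E Es t" and "i \<le> t"
    and isolated: "is_isolated (Es i) v"
  shows "invariant_basis_number (leavitt_path_algebra TYPE('k::field) E)"
proof -
  interpret fin_digraph E by fact
  obtain H where H: "hereditary E H" "Es i = restrict_graph E H"
    and len: "\<And>x p y. awalk x p y \<Longrightarrow> y \<notin> H \<Longrightarrow> length p < i"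
    using process_restrict[OF wf_digraph process \<open>i \<le> t\<close>] by blast
  have v: "is_source (restrict_graph E H) v" "out_arcs (restrict_graph E H) v = {}"
    using isolated by (auto simp: H(2) is_isolated_def is_sink_def)
  note source = restrict_source[OF v(1)]
  \<comment> \<open>The isolated vertex is a source of its stage, so the last edge of a walk into it
    starts at an eliminated vertex, where the strict bound applies to the rest of the walk.\<close>
  have "length p \<le> i" if p: "awalk x p v" for x p
  proof (cases p rule: rev_cases)
    case (snoc q a)
    have a: "awalk x q (tail E a)" "a \<in> arcs E" "head E a = v"
      using p unfolding snoc awalk_append_iff by (auto simp: awalk_simps)
    then have "tail E a \<notin> H" using source(2) by blast
    then show ?thesis using len[OF a(1)] snoc by simp
  qed simp
  then have "{(x, p). awalk x p v} \<subseteq> verts E \<times> {p. set p \<subseteq> arcs E \<and> length p \<le> i}"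
    by (auto simp: awalk_def)
  moreover have "finite (verts E \<times> {p. set p \<subseteq> arcs E \<and> length p \<le> i})"
    by (intro finite_cartesian_product finite_lists_length_le finite_verts finite_arcs)
  ultimately have "finite {(x, p). awalk x p v}" by (rule finite_subset)
  \<comment> \<open>Elimination never removes an edge that leaves a surviving vertex, so a sink of
    the stage is a sink of \<open>E\<close>.\<close>
  moreover have "out_arcs E v = {}"
  proof -
    have "out_arcs E v = out_arcs (restrict_graph E H) v" using source(1) by (auto simp: out_arcs_def)
    then show ?thesis using v(2) by simp
  qed
  moreover have "v \<in> verts E" using source(1) H(1) by (auto simp: hereditary_def)
  ultimately interpret sink_paths E "TYPE('k)" v by unfold_locales
  show ?thesis by (rule leavitt_invariant_basis_number)
qed

theorem theorem3p10:
  fixes E :: "('v, 'e) pre_digraph"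
    and Es :: "nat \<Rightarrow> ('v, 'e) pre_digraph"
    and t :: nat
  assumes "fin_digraph E"
    and "verts E \<noteq> {}"
    and "source_elimination_process E Es t"
  shows "((\<exists>i\<le>t. \<exists>v. is_isolated (Es i) v) \<longrightarrow>
            invariant_basis_number (leavitt_path_algebra TYPE('k::field) E)) \<and>
         ((\<forall>i\<le>t. \<nexists>v. is_isolated (Es i) v) \<longrightarrow>
            (\<exists>F :: (nat, nat) pre_digraph.
               fin_digraph F \<and> verts F \<noteq> {} \<and> source_free F \<and>
               algebra_isomorphic (leavitt_path_algebra TYPE('k) E) (leavitt_path_algebra TYPE('k) F) \<and>
               (\<exists>\<phi>. bij_betw \<phi> (cycles_without_exits F) (cycles_without_exits E)) \<and>
               (\<exists>\<psi>. bij_betw \<psi> (source_cycles F) (source_cycles (Es t)))))"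
proof (intro conjI impI)
  assume "\<exists>i\<le>t. \<exists>v. is_isolated (Es i) v"
  then show "invariant_basis_number (leavitt_path_algebra TYPE('k) E)"
    using isolated_invariant_basis_number[OF assms(1,3)] by blast
next
  assume no_isolated: "\<forall>i\<le>t. \<nexists>v. is_isolated (Es i) v"
  have wf: "wf_digraph E" using assms(1) by (rule wf_digraph_fin)
  obtain H where H: "Es t = restrict_graph E H" using process_restrict[OF wf assms(3) order_refl] by blast
  have elim: "eliminates E (verts (Es t)) \<and> verts (Es t) \<noteq> {}"
    using process_eliminates[OF wf assms(2,3) _ order_refl] no_isolated by blast
  \<comment> \<open>Excludes the exceptional way of stopping, so the final graph is genuinely
    source-free.\<close>
  have "\<not> trivial_graph (Es (t - 1))"
  proof
    assume "trivial_graph (Es (t - 1))"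
    then have "\<exists>v. is_isolated (Es (t - 1)) v"
      by (auto simp: trivial_graph_def is_isolated_def is_source_def is_sink_def in_arcs_def out_arcs_def)
    then show False using no_isolated by (metis diff_le_self)
  qed
  then have "source_free (Es t)" using assms(3) by (simp add: source_elimination_process_def)
  then show "\<exists>F :: (nat, nat) pre_digraph. fin_digraph F \<and> verts F \<noteq> {} \<and> source_free F \<and>
      algebra_isomorphic (leavitt_path_algebra TYPE('k) E) (leavitt_path_algebra TYPE('k) F) \<and>
      (\<exists>\<phi>. bij_betw \<phi> (cycles_without_exits F) (cycles_without_exits E)) \<and>
      (\<exists>\<psi>. bij_betw \<psi> (source_cycles F) (source_cycles (Es t)))"
    using eliminates_source_free_model[OF assms(1), of H, where 'k='k] elim by (simp add: H)
qed

end
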